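(* Let $\mathfrak d$ be a finite-dimensional Lie algebra over $\mathbf k$, let $\Gamma$ be a group acting on $\mathfrak d$ by automorphisms, and let $H=U(\mathfrak d)\,\sharp\,\mathbf k[\Gamma]$ be the smash product. Let $L$ be a solvable Lie $H$-pseudoalgebra and $V$ a nonzero $L$-module which is finitely generated over $U(\mathfrak d)$. Then there exists an eigenvector for the action of $L$ on $V$, i.e., there exist $v\in V\setminus\{0\}$ and $\varphi\in\mathrm{Hom}_H(L,H)$ such that $a*v=(\varphi(a)\otimes1)\otimes_Hv$ for all $a\in L$.
   Context: $\mathbf k$ is an algebraically closed field of characteristic $0$; vector spaces and unadorned $\otimes$ are over $\mathbf k$. $H=U(\mathfrak d)\sharp\mathbf k[\Gamma]$ is the Hopf algebra generated by $U(\mathfrak d)$ and $\Gamma$ with $gfg^{-1}=g\cdot f$ for $g\in\Gamma$, $f\in U(\mathfrak d)$, $\Delta(a)=a\otimes1+1\otimes a$ $(a\in\mathfrak d)$, $\Delta(g)=g\otimes g$ $(g\in\Gamma)$; it is cocommutative. $S$ is its antipode. $H^{\otimes n}$ is a right $H$-module via the iterated coproduct. A Lie $H$-pseudoalgebra is a left $H$-module $L$ with a linear map $L\otimes L\to(H\otimes H)\otimes_HL$, $a\otimes b\mapsto[a*b]$, such that $[fa*gb]=((f\otimes g)\otimes_H1)[a*b]$; $[b*a]=-(\sigma\otimes_H\mathrm{id})[a*b]$ ($\sigma$ the flip); and $[a*[b*c]]-((\sigma\otimes\mathrm{id})\otimes_H\mathrm{id})[b*[a*c]]=[[a*b]*c]$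 in $H^{\otimes3}\otimes_HL$. Here, if $[a*b]=\sum_i g_i\otimes_He_i$ and $[e_i*c]=\sum_j(f_{ij}\otimes g_{ij})\otimes_He_{ij}$, then $[[a*b]*c]=\sum(g_i\otimes1)(\Delta(f_{ij})\otimes g_{ij})\otimes_He_{ij}$; if $[b*c]=\sum_i h_i\otimes_Hd_i$ and $[a*d_i]=\sum_j(h_{ij}\otimes l_{ij})\otimes_Hd_{ij}$, then $[a*[b*c]]=\sum(1\otimes h_i)(h_{ij}\otimes\Delta(l_{ij}))\otimes_Hd_{ij}$. An $L$-module is a left $H$-module $V$ with a linear map $L\otimes V\to(H\otimes H)\otimes_HV$, $a\otimes v\mapsto a*v$, such that $fa*gv=((f\otimes g)\otimes_H1)(a*v)$ and $a*(b*v)-((\sigma\otimes\mathrm{id})\otimes_H\mathrm{id})(b*(a*v))=[a*b]*v$ in $H^{\otimes3}\otimes_HV$. Here, if $[a*b]=\sum_i g_i\otimes_He_i$ and $e_i*v=\sum_j(f_{ij}\otimes g_{ij})\otimes_Hv_{ij}$, then $[a*b]*v=\sum(g_i\otimes1)(\Delta(f_{ij})\otimes g_{ij})\otimes_Hv_{ij}$; if $b*v=\sum_i h_i\otimes_Hw_i$ and $a*w_i=\sum_j(h_{ij}\otimes l_{ij})\otimes_Hw_{ij}$, then $a*(b*v)=\sum(1\otimes h_i)(h_{ij}\otimes\Delta(l_{ij}))\otimes_Hw_{ij}$. Solvability: for $x\in X:=H^*$ and $a,b\in L$ write $[a*b]=\sum_i(h_i\otimes1)\otimes_Hc_i$ (always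 possible) and put $[a_xb]=\sum_i\langle x,S(h_i)\rangle c_i$. For $H$-submodules $A,B\subset L$, $[A,B]$ is the span of all $[a_xb]$, $a\in A,b\in B,x\in X$. Put $L^{(0)}=L$, $L^{(n+1)}=[L^{(n)},L^{(n)}]$. $L$ is solvable if $L^{(n)}=0$ for some $n$. *)

theory Defs
  imports "HOL-Library.Poly_Mapping" "HOL-Computational_Algebra.Polynomial"
begin

section \<open>Formal linear combinations and quotients\<close>

text \<open>
  \<open>'x \<Rightarrow>\<^sub>0 'k\<close> is the free vector space on \<open>'x\<close>. All tensor products are built as quotients of
  such spaces: an element of a quotient by a subspace \<open>N\<close> is a coset of \<open>N\<close>, so
  \<open>X \<in> A\<close> reads: the formal sum \<open>X\<close> represents the element \<open>A\<close>.
\<close>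

definition fscale :: "'k::field \<Rightarrow> ('x \<Rightarrow>\<^sub>0 'k) \<Rightarrow> ('x \<Rightarrow>\<^sub>0 'k)" where
  "fscale c X = Poly_Mapping.map (\<lambda>a. c * a) X"

abbreviation basis_vec :: "'x \<Rightarrow> ('x \<Rightarrow>\<^sub>0 'k::field)" where
  "basis_vec x \<equiv> Poly_Mapping.single x 1"

text \<open>The linear extension of \<open>f\<close> to formal sums, with values in a space with scaling \<open>sc\<close>.\<close>

definition lin_ext :: "('k \<Rightarrow> 'm \<Rightarrow> 'm) \<Rightarrow> ('x \<Rightarrow> 'm) \<Rightarrow> ('x \<Rightarrow>\<^sub>0 'k::field) \<Rightarrow> 'm::ab_group_add" where
  "lin_ext sc f X = (\<Sum>x\<in>Poly_Mapping.keys X. sc (Poly_Mapping.lookup X x) (f x))"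

definition coset :: "'x::ab_group_add set \<Rightarrow> 'x \<Rightarrow> 'x set" where
  "coset N X = {Y. Y - X \<in> N}"

definition rep :: "'x set \<Rightarrow> 'x" where
  "rep A = (SOME X. X \<in> A)"

text \<open>Relations forcing linearity in the argument of \<open>plug\<close>, i.e. in one tensor factor.\<close>

definition slot_rels ::
    "('k \<Rightarrow> 'm \<Rightarrow> 'm) \<Rightarrow> ('m::ab_group_add \<Rightarrow> 'x) \<Rightarrow> ('x \<Rightarrow>\<^sub>0 'k::field) set" where
  "slot_rels sc plug =
     {basis_vec (plug (x + y)) - basis_vec (plug x) - basis_vec (plug y) | x y. True} \<union>
     {basis_vec (plug (sc c x)) - fscale c (basis_vec (plug x)) | c x. True}"


section \<open>Lie algebras and universal enveloping algebras\<close>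

locale lie_algebra = vector_space sd
  for sd :: "'k::field \<Rightarrow> 'd::ab_group_add \<Rightarrow> 'd" +
  fixes lb :: "'d \<Rightarrow> 'd \<Rightarrow> 'd"
  assumes lb_linear_right: "Vector_Spaces.linear sd sd (\<lambda>y. lb x y)"
    and lb_linear_left: "Vector_Spaces.linear sd sd (\<lambda>x. lb x y)"
    and lb_self: "lb x x = 0"
    and lb_jacobi: "lb x (lb y z) + lb y (lb z x) + lb z (lb x y) = 0"
begin

text \<open>
  The kernel of the canonical map from the free associative algebra on the set underlying the
  Lie algebra (formal sums of words) onto the universal enveloping algebra: the two-sided ideal
  generated by the linearity relations and by \<open>x y - y x - [x, y]\<close>.
\<close>

definition env_ideal :: "('d list \<Rightarrow>\<^sub>0 'k) set" where
  "env_ideal = module.span fscale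
     ((\<Union>us vs. slot_rels sd (\<lambda>x. us @ [x] @ vs)) \<union>
      {basis_vec (us @ [x, y] @ vs) - basis_vec (us @ [y, x] @ vs)
         - basis_vec (us @ [lb x y] @ vs) | us x y vs. True})"

end

locale lie_group_action =
  lie_algebra sd lb + Gamma: Groups.group gmul gone ginv
  for sd :: "'k::field \<Rightarrow> 'd::ab_group_add \<Rightarrow> 'd" and lb
    and gmul :: "'g \<Rightarrow> 'g \<Rightarrow> 'g" and gone ginv +
  fixes gact :: "'g \<Rightarrow> 'd \<Rightarrow> 'd"
  assumes gact_linear: "Vector_Spaces.linear sd sd (gact g)"
    and gact_lb: "gact g (lb x y) = lb (gact g x) (gact g y)"
    and gact_one: "gact gone x = x"
    and gact_mul: "gact (gmul g h) x = gact g (gact h x)"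


section \<open>Hopf algebras\<close>

locale k_algebra = vector_space scale
  for scale :: "'k::field \<Rightarrow> 'h::ring_1 \<Rightarrow> 'h" +
  assumes scale_mult_left: "scale c x * y = scale c (x * y)"
    and scale_mult_right: "x * scale c y = scale c (x * y)"
begin

text \<open>\<open>H \<otimes> H\<close> and \<open>H \<otimes> H \<otimes> H\<close> consist of the cosets of \<open>rel2\<close> and \<open>rel3\<close>, respectively.\<close>

definition rel2 :: "('h \<times> 'h \<Rightarrow>\<^sub>0 'k) set" where
  "rel2 = module.span fscale
     (\<Union>h. slot_rels scale (\<lambda>x. (x, h)) \<union> slot_rels scale (\<lambda>x. (h, x)))"

definition rel3 :: "('h \<times> 'h \<times> 'h \<Rightarrow>\<^sub>0 'k) set" where
  "rel3 = module.span fscale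
     (\<Union>h h'. slot_rels scale (\<lambda>x. (x, h, h')) \<union> slot_rels scale (\<lambda>x. (h, x, h'))
            \<union> slot_rels scale (\<lambda>x. (h, h', x)))"

text \<open>The image of the tensor algebra of \<open>d\<close> in \<open>H\<close> under the extension of \<open>\<iota> : d \<rightarrow> H\<close>.\<close>

definition word_eval :: "('d \<Rightarrow> 'h) \<Rightarrow> ('d list \<Rightarrow>\<^sub>0 'k) \<Rightarrow> 'h" where
  "word_eval \<iota> X = lin_ext scale (\<lambda>xs. prod_list (map \<iota> xs)) X"

definition generated_subalgebra :: "('d \<Rightarrow> 'h) \<Rightarrow> 'h set" where
  "generated_subalgebra \<iota> = range (word_eval \<iota>)"

end

definition mult2 :: "'h::times \<times> 'h \<Rightarrow> 'h \<times> 'h \<Rightarrow> 'h \<times> 'h" where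
  "mult2 u w = (fst u * fst w, snd u * snd w)"

definition mult3 :: "'h::times \<times> 'h \<times> 'h \<Rightarrow> 'h \<times> 'h \<times> 'h \<Rightarrow> 'h \<times> 'h \<times> 'h" where
  "mult3 u w = (fst u * fst w, fst (snd u) * fst (snd w), snd (snd u) * snd (snd w))"

locale hopf_algebra = k_algebra scale
  for scale :: "'k::field \<Rightarrow> 'h::ring_1 \<Rightarrow> 'h" +
  fixes \<Delta> :: "'h \<Rightarrow> ('h \<times> 'h \<Rightarrow>\<^sub>0 'k) set"
    and \<epsilon> :: "'h \<Rightarrow> 'k"
    and S :: "'h \<Rightarrow> 'h"
  assumes comult_coset: "\<Delta> f \<in> range (coset rel2)"
    and comult_add: "X \<in> \<Delta> f \<Longrightarrow> Y \<in> \<Delta> g \<Longrightarrow> X + Y \<in> \<Delta> (f + g)"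
    and comult_scale: "X \<in> \<Delta> f \<Longrightarrow> fscale c X \<in> \<Delta> (scale c f)"
    and comult_one: "basis_vec (1, 1) \<in> \<Delta> 1"
    and comult_mult: "X \<in> \<Delta> f \<Longrightarrow> Y \<in> \<Delta> g \<Longrightarrow>
          lin_ext fscale (\<lambda>u. lin_ext fscale (\<lambda>w. basis_vec (mult2 u w)) Y) X \<in> \<Delta> (f * g)"
    and coassoc:
          "lin_ext fscale (\<lambda>(p, q). lin_ext fscale (\<lambda>(p1, p2). basis_vec (p1, p2, q)) (rep (\<Delta> p)))
             (rep (\<Delta> f))
         - lin_ext fscale (\<lambda>(p, q). lin_ext fscale (\<lambda>(q1, q2). basis_vec (p, q1, q2)) (rep (\<Delta> q)))
             (rep (\<Delta> f)) \<in> rel3"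
    and counit_linear: "Vector_Spaces.linear scale (*) \<epsilon>"
    and counit_mult: "\<epsilon> (f * g) = \<epsilon> f * \<epsilon> g"
    and counit_one: "\<epsilon> 1 = 1"
    and counit_left: "X \<in> \<Delta> f \<Longrightarrow> lin_ext scale (\<lambda>(p, q). scale (\<epsilon> p) q) X = f"
    and counit_right: "X \<in> \<Delta> f \<Longrightarrow> lin_ext scale (\<lambda>(p, q). scale (\<epsilon> q) p) X = f"
    and antipode_linear: "Vector_Spaces.linear scale scale S"
    and antipode_left: "X \<in> \<Delta> f \<Longrightarrow> lin_ext scale (\<lambda>(p, q). S p * q) X = scale (\<epsilon> f) 1"
    and antipode_right: "X \<in> \<Delta> f \<Longrightarrow> lin_ext scale (\<lambda>(p, q). p * S q) X = scale (\<epsilon> f) 1"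
begin

text \<open>A representative of the iterated coproduct \<open>(\<Delta> \<otimes> id) \<Delta> f\<close>.\<close>

definition comult3_rep :: "'h \<Rightarrow> ('h \<times> 'h \<times> 'h \<Rightarrow>\<^sub>0 'k)" where
  "comult3_rep f =
     lin_ext fscale (\<lambda>(p, q). lin_ext fscale (\<lambda>(p1, p2). basis_vec (p1, p2, q)) (rep (\<Delta> p)))
       (rep (\<Delta> f))"

definition mscale :: "('h \<Rightarrow> 'm \<Rightarrow> 'm) \<Rightarrow> 'k \<Rightarrow> 'm \<Rightarrow> 'm" where
  "mscale act c m = act (scale c 1) m"

text \<open>
  For a left \<open>H\<close>-module \<open>M\<close> with action \<open>act\<close>, the elements of \<open>(H \<otimes> H) \<otimes>\<^sub>H M\<close> are the cosets of
  \<open>rel2M act\<close> and those of \<open>(H \<otimes> H \<otimes> H) \<otimes>\<^sub>H M\<close> are the cosets of \<open>rel3M act\<close>. The relations are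
  \<open>k\<close>-multilinearity and \<open>w \<Delta>(f) \<otimes> m = w \<otimes> f m\<close>, where \<open>\<Delta>\<close> is iterated in the triple case.
\<close>

definition rel2M :: "('h \<Rightarrow> 'm \<Rightarrow> 'm) \<Rightarrow> (('h \<times> 'h) \<times> 'm::ab_group_add \<Rightarrow>\<^sub>0 'k) set" where
  "rel2M act = module.span fscale
     ((\<Union>h m. slot_rels scale (\<lambda>x. ((x, h), m)) \<union> slot_rels scale (\<lambda>x. ((h, x), m))) \<union>
      (\<Union>w. slot_rels (mscale act) (\<lambda>m. (w, m))) \<union>
      {lin_ext fscale (\<lambda>u. basis_vec (mult2 w u, m)) (rep (\<Delta> f)) - basis_vec (w, act f m)
         | w f m. True})"

definition rel3M :: "('h \<Rightarrow> 'm \<Rightarrow> 'm) \<Rightarrow> (('h \<times> 'h \<times> 'h) \<times> 'm::ab_group_add \<Rightarrow>\<^sub>0 'k) set" where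
  "rel3M act = module.span fscale
     ((\<Union>h h' m. slot_rels scale (\<lambda>x. ((x, h, h'), m)) \<union> slot_rels scale (\<lambda>x. ((h, x, h'), m))
              \<union> slot_rels scale (\<lambda>x. ((h, h', x), m))) \<union>
      (\<Union>w. slot_rels (mscale act) (\<lambda>m. (w, m))) \<union>
      {lin_ext fscale (\<lambda>u. basis_vec (mult3 w u, m)) (comult3_rep f) - basis_vec (w, act f m)
         | w f m. True})"

text \<open>
  The two ways of composing pseudoproducts, on representatives. If \<open>X\<close> represents \<open>[a * b]\<close> and
  \<open>F e\<close> represents \<open>e * v\<close>, then \<open>nest_left F X\<close> represents \<open>[a * b] * v\<close>; if \<open>X\<close> represents
  \<open>b * v\<close> and \<open>F w\<close> represents \<open>a * w\<close>, then \<open>nest_right F X\<close> represents \<open>a * (b * v)\<close>.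
\<close>

definition nest_left ::
  "('e \<Rightarrow> (('h \<times> 'h) \<times> 'm \<Rightarrow>\<^sub>0 'k)) \<Rightarrow> (('h \<times> 'h) \<times> 'e \<Rightarrow>\<^sub>0 'k)
     \<Rightarrow> (('h \<times> 'h \<times> 'h) \<times> 'm \<Rightarrow>\<^sub>0 'k)" where
  "nest_left F X =
     lin_ext fscale (\<lambda>((p, q), e).
       lin_ext fscale (\<lambda>((r, s), u).
         lin_ext fscale (\<lambda>(r1, r2). basis_vec ((p * r1, q * r2, s), u)) (rep (\<Delta> r)))
       (F e)) X"

definition nest_right ::
  "('e \<Rightarrow> (('h \<times> 'h) \<times> 'm \<Rightarrow>\<^sub>0 'k)) \<Rightarrow> (('h \<times> 'h) \<times> 'e \<Rightarrow>\<^sub>0 'k)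
     \<Rightarrow> (('h \<times> 'h \<times> 'h) \<times> 'm \<Rightarrow>\<^sub>0 'k)" where
  "nest_right F X =
     lin_ext fscale (\<lambda>((p, q), e).
       lin_ext fscale (\<lambda>((r, s), u).
         lin_ext fscale (\<lambda>(s1, s2). basis_vec ((r, p * s1, q * s2), u)) (rep (\<Delta> s)))
       (F e)) X"

definition flip :: "(('h \<times> 'h) \<times> 'm \<Rightarrow>\<^sub>0 'k) \<Rightarrow> (('h \<times> 'h) \<times> 'm \<Rightarrow>\<^sub>0 'k)" where
  "flip X = lin_ext fscale (\<lambda>((p, q), u). basis_vec ((q, p), u)) X"

definition flip12 ::
  "(('h \<times> 'h \<times> 'h) \<times> 'm \<Rightarrow>\<^sub>0 'k) \<Rightarrow> (('h \<times> 'h \<times> 'h) \<times> 'm \<Rightarrow>\<^sub>0 'k)" where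
  "flip12 X = lin_ext fscale (\<lambda>((p, q, r), u). basis_vec ((q, p, r), u)) X"

end


section \<open>Smash products\<close>

text \<open>
  The Hopf algebra \<open>H\<close> is (a model of) the smash product of \<open>U(d)\<close> and the group algebra: \<open>\<iota>\<close>
  identifies \<open>U(d)\<close>, as presented by \<open>env_ideal\<close>, with the subalgebra generated by the image of
  \<open>d\<close>, and multiplication identifies \<open>U(d) \<otimes> k[\<Gamma>]\<close>, i.e. the finitely supported
  \<open>U(d)\<close>-valued functions on the group, with \<open>H\<close>. The values of \<open>\<Delta>\<close> on generators determine
  \<open>\<Delta>\<close>, and hence \<open>\<epsilon>\<close> and \<open>S\<close>.
\<close>

locale smash_product =
  d: lie_group_action sd lb gmul gone ginv gact + hopf_algebra scale \<Delta> \<epsilon> S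
  for sd :: "'k::field \<Rightarrow> 'd::ab_group_add \<Rightarrow> 'd" and lb
    and gmul :: "'g \<Rightarrow> 'g \<Rightarrow> 'g" and gone ginv gact
    and scale :: "'k \<Rightarrow> 'h::ring_1 \<Rightarrow> 'h" and \<Delta> \<epsilon> S +
  fixes \<iota> :: "'d \<Rightarrow> 'h" and \<gamma> :: "'g \<Rightarrow> 'h"
  assumes enveloping: "{X. word_eval \<iota> X = 0} = d.env_ideal"
    and gamma_one: "\<gamma> gone = 1"
    and gamma_mult: "\<gamma> (gmul g h) = \<gamma> g * \<gamma> h"
    and gamma_iota: "\<gamma> g * \<iota> x * \<gamma> (ginv g) = \<iota> (gact g x)"
    and decomposition:
      "\<exists>!u :: 'g \<Rightarrow>\<^sub>0 'h.
         (\<forall>g. Poly_Mapping.lookup u g \<in> generated_subalgebra \<iota>) \<and>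
         f = (\<Sum>g\<in>Poly_Mapping.keys u. Poly_Mapping.lookup u g * \<gamma> g)"
    and comult_iota: "\<Delta> (\<iota> x) = coset rel2 (basis_vec (\<iota> x, 1) + basis_vec (1, \<iota> x))"
    and comult_gamma: "\<Delta> (\<gamma> g) = coset rel2 (basis_vec (\<gamma> g, \<gamma> g))"


section \<open>Lie pseudoalgebras and their modules\<close>

locale left_module =
  fixes act :: "'h::ring_1 \<Rightarrow> 'm::ab_group_add \<Rightarrow> 'm"
  assumes act_add_right: "act f (x + y) = act f x + act f y"
    and act_add_left: "act (f + g) x = act f x + act g x"
    and act_mult: "act (f * g) x = act f (act g x)"
    and act_one: "act 1 x = x"

definition left_module_hom ::
    "('h \<Rightarrow> 'm \<Rightarrow> 'm) \<Rightarrow> ('h \<Rightarrow> 'n \<Rightarrow> 'n) \<Rightarrow> ('m::plus \<Rightarrow> 'n::plus) \<Rightarrow> bool" where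
  "left_module_hom act act' \<phi> \<longleftrightarrow>
     (\<forall>x y. \<phi> (x + y) = \<phi> x + \<phi> y) \<and> (\<forall>f x. \<phi> (act f x) = act' f (\<phi> x))"

definition finitely_generated_over :: "'h set \<Rightarrow> ('h \<Rightarrow> 'm \<Rightarrow> 'm::ab_group_add) \<Rightarrow> bool" where
  "finitely_generated_over R act \<longleftrightarrow>
     (\<exists>B. finite B \<and> (\<forall>v. \<exists>c. (\<forall>b\<in>B. c b \<in> R) \<and> v = (\<Sum>b\<in>B. act (c b) b)))"

text \<open>A bilinear map \<open>A \<otimes> M \<rightarrow> (H \<otimes> H) \<otimes>\<^sub>H M\<close> with \<open>f a * g m = ((f \<otimes> g) \<otimes>\<^sub>H 1) (a * m)\<close>.\<close>

locale pseudo_map =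
  hopf_algebra scale \<Delta> \<epsilon> S + A: left_module actA + M: left_module actM
  for scale :: "'k::field \<Rightarrow> 'h::ring_1 \<Rightarrow> 'h" and \<Delta> \<epsilon> S
    and actA :: "'h \<Rightarrow> 'a::ab_group_add \<Rightarrow> 'a"
    and actM :: "'h \<Rightarrow> 'm::ab_group_add \<Rightarrow> 'm" +
  fixes \<beta> :: "'a \<Rightarrow> 'm \<Rightarrow> (('h \<times> 'h) \<times> 'm \<Rightarrow>\<^sub>0 'k) set"
  assumes pseudo_coset: "\<beta> a m \<in> range (coset (rel2M actM))"
    and pseudo_add_left: "X \<in> \<beta> a m \<Longrightarrow> Y \<in> \<beta> b m \<Longrightarrow> X + Y \<in> \<beta> (a + b) m"
    and pseudo_add_right: "X \<in> \<beta> a m \<Longrightarrow> Y \<in> \<beta> a n \<Longrightarrow> X + Y \<in> \<beta> a (m + n)"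
    and pseudo_scale_left: "X \<in> \<beta> a m \<Longrightarrow> fscale c X \<in> \<beta> (mscale actA c a) m"
    and pseudo_scale_right: "X \<in> \<beta> a m \<Longrightarrow> fscale c X \<in> \<beta> a (mscale actM c m)"
    and pseudo_act: "X \<in> \<beta> a m \<Longrightarrow>
      lin_ext fscale (\<lambda>(w, u). basis_vec (mult2 (f, g) w, u)) X \<in> \<beta> (actA f a) (actM g m)"

locale lie_pseudoalgebra =
  pseudo_map scale \<Delta> \<epsilon> S actL actL br
  for scale :: "'k::field \<Rightarrow> 'h::ring_1 \<Rightarrow> 'h" and \<Delta> \<epsilon> S
    and actL :: "'h \<Rightarrow> 'l::ab_group_add \<Rightarrow> 'l" and br +
  assumes pseudo_skew: "X \<in> br a b \<Longrightarrow> - flip X \<in> br b a"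
    and pseudo_jacobi:
      "nest_right (\<lambda>e. rep (br a e)) (rep (br b c))
       - flip12 (nest_right (\<lambda>e. rep (br b e)) (rep (br a c)))
       - nest_left (\<lambda>e. rep (br e c)) (rep (br a b)) \<in> rel3M actL"
begin

text \<open>
  \<open>[a\<^sub>x b] = \<Sum>\<^sub>i \<langle>x, S(h\<^sub>i)\<rangle> c\<^sub>i\<close>, where \<open>\<Sum>\<^sub>i h\<^sub>i \<otimes> c\<^sub>i\<close> is any formal sum \<open>Y\<close> such that
  \<open>[a * b] = \<Sum>\<^sub>i (h\<^sub>i \<otimes> 1) \<otimes>\<^sub>H c\<^sub>i\<close>; the result does not depend on its choice.
\<close>

definition x_bracket :: "'l \<Rightarrow> ('h \<Rightarrow> 'k) \<Rightarrow> 'l \<Rightarrow> 'l" where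
  "x_bracket a x b =
     lin_ext (mscale actL) (\<lambda>(h, c). mscale actL (x (S h)) c)
       (SOME Y. lin_ext fscale (\<lambda>(h, c). basis_vec ((h, 1), c)) Y \<in> br a b)"

definition bracket_span :: "'l set \<Rightarrow> 'l set \<Rightarrow> 'l set" where
  "bracket_span A B = module.span (mscale actL)
     {x_bracket a x b | a x b. a \<in> A \<and> b \<in> B \<and> Vector_Spaces.linear scale (*) x}"

primrec derived :: "nat \<Rightarrow> 'l set" where
  "derived 0 = UNIV"
| "derived (Suc n) = bracket_span (derived n) (derived n)"

definition solvable :: bool where
  "solvable \<longleftrightarrow> (\<exists>n. derived n = {0})"

end

locale lie_pseudoalgebra_module =
  L: lie_pseudoalgebra scale \<Delta> \<epsilon> S actL br + V: pseudo_map scale \<Delta> \<epsilon> S actL actV mact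
  for scale :: "'k::field \<Rightarrow> 'h::ring_1 \<Rightarrow> 'h" and \<Delta> \<epsilon> S
    and actL :: "'h \<Rightarrow> 'l::ab_group_add \<Rightarrow> 'l" and br
    and actV :: "'h \<Rightarrow> 'v::ab_group_add \<Rightarrow> 'v" and mact +
  assumes module_jacobi:
    "L.nest_right (\<lambda>w. rep (mact a w)) (rep (mact b v))
     - L.flip12 (L.nest_right (\<lambda>w. rep (mact b w)) (rep (mact a v)))
     - L.nest_left (\<lambda>e. rep (mact e v)) (rep (br a b)) \<in> L.rel3M actV"

end

theory Submission
  imports Defs "HOL-Library.FuncSet"
begin

text \<open>
  Straightening \<open>(p \<otimes> q) \<otimes>\<^sub>H v = \<Sum> (p S q\<^sub>1 \<otimes> 1) \<otimes>\<^sub>H q\<^sub>2 v\<close> identifies \<open>(H \<otimes> H) \<otimes>\<^sub>H V\<close> with \<open>H \<otimes> V\<close>. Hence the action of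
  \<open>a \<in> L\<close> is encoded in the operators \<open>op a x\<close> on \<open>V\<close>, where \<open>x\<close> runs through the linear functionals on \<open>H\<close>, and an
  eigenvector for the pseudo-action is the same as a common eigenvector of all these operators. The
  commutator of \<open>op a x\<close> and \<open>op b y\<close> is a sum of operators attached to elements of \<open>[L, L]\<close>
  (\<open>commutator_op\<close>), so the operators of \<open>L\<close> form a solvable Lie algebra of endomorphisms of the
  possibly infinite-dimensional space \<open>V\<close>. As in the classical theorem of Lie, a common eigenvector is found by going
  up the derived series. Let \<open>A\<close> be a term of the series, \<open>A'\<close> the next one, and \<open>W\<close> the weight
  space of a common eigenvector of \<open>A'\<close>.

  Finite-dimensionality comes from finite generation: the vectors \<open>v\<close> for which the coefficients of \<open>a * v\<close> in
  \<open>H\<close> stay in a fixed finite-dimensional space form a space that is finite-dimensional modulo the kernel of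
  \<open>a\<close> (\<open>fin_dim_bounded_coefficients\<close>). If the weight is zero, the operators of \<open>A\<close> commute on \<open>W\<close>, and some
  \<open>op a x\<close> maps such a space onto a nonzero finite-dimensional stable subspace of \<open>W\<close>, unless all of them vanish
  on \<open>W\<close>. If the weight is nonzero, \<open>W\<close> itself is finite-dimensional, and it remains to
  show that \<open>W\<close> is stable under \<open>A\<close> and that \<open>A\<close> acts on it by commuting operators.

  Both claims follow from one observation about Heisenberg relations: if operators \<open>q\<close> kill a vector
  \<open>w\<close> and have scalar commutators, up to operators that again kill \<open>w\<close>, with creation operators \<open>X\<^sub>1, \<dots>, X\<^sub>m\<close>, and if
  this pairing is nondegenerate, then the ordered monomials in the \<open>X\<^sub>i\<close> applied to \<open>w\<close> are linearly independent in
  characteristic \<open>0\<close>. An operator that does not preserve \<open>W\<close> would join a basis of the image of \<open>d\<close>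
  in \<open>H\<close> as an additional creation operator, and the monomials would grow faster than a finitely
  generated \<open>U(d)\<close>-module can (\<open>weight_space_stable\<close>). On a stable \<open>W\<close>, a nonzero commutator would make \<open>W\<close>
  infinite-dimensional (\<open>weight_space_commute\<close>). That the pairing is nondegenerate follows in turn from the
  independence of the powers of a nonzero primitive element of \<open>H\<close>, a third instance of the same
  observation (\<open>primitive_fin_dim_stable\<close>).
\<close>

section \<open>Linear algebra\<close>

text \<open>
  The bare linearity identities, without the claim that both sides are vector spaces. Multilinearity
  of an expression is then a simplification problem.
\<close>

definition lin ::
    "('k \<Rightarrow> 'a \<Rightarrow> 'a) \<Rightarrow> ('k \<Rightarrow> 'b \<Rightarrow> 'b) \<Rightarrow> ('a::ab_group_add \<Rightarrow> 'b::ab_group_add) \<Rightarrow> bool" where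
  "lin s t f \<longleftrightarrow> (\<forall>x y. f (x + y) = f x + f y) \<and> (\<forall>c x. f (s c x) = t c (f x))"

lemma linI:
  "(\<And>x y. f (x + y) = f x + f y) \<Longrightarrow> (\<And>c x. f (s c x) = t c (f x)) \<Longrightarrow> lin s t f"
  by (simp add: lin_def)

lemma lin_add: "lin s t f \<Longrightarrow> f (x + y) = f x + f y"
  and lin_scale: "lin s t f \<Longrightarrow> f (s c x) = t c (f x)"
  by (simp_all add: lin_def)

lemma lin_zero: "lin s t f \<Longrightarrow> f 0 = 0"
  using lin_add[of s t f 0 0] by simp

lemma lin_neg: "lin s t f \<Longrightarrow> f (- x) = - f x"
  using lin_add[of s t f x "- x"] lin_zero[of s t f] by (simp add: eq_neg_iff_add_eq_0 add.commute)

lemma lin_diff: "lin s t f \<Longrightarrow> f (x - y) = f x - f y"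
  using lin_add[of s t f x "- y"] lin_neg[of s t f y] by simp

lemma lin_sum: "lin s t f \<Longrightarrow> f (sum g A) = (\<Sum>x\<in>A. f (g x))"
  by (induct A rule: infinite_finite_induct) (auto simp: lin_zero lin_add)

lemma lin_compose: "lin s t f \<Longrightarrow> lin t u g \<Longrightarrow> lin s u (\<lambda>x. g (f x))"
  by (simp add: lin_def)

lemma lin_ident: "lin s s (\<lambda>x. x)"
  by (simp add: lin_def)

lemma lin_imp_linear:
  "vector_space s \<Longrightarrow> vector_space t \<Longrightarrow> lin s t f \<Longrightarrow> Vector_Spaces.linear s t f"
  by (simp add: Vector_Spaces.linear_iff lin_def)

lemma linear_imp_lin: "Vector_Spaces.linear s t f \<Longrightarrow> lin s t f"
  by (simp add: Vector_Spaces.linear_iff lin_def)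

lemma vector_space_mult: "vector_space ((*) :: 'k::field \<Rightarrow> 'k \<Rightarrow> 'k)"
  by unfold_locales (auto simp: algebra_simps)

lemma lookup_fscale: "Poly_Mapping.lookup (fscale c X) x = c * Poly_Mapping.lookup X x"
  by (simp add: fscale_def Poly_Mapping.map.rep_eq when_def)

interpretation fs: vector_space "fscale :: 'k::field \<Rightarrow> ('x \<Rightarrow>\<^sub>0 'k) \<Rightarrow> ('x \<Rightarrow>\<^sub>0 'k)"
  by unfold_locales
    (auto intro!: poly_mapping_eqI simp: lookup_fscale lookup_add algebra_simps)

lemma keys_fscale: "Poly_Mapping.keys (fscale c X) \<subseteq> Poly_Mapping.keys X"
  by (auto simp: in_keys_iff lookup_fscale)

context vector_space
begin

lemma lin_ext_superset:
  assumes "finite A" "Poly_Mapping.keys X \<subseteq> A"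
  shows "lin_ext scale f X = (\<Sum>x\<in>A. scale (Poly_Mapping.lookup X x) (f x))"
  unfolding lin_ext_def using assms
  by (intro sum.mono_neutral_left) (auto simp: in_keys_iff)

lemma lin_lin_ext:
  fixes f :: "'x \<Rightarrow> 'b"
  shows "lin fscale scale (lin_ext scale f)"
proof (rule linI)
  fix X Y :: "'x \<Rightarrow>\<^sub>0 'a" and c
  let ?A = "Poly_Mapping.keys X \<union> Poly_Mapping.keys Y"
  have "lin_ext scale f (X + Y) = (\<Sum>x\<in>?A. scale (Poly_Mapping.lookup (X + Y) x) (f x))"
    by (rule lin_ext_superset) (auto simp: keys_add)
  also have "\<dots> = lin_ext scale f X + lin_ext scale f Y"
    by (simp add: lin_ext_superset[of ?A] lookup_add scale_left_distrib sum.distrib)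
  finally show "lin_ext scale f (X + Y) = lin_ext scale f X + lin_ext scale f Y" .
  show "lin_ext scale f (fscale c X) = scale c (lin_ext scale f X)"
    by (subst lin_ext_superset[of "Poly_Mapping.keys X"])
       (auto simp: lin_ext_def lookup_fscale scale_sum_right keys_fscale[THEN subsetD])
qed

lemma lin_ext_single: "lin_ext scale f (Poly_Mapping.single x c) = scale c (f x)"
  by (subst lin_ext_superset[of "{x}"]) (auto simp: lookup_single)

lemma lin_ext_basis [simp]: "lin_ext scale f (basis_vec x) = f x"
  by (simp add: lin_ext_single)

lemma lin_ext_zero [simp]: "lin_ext scale f 0 = 0"
  by (simp add: lin_ext_def)

lemmas lin_ext_add = lin_add[OF lin_lin_ext]
  and lin_ext_fscale = lin_scale[OF lin_lin_ext]
  and lin_ext_diff = lin_diff[OF lin_lin_ext]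

lemma lin_ext_fun_add:
  "lin_ext scale (\<lambda>x. f x + g x) X = lin_ext scale f X + lin_ext scale g X"
  by (simp add: lin_ext_def scale_right_distrib sum.distrib)

lemma lin_ext_fun_scale:
  "lin_ext scale (\<lambda>x. scale c (f x)) X = scale c (lin_ext scale f X)"
  by (simp add: lin_ext_def scale_sum_right ac_simps)

lemma lin_ext_mem:
  "subspace S \<Longrightarrow> (\<And>x. x \<in> Poly_Mapping.keys X \<Longrightarrow> f x \<in> S) \<Longrightarrow> lin_ext scale f X \<in> S"
  unfolding lin_ext_def by (intro subspace_sum subspace_scale) auto

lemma lin_ext_vanishes_on_span:
  assumes "X \<in> fs.span G" and "\<And>Y. Y \<in> G \<Longrightarrow> lin_ext scale f Y = 0"
  shows "lin_ext scale f X = 0"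
  using assms(1)
proof (induct rule: fs.span_induct_alt)
  case (step c Y Z)
  then show ?case by (simp add: lin_ext_add lin_ext_fscale assms(2))
qed simp

lemma lin_ext_slot_rels:
  assumes "lin s scale (\<lambda>x. f (plug x))" and "Y \<in> slot_rels s plug"
  shows "lin_ext scale f Y = 0"
  using assms by (auto simp: slot_rels_def lin_ext_diff lin_ext_fscale lin_def)

end

lemma lin_lin_ext_apply:
  assumes "vector_space t" and "lin s t g"
  shows "g (lin_ext s f X) = lin_ext t (\<lambda>x. g (f x)) X"
  unfolding lin_ext_def by (simp add: lin_sum[OF assms(2)] lin_scale[OF assms(2)])

lemma (in vector_space) lin_ext_lin_ext:
  "lin_ext scale f (lin_ext fscale F X) = lin_ext scale (\<lambda>x. lin_ext scale f (F x)) X"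
  by (rule lin_lin_ext_apply[OF vector_space_axioms lin_lin_ext])

lemma (in vector_space) lin_ext_swap:
  "lin_ext scale (\<lambda>x. lin_ext scale (f x) Y) X = lin_ext scale (\<lambda>y. lin_ext scale (\<lambda>x. f x y) X) Y"
  unfolding lin_ext_def
  by (simp add: scale_sum_right) (subst sum.swap, simp add: mult.commute)

definition fin_dim :: "('k::field \<Rightarrow> 'v \<Rightarrow> 'v) \<Rightarrow> 'v::ab_group_add set \<Rightarrow> bool" where
  "fin_dim sc S \<longleftrightarrow> (\<exists>T. finite T \<and> S \<subseteq> module.span sc T)"

context vector_space
begin

text \<open>
  All tensor products are quotients of spaces of formal sums. Membership of a formal sum in the
  subspace of relations is proved with functionals that vanish on the relations.
\<close>

lemma functional_separates:
  assumes "subspace N" "v \<notin> N"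
  obtains l where "lin scale (*) l" "\<And>u. u \<in> N \<Longrightarrow> l u = 0" "l v = 1"
proof -
  interpret p: vector_space_pair scale "(*) :: 'a \<Rightarrow> 'a \<Rightarrow> 'a"
    by (intro vector_space_pair.intro vector_space_axioms vector_space_mult)
  obtain B where B: "B \<subseteq> N" "independent B" "N \<subseteq> span B"
    by (rule maximal_independent_subset)
  have sB: "span B = N" by (rule span_subspace) (use assms B in auto)
  have "independent (insert v B)" using B sB assms by (intro independent_insertI) auto
  then obtain l where l: "Vector_Spaces.linear scale (*) l"
      "\<And>x. x \<in> insert v B \<Longrightarrow> l x = (if x = v then 1 else 0)"
    using p.linear_independent_extend[of "insert v B" "\<lambda>x. if x = v then 1 else 0"] by blast
  have "l u = 0" if "u \<in> N" for u
    by (rule p.linear_eq_0_on_span[OF l(1), of B]) (use that l(2) B sB assms in auto)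
  with l show thesis by (intro that[of l]) (auto intro: linear_imp_lin)
qed

lemma functional_nonzero:
  assumes "v \<noteq> 0" obtains l where "lin scale (*) l" "l v = 1"
  using functional_separates[of "{0}" v] assms by auto

lemma functionals_separate:
  assumes "\<And>l. lin scale (*) l \<Longrightarrow> l u = l v" shows "u = v"
proof (rule ccontr)
  assume "u \<noteq> v"
  then obtain l where "lin scale (*) l" "l (u - v) = 1" using functional_nonzero[of "u - v"] by auto
  with assms[of l] show False by (simp add: lin_diff)
qed

text \<open>
  The coordinates are defined on the whole space, so they can be contracted with any tensor. They are
  coordinates with respect to a basis of the space that extends \<open>E\<close>.
\<close>

lemma finite_coordinates:
  assumes "finite T"
  obtains E x where "finite E" "E \<subseteq> T" "\<And>e. e \<in> E \<Longrightarrow> lin scale (*) (x e)"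
    "\<And>h. h \<in> span T \<Longrightarrow> h = (\<Sum>e\<in>E. scale (x e h) e)"
    "\<And>e e'. e \<in> E \<Longrightarrow> e' \<in> E \<Longrightarrow> x e e' = (if e = e' then 1 else 0)"
proof -
  obtain E where E: "E \<subseteq> T" "independent E" "T \<subseteq> span E" by (rule maximal_independent_subset)
  define B where "B = extend_basis E"
  have B: "independent B" "span B = UNIV" "E \<subseteq> B"
    using E by (auto simp: B_def independent_extend_basis extend_basis_superset)
  have fin: "finite E" using E assms by (auto intro: finite_subset)
  have sp: "span T = span E" using E by (metis span_eq span_superset subset_trans)
  define x where "x = (\<lambda>e h. representation B h e)"
  have xl: "lin scale (*) (x e)" for e
    unfolding x_def by (rule linear_imp_lin[OF linear_representation]) (use B in auto)
  have xe: "x e e' = (if e = e' then 1 else 0)" if "e' \<in> E" for e e'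
    unfolding x_def using representation_basis[of B e'] that B by auto
  have "h = (\<Sum>e\<in>E. scale (x e h) e)" if "h \<in> span T" for h
  proof -
    from that have "h \<in> span E" by (simp add: sp)
    then obtain u where u: "h = (\<Sum>e\<in>E. scale (u e) e)" using span_finite[OF fin] by auto
    have "x e h = u e" if "e \<in> E" for e
      using that fin unfolding u lin_sum[OF xl] lin_scale[OF xl]
      by (simp add: xe if_distrib cong: if_cong)
    then show ?thesis unfolding u by (simp cong: sum.cong)
  qed
  with fin E xl xe show thesis by (intro that[of E x]) auto
qed

text \<open>
  A formal sum \<open>Y\<close> of pairs stands for a tensor in \<open>H \<otimes> U\<close>. Writing the left factors in a finite basis
  \<open>E\<close> turns it into \<open>\<Sum>e\<in>E. e \<otimes> u\<^sub>e\<close>, where \<open>u\<^sub>e\<close> is the contraction with the coordinate \<open>x e\<close>.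
\<close>

lemma tensor_expand:
  assumes t: "vector_space t"
    and 1: "\<And>u. lin scale t (\<lambda>h. \<beta> h u)" and 2: "\<And>h. lin sc t (\<beta> h)"
    and E: "\<And>h. h \<in> fst ` Poly_Mapping.keys Y \<Longrightarrow> h = (\<Sum>e\<in>E. scale (x e h) e)"
  shows "lin_ext t (\<lambda>(h, u). \<beta> h u) Y = (\<Sum>e\<in>E. \<beta> e (lin_ext sc (\<lambda>(h, u). sc (x e h) u) Y))"
proof -
  interpret m: vector_space t by fact
  let ?c = "Poly_Mapping.lookup Y"
  have "lin_ext t (\<lambda>(h, u). \<beta> h u) Y
      = (\<Sum>z\<in>Poly_Mapping.keys Y. \<Sum>e\<in>E. t (?c z) (t (x e (fst z)) (\<beta> e (snd z))))"
    unfolding lin_ext_def case_prod_unfold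
  proof (rule sum.cong[OF refl])
    fix z assume "z \<in> Poly_Mapping.keys Y"
    then have "fst z = (\<Sum>e\<in>E. scale (x e (fst z)) e)" by (intro E) auto
    then have "\<beta> (fst z) (snd z) = \<beta> (\<Sum>e\<in>E. scale (x e (fst z)) e) (snd z)" by (rule arg_cong)
    also have "\<dots> = (\<Sum>e\<in>E. t (x e (fst z)) (\<beta> e (snd z)))"
      by (simp only: lin_sum[OF 1] lin_scale[OF 1])
    finally show "t (?c z) (\<beta> (fst z) (snd z)) = (\<Sum>e\<in>E. t (?c z) (t (x e (fst z)) (\<beta> e (snd z))))"
      by (simp add: m.scale_sum_right)
  qed
  also have "\<dots> = (\<Sum>e\<in>E. \<beta> e (lin_ext sc (\<lambda>(h, u). sc (x e h) u) Y))"
    by (subst sum.swap) (simp add: lin_ext_def case_prod_unfold lin_sum[OF 2] lin_scale[OF 2])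
  finally show ?thesis .
qed

lemma tensor_zero:
  assumes t: "vector_space t"
    and 1: "\<And>u. lin scale t (\<lambda>h. \<beta> h u)" and 2: "\<And>h. lin sc t (\<beta> h)"
    and 0: "\<And>x. lin scale (*) x \<Longrightarrow> lin_ext sc (\<lambda>(h, u). sc (x h) u) Y = 0"
  shows "lin_ext t (\<lambda>(h, u). \<beta> h u) Y = 0"
proof -
  have "finite (fst ` Poly_Mapping.keys Y)" by simp
  then obtain E x where E: "finite E" "\<And>e. e \<in> E \<Longrightarrow> lin scale (*) (x e)"
    "\<And>h. h \<in> span (fst ` Poly_Mapping.keys Y) \<Longrightarrow> h = (\<Sum>e\<in>E. scale (x e h) e)"
    by (rule finite_coordinates) blast
  have "lin_ext t (\<lambda>(h, u). \<beta> h u) Y = (\<Sum>e\<in>E. \<beta> e (lin_ext sc (\<lambda>(h, u). sc (x e h) u) Y))"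
    by (rule tensor_expand[OF t 1 2 E(3)[OF span_base]])
  also have "\<dots> = 0" by (intro sum.neutral ballI) (simp add: 0 E(2) lin_zero[OF 2])
  finally show ?thesis .
qed

lemma fin_dim_mono: "fin_dim scale S \<Longrightarrow> R \<subseteq> S \<Longrightarrow> fin_dim scale R"
  by (auto simp: fin_dim_def)

lemma fin_dim_span_finite: "finite T \<Longrightarrow> fin_dim scale (span T)"
  by (auto simp: fin_dim_def)

lemma many_vectors_dependent:
  assumes "finite T" "finite I" "card T < card I" "\<And>i. i \<in> I \<Longrightarrow> f i \<in> span T"
  obtains c i where "(\<Sum>i\<in>I. scale (c i) (f i)) = 0" "i \<in> I" "c i \<noteq> 0"
proof (cases "inj_on f I")
  case True
  have "dependent (f ` I)"
  proof (rule ccontr)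
    assume "independent (f ` I)"
    with independent_span_bound[of T "f ` I"] assms have "card (f ` I) \<le> card T" by auto
    with assms(3) card_image[OF True] show False by simp
  qed
  with assms(2) obtain u v where u: "(\<Sum>v\<in>f ` I. scale (u v) v) = 0" "v \<in> f ` I" "u v \<noteq> 0"
    using dependent_finite[of "f ` I"] by auto
  then obtain i where "i \<in> I" "v = f i" by auto
  with u show thesis
    by (intro that[of "\<lambda>i. u (f i)" i]) (auto simp: sum.reindex[OF True])
next
  case False
  then obtain i j where ij: "i \<in> I" "j \<in> I" "i \<noteq> j" "f i = f j" by (auto simp: inj_on_def)
  define c where "c = (\<lambda>k. if k = i then 1 else if k = j then - 1 else 0 :: 'a)"
  have "(\<Sum>k\<in>I. scale (c k) (f k)) = (\<Sum>k\<in>{i,j}. scale (c k) (f k))"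
    by (rule sum.mono_neutral_right) (use ij assms in \<open>auto simp: c_def\<close>)
  also have "\<dots> = 0" using ij by (simp add: c_def)
  finally show thesis by (intro that[of c i]) (use ij in \<open>auto simp: c_def\<close>)
qed

text \<open>
  Induction on the number of maps: \<open>F\<close> is spanned, modulo the kernel of one of the maps, by finitely
  many preimages of a basis of its image.
\<close>

lemma fin_dim_image_of_joint_kernel:
  assumes F: "subspace F" and J: "finite J" and g: "\<And>j. j \<in> J \<Longrightarrow> lin scale scale (g j)"
    and im: "\<And>j v. j \<in> J \<Longrightarrow> v \<in> F \<Longrightarrow> g j v \<in> span B" and B: "finite B"
    and T: "lin scale scale T"
    and ker: "\<And>v. v \<in> F \<Longrightarrow> (\<And>j. j \<in> J \<Longrightarrow> g j v = 0) \<Longrightarrow> T v = 0"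
  shows "fin_dim scale (T ` F)"
  using F J g im ker
proof (induct "card J" arbitrary: J F)
  case 0
  then have "T ` F \<subseteq> {0}" by auto
  then show ?case by (auto simp: fin_dim_def intro!: exI[of _ "{}"])
next
  case (Suc n)
  from Suc(2,4) obtain j where j: "j \<in> J" by (metis card_eq_0_iff ex_in_conv nat.simps(3))
  define F' where "F' = {v \<in> F. g j v = 0}"
  have F': "subspace F'"
    using Suc(3) Suc(5)[OF j]
    by (auto simp: F'_def subspace_def lin_add lin_scale lin_zero)
  have "fin_dim scale (T ` F')"
  proof (rule Suc(1)[of "J - {j}"])
    show "n = card (J - {j})" using Suc(2,4) j by simp
    show "T v = 0" if "v \<in> F'" "\<And>i. i \<in> J - {j} \<Longrightarrow> g i v = 0" for v
      using that Suc(7)[of v] by (auto simp: F'_def)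
  qed (use Suc F' in \<open>auto simp: F'_def\<close>)
  then obtain R where R: "finite R" "T ` F' \<subseteq> span R" by (auto simp: fin_dim_def)
  \<comment> \<open>A finite set of preimages of a basis of \<open>g j ` F\<close> spans \<open>F\<close> modulo \<open>F'\<close>.\<close>
  obtain C where C: "C \<subseteq> g j ` F" "independent C" "g j ` F \<subseteq> span C"
    by (rule maximal_independent_subset)
  have fC: "finite C" using independent_span_bound[of B C] B C Suc(6)[OF j] by blast
  have "\<forall>c\<in>C. \<exists>v\<in>F. g j v = c" using C by auto
  then obtain p where p: "\<And>c. c \<in> C \<Longrightarrow> p c \<in> F \<and> g j (p c) = c" by metis
  have "T v \<in> span (R \<union> (\<lambda>c. T (p c)) ` C)" if v: "v \<in> F" for v
  proof -
    from v C have "g j v \<in> span C" by auto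
    then obtain u where u: "g j v = (\<Sum>c\<in>C. scale (u c) c)" using span_finite[OF fC] by auto
    define v0 where "v0 = (\<Sum>c\<in>C. scale (u c) (p c))"
    have v0: "v0 \<in> F" unfolding v0_def using p Suc(3)
      by (intro subspace_sum subspace_scale) auto
    have "g j v0 = g j v"
      unfolding v0_def u lin_sum[OF Suc(5)[OF j]] lin_scale[OF Suc(5)[OF j]]
      by (rule sum.cong) (auto simp: p)
    then have "v - v0 \<in> F'" using v v0 Suc(3) lin_diff[OF Suc(5)[OF j]]
      by (auto simp: F'_def subspace_diff)
    then have 1: "T (v - v0) \<in> span (R \<union> (\<lambda>c. T (p c)) ` C)"
      using R span_mono[of R "R \<union> (\<lambda>c. T (p c)) ` C"] by blast
    have 2: "T v0 \<in> span (R \<union> (\<lambda>c. T (p c)) ` C)"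
      unfolding v0_def lin_sum[OF T] lin_scale[OF T]
      by (intro span_sum span_scale span_base) auto
    from span_add[OF 1 2] show ?thesis by (simp add: lin_diff[OF T])
  qed
  with R fC show ?case by (auto simp: fin_dim_def intro!: exI[of _ "R \<union> (\<lambda>c. T (p c)) ` C"])
qed

end

section \<open>Common eigenvectors of commuting operators\<close>

definition poly_op :: "('k \<Rightarrow> 'v \<Rightarrow> 'v) \<Rightarrow> ('v \<Rightarrow> 'v) \<Rightarrow> 'v \<Rightarrow> 'k::field poly \<Rightarrow> 'v::ab_group_add" where
  "poly_op sc T z p = (\<Sum>i\<le>degree p. sc (coeff p i) ((T ^^ i) z))"

context vector_space
begin

lemma poly_op_superset:
  "degree p \<le> n \<Longrightarrow> poly_op scale T z p = (\<Sum>i\<le>n. scale (coeff p i) ((T ^^ i) z))"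
  unfolding poly_op_def by (rule sum.mono_neutral_left) (auto simp: coeff_eq_0)

lemma poly_op_add: "poly_op scale T z (p + q) = poly_op scale T z p + poly_op scale T z q"
  using degree_add_le_max[of p q]
  by (simp add: poly_op_superset[of _ "max (degree p) (degree q)"] scale_left_distrib sum.distrib)

lemma poly_op_smult: "poly_op scale T z (smult c p) = scale c (poly_op scale T z p)"
  by (simp add: poly_op_superset[of _ "degree p"] degree_smult_le scale_sum_right)

lemma poly_op_pCons_0:
  assumes "lin scale scale T"
  shows "poly_op scale T z (pCons 0 p) = T (poly_op scale T z p)"
proof -
  have "poly_op scale T z (pCons 0 p) = (\<Sum>i\<le>Suc (degree p). scale (coeff (pCons 0 p) i) ((T ^^ i) z))"
    by (rule poly_op_superset) (simp add: degree_pCons_le)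
  also have "\<dots> = T (poly_op scale T z p)"
    by (simp add: sum.atMost_Suc_shift poly_op_def lin_sum[OF assms] lin_scale[OF assms]
        del: sum.atMost_Suc)
  finally show ?thesis .
qed

end

text \<open>
  Fix a nonzero \<open>z\<close> in \<open>Z\<close> and a nonzero polynomial \<open>p\<close> of least degree with \<open>p(T) z = 0\<close>. It has a root \<open>\<alpha>\<close>;
  if \<open>p = (t - \<alpha>) r\<close>, then \<open>r(T) z\<close> is an eigenvector.
\<close>

lemma eigenvector_exists:
  fixes sc :: "'k::alg_closed_field \<Rightarrow> 'v::ab_group_add \<Rightarrow> 'v"
  assumes "vector_space sc" and T: "lin sc sc T"
    and Z: "\<And>z. z \<in> Z \<Longrightarrow> T z \<in> Z" "module.subspace sc Z" "fin_dim sc Z" and z: "z \<in> Z" "z \<noteq> 0"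
  obtains \<alpha> u where "u \<in> Z" "u \<noteq> 0" "T u = sc \<alpha> u"
proof -
  interpret vector_space sc by fact
  from Z(3) obtain B where B: "finite B" "Z \<subseteq> span B" by (auto simp: fin_dim_def)
  have TZ: "(T ^^ i) z \<in> Z" for i by (induct i) (use z Z in auto)
  have mem: "poly_op sc T z p \<in> Z" for p
    unfolding poly_op_def using Z(2) TZ by (intro subspace_sum subspace_scale) auto
  obtain c i where c: "(\<Sum>i\<in>{..card B}. sc (c i) ((T ^^ i) z)) = 0" "i \<in> {..card B}" "c i \<noteq> 0"
    by (rule many_vectors_dependent[of B "{..card B}" "\<lambda>i. (T ^^ i) z"]) (use B TZ in auto)
  define q where "q = (\<Sum>i\<le>card B. monom (c i) i)"
  have cq: "coeff q j = (if j \<le> card B then c j else 0)" for j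
    by (simp add: q_def coeff_sum if_distrib cong: if_cong)
  have "degree q \<le> card B" by (rule degree_le) (simp add: cq)
  then have "poly_op sc T z q = (\<Sum>i\<le>card B. sc (coeff q i) ((T ^^ i) z))" by (rule poly_op_superset)
  also have "\<dots> = 0" using c(1) by (simp add: cq)
  finally have "q \<noteq> 0 \<and> poly_op sc T z q = 0" using c cq[of i] by auto
  then obtain p where p: "p \<noteq> 0" "poly_op sc T z p = 0"
    and min: "\<And>r. degree r < degree p \<Longrightarrow> r \<noteq> 0 \<Longrightarrow> poly_op sc T z r \<noteq> 0"
    using ex_has_least_nat[of "\<lambda>p. p \<noteq> 0 \<and> poly_op sc T z p = 0" q degree]
    by (metis (mono_tags, lifting) linorder_not_le)
  have "degree p > 0"
  proof (rule ccontr)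
    assume "\<not> degree p > 0"
    then obtain a where "p = [:a:]" by (metis degree_eq_zeroE not_gr0)
    with p z show False by (simp add: poly_op_def)
  qed
  then obtain \<alpha> where "poly p \<alpha> = 0" using alg_closed_imp_poly_has_root by blast
  then obtain r where r: "p = [:- \<alpha>, 1:] * r" by (metis dvdE poly_eq_0_iff_dvd)
  with p have r0: "r \<noteq> 0" by auto
  then have "degree p = Suc (degree r)" unfolding r by (subst degree_mult_eq) auto
  with min[of r] r0 have u0: "poly_op sc T z r \<noteq> 0" by simp
  have "p = pCons 0 r + smult (- \<alpha>) r" unfolding r by simp
  then have "poly_op sc T z p = T (poly_op sc T z r) + sc (- \<alpha>) (poly_op sc T z r)"
    by (simp only: poly_op_add poly_op_smult poly_op_pCons_0[OF T])
  with p(2) have "T (poly_op sc T z r) = sc \<alpha> (poly_op sc T z r)" by simp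
  with u0 mem show thesis by (intro that) auto
qed

text \<open>
  Induction on the dimension of \<open>Z\<close>: if some operator is not a scalar on \<open>Z\<close>, one of its eigenspaces in \<open>Z\<close>
  is a proper subspace, and it is stable under all operators of the family.
\<close>

lemma common_eigenvector_of_commuting:
  fixes sc :: "'k::alg_closed_field \<Rightarrow> 'v::ab_group_add \<Rightarrow> 'v"
  assumes vs: "vector_space sc" and lin: "\<And>T. T \<in> \<T> \<Longrightarrow> lin sc sc T"
    and stable: "\<And>T z. T \<in> \<T> \<Longrightarrow> z \<in> Z \<Longrightarrow> T z \<in> Z"
    and comm: "\<And>T T' z. T \<in> \<T> \<Longrightarrow> T' \<in> \<T> \<Longrightarrow> z \<in> Z \<Longrightarrow> T (T' z) = T' (T z)"
    and Z: "module.subspace sc Z" "fin_dim sc Z" "\<exists>z\<in>Z. z \<noteq> 0"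
  shows "\<exists>u\<in>Z. u \<noteq> 0 \<and> (\<forall>T\<in>\<T>. \<exists>\<alpha>. T u = sc \<alpha> u)"
proof -
  interpret vector_space sc by fact
  from Z(2) obtain B where "finite B" "Z \<subseteq> span B" by (auto simp: fin_dim_def)
  then have bound: "finite C \<and> card C \<le> card B" if "C \<subseteq> Z" "independent C" for C
    using independent_span_bound[of B C] that by auto
  show ?thesis using stable comm Z
  proof (induct "dim Z" arbitrary: Z rule: less_induct)
    case less
    show ?case
    proof (cases "\<forall>T\<in>\<T>. \<exists>\<alpha>. \<forall>z\<in>Z. T z = sc \<alpha> z")
      case True
      then show ?thesis using less(6) by blast
    next
      case False
      then obtain T where T: "T \<in> \<T>" and nT: "\<And>\<alpha>. \<exists>z\<in>Z. T z \<noteq> sc \<alpha> z" by blast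
      obtain \<alpha> u where u: "u \<in> Z" "u \<noteq> 0" "T u = sc \<alpha> u"
        using eigenvector_exists[OF vs lin[OF T], of Z] less(2,4-6) T by metis
      define Z' where "Z' = {z \<in> Z. T z = sc \<alpha> z}"
      have sub: "subspace Z'" using less(4) lin[OF T]
        by (auto simp: Z'_def subspace_def lin_zero lin_add lin_scale scale_right_distrib mult.commute)
      obtain z where z: "z \<in> Z" "z \<notin> Z'" using nT[of \<alpha>] by (auto simp: Z'_def)
      have "dim Z' < dim Z"
      proof -
        from less(5) obtain R where R: "finite R" "Z \<subseteq> span R" by (auto simp: fin_dim_def)
        obtain C where C: "C \<subseteq> Z'" "independent C" "Z' \<subseteq> span C" "card C = dim Z'"
          by (rule basis_exists)
        have sC: "span C = Z'" by (rule span_subspace) (use C sub in auto)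
        have i: "independent (insert z C)" using z C sC by (intro independent_insertI) auto
        have sZ: "insert z C \<subseteq> Z" using z C by (auto simp: Z'_def)
        obtain D where D: "D \<subseteq> Z" "independent D" "Z \<subseteq> span D" "card D = dim Z"
          by (rule basis_exists)
        have fD: "finite D" using independent_span_bound[of R D] R D by auto
        have "finite (insert z C) \<and> card (insert z C) \<le> card D"
          by (rule independent_span_bound) (use fD i sZ D in auto)
        moreover have "z \<notin> C" using z C by auto
        ultimately show ?thesis using C(4) D(4) card_insert_disjoint[of C z] by auto
      qed
      then have "\<exists>u\<in>Z'. u \<noteq> 0 \<and> (\<forall>T\<in>\<T>. \<exists>\<alpha>. T u = sc \<alpha> u)"
      proof (rule less(1))
        show "S v \<in> Z'" if "S \<in> \<T>" "v \<in> Z'" for S v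
          using that less(2)[of S v] less(3)[OF T \<open>S \<in> \<T>\<close>, of v] lin_scale[OF lin[OF that(1)]]
          by (auto simp: Z'_def)
        show "S (S' v) = S' (S v)" if "S \<in> \<T>" "S' \<in> \<T>" "v \<in> Z'" for S S' v
          using that less(3) by (auto simp: Z'_def)
        show "fin_dim sc Z'" by (rule fin_dim_mono[OF less(5)]) (auto simp: Z'_def)
      qed (use sub u in \<open>auto simp: Z'_def\<close>)
      then show ?thesis by (auto simp: Z'_def)
    qed
  qed
qed

section \<open>Operators satisfying Heisenberg relations\<close>

definition short_words :: "('k::field \<Rightarrow> 'v \<Rightarrow> 'v) \<Rightarrow> (nat \<Rightarrow> 'v \<Rightarrow> 'v) \<Rightarrow> nat \<Rightarrow> 'v \<Rightarrow> nat \<Rightarrow> 'v::ab_group_add set" where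
  "short_words sc X m w n = module.span sc {foldr X us w | us. set us \<subseteq> {..<m} \<and> length us < n}"

text \<open>
  The derivation with \<open>X i \<mapsto> \<delta> i\<close>, applied to the word \<open>us\<close>.
\<close>

definition deletions :: "('k::field \<Rightarrow> 'v \<Rightarrow> 'v) \<Rightarrow> (nat \<Rightarrow> 'v \<Rightarrow> 'v) \<Rightarrow> 'v \<Rightarrow> (nat \<Rightarrow> 'k) \<Rightarrow> nat list \<Rightarrow> 'v::ab_group_add" where
  "deletions sc X w \<delta> us =
     (\<Sum>p<length us. sc (\<delta> (us ! p)) (foldr X (take p us @ drop (Suc p) us) w))"

text \<open>
  The operators \<open>X i\<close> and those in \<open>\<Q>\<close> play the roles of creation and annihilation operators on a Fock space
  with vacuum vector \<open>w\<close>. Commutators are scalars only up to \<open>\<Q>\<close>, which is harmless because \<open>\<Q>\<close> kills \<open>w\<close>.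
\<close>

locale heisenberg = vector_space sc
  for sc :: "'k::field_char_0 \<Rightarrow> 'v::ab_group_add \<Rightarrow> 'v" +
  fixes X :: "nat \<Rightarrow> 'v \<Rightarrow> 'v" and m :: nat and \<Q> :: "('v \<Rightarrow> 'v) set" and w :: 'v
  assumes creation_lin: "i < m \<Longrightarrow> lin sc sc (X i)"
    and annihilation_lin: "q \<in> \<Q> \<Longrightarrow> lin sc sc q"
    and annihilates: "q \<in> \<Q> \<Longrightarrow> q w = 0"
    and commutator: "q \<in> \<Q> \<Longrightarrow> i < m \<Longrightarrow>
          \<exists>c. \<exists>q'\<in>\<Q>. \<forall>v. q (X i v) = X i (q v) + sc c v + q' v"
begin

abbreviation "U \<equiv> short_words sc X m w"
abbreviation "D \<equiv> deletions sc X w"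

lemma U_sub: "subspace (U n)"
  by (simp add: short_words_def)

lemma U_word: "set us \<subseteq> {..<m} \<Longrightarrow> length us < n \<Longrightarrow> foldr X us w \<in> U n"
  unfolding short_words_def by (intro span_base) auto

lemma U_mono: "n \<le> n' \<Longrightarrow> U n \<subseteq> U n'"
  unfolding short_words_def by (intro span_mono) auto

lemma U_induct:
  assumes "v \<in> U n" and f: "lin sc sc f" and S: "subspace S"
    and "\<And>us. set us \<subseteq> {..<m} \<Longrightarrow> length us < n \<Longrightarrow> f (foldr X us w) \<in> S"
  shows "f v \<in> S"
  using assms(1) unfolding short_words_def
proof (induct rule: span_induct_alt)
  case base
  show ?case using S by (simp add: lin_zero[OF f] subspace_0)
next
  case (step c x y)
  then show ?case using S assms(4) by (auto simp: lin_add[OF f] lin_scale[OF f] intro!: subspace_add subspace_scale)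
qed

lemma creation_U:
  assumes "i < m" "v \<in> U n" shows "X i v \<in> U (Suc n)"
proof (rule U_induct[OF assms(2) creation_lin[OF assms(1)] U_sub])
  fix us assume "set us \<subseteq> {..<m}" "length us < n"
  then show "X i (foldr X us w) \<in> U (Suc n)" using U_word[of "i # us" "Suc n"] assms(1) by simp
qed

lemma deletions_Nil [simp]: "D \<delta> [] = 0"
  by (simp add: deletions_def)

lemma deletions_Cons:
  assumes "i < m"
  shows "D \<delta> (i # us) = sc (\<delta> i) (foldr X us w) + X i (D \<delta> us)"
  unfolding deletions_def
  by (simp add: sum.lessThan_Suc_shift lin_sum[OF creation_lin[OF assms]] lin_scale[OF creation_lin[OF assms]]
        del: sum.lessThan_Suc)

lemma deletions_U: "set us \<subseteq> {..<m} \<Longrightarrow> D \<delta> us \<in> U (length us)"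
proof (induct us)
  case (Cons i us)
  then show ?case
    by (auto simp: deletions_Cons intro!: subspace_add subspace_scale U_sub U_word creation_U)
qed (simp add: subspace_0[OF U_sub])

lemma scalar_exists:
  assumes "q \<in> \<Q>" shows "\<exists>\<delta>. \<forall>i<m. q (X i w) = sc (\<delta> i) w"
proof -
  have "\<exists>d. q (X i w) = sc d w" if i: "i < m" for i
  proof -
    from commutator[OF assms i] obtain c q'
      where "q' \<in> \<Q>" "\<And>v. q (X i v) = X i (q v) + sc c v + q' v" by blast
    then show ?thesis
      using annihilates[OF assms] annihilates[of q'] lin_zero[OF creation_lin[OF i]]
      by (intro exI[of _ c]) simp
  qed
  then show ?thesis by metis
qed

text \<open>
  Moving \<open>q\<close> past a letter costs a scalar, which deletes the letter, and another annihilation operator, which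
  deletes a second letter later on. To leading order \<open>q\<close> is thus a derivation.
\<close>

lemma annihilation_word:
  assumes "q \<in> \<Q>" "\<And>i. i < m \<Longrightarrow> q (X i w) = sc (\<delta> i) w" "set us \<subseteq> {..<m}"
  shows "q (foldr X us w) - D \<delta> us \<in> U (length us - 1)"
    and "q (foldr X us w) \<in> U (length us)"
proof -
  have "q (foldr X us w) - D \<delta> us \<in> U (length us - 1) \<and> q (foldr X us w) \<in> U (length us)"
    using assms
  proof (induct us arbitrary: q \<delta>)
    case Nil
    then show ?case by (simp add: annihilates subspace_0[OF U_sub])
  next
    case (Cons i us)
    let ?u = "foldr X us w"
    have i: "i < m" and us: "set us \<subseteq> {..<m}" using Cons(4) by auto
    obtain c q' where q': "q' \<in> \<Q>" and c: "\<And>v. q (X i v) = X i (q v) + sc c v + q' v"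
      using commutator[OF Cons(2) i] by blast
    obtain \<delta>' where \<delta>': "\<And>j. j < m \<Longrightarrow> q' (X j w) = sc (\<delta>' j) w" using scalar_exists[OF q'] by blast
    have cw: "sc c w = sc (\<delta> i) w"
      using c[of w] Cons(3)[OF i] annihilates[OF q'] annihilates[OF Cons(2)] lin_zero[OF creation_lin[OF i]] by auto
    have cu: "sc c ?u = sc (\<delta> i) ?u"
    proof (cases "w = 0")
      case True
      have "foldr X us 0 = 0" using us
        by (induct us) (auto simp: lin_zero[OF creation_lin])
      with True show ?thesis by simp
    qed (use cw in simp)
    have IH: "q ?u - D \<delta> us \<in> U (length us - 1)"
      using Cons(1)[OF Cons(2,3) us] by auto
    have IH': "q' ?u \<in> U (length us)"
      using Cons(1)[OF q' \<delta>' us] by auto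
    have "q (foldr X (i # us) w) - D \<delta> (i # us) = X i (q ?u - D \<delta> us) + q' ?u"
      by (simp add: c deletions_Cons[OF i] lin_diff[OF creation_lin[OF i]] cu)
    moreover have "X i (q ?u - D \<delta> us) \<in> U (length us)"
    proof (cases us)
      case Nil
      then show ?thesis
        by (simp add: annihilates[OF Cons(2)] lin_zero[OF creation_lin[OF i]] subspace_0[OF U_sub])
    next
      case (Cons a list)
      with creation_U[OF i IH] show ?thesis by simp
    qed
    ultimately have 1: "q (foldr X (i # us) w) - D \<delta> (i # us) \<in> U (length us)"
      using IH' by (simp add: subspace_add[OF U_sub])
    have "D \<delta> (i # us) \<in> U (length (i # us))" by (rule deletions_U[OF Cons(4)])
    moreover have "U (length us) \<subseteq> U (length (i # us))" by (rule U_mono) simp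
    ultimately have "q (foldr X (i # us) w) \<in> U (length (i # us))"
      using 1 subspace_add[OF U_sub, of "q (foldr X (i # us) w) - D \<delta> (i # us)" "length (i # us)" "D \<delta> (i # us)"]
      by auto
    with 1 show ?case by simp
  qed
  then show "q (foldr X us w) - D \<delta> us \<in> U (length us - 1)" "q (foldr X us w) \<in> U (length us)" by auto
qed

lemma annihilation_U:
  assumes "q \<in> \<Q>" "v \<in> U n" shows "q v \<in> U (n - 1)"
proof (rule U_induct[OF assms(2) annihilation_lin[OF assms(1)] U_sub])
  fix us assume us: "set us \<subseteq> {..<m}" "length us < n"
  obtain \<delta> where "\<And>i. i < m \<Longrightarrow> q (X i w) = sc (\<delta> i) w" using scalar_exists[OF assms(1)] by blast
  then have "q (foldr X us w) \<in> U (length us)" by (rule annihilation_word[OF assms(1) _ us(1)])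
  moreover have "U (length us) \<subseteq> U (n - 1)" using us by (intro U_mono) linarith
  ultimately show "q (foldr X us w) \<in> U (n - 1)" by auto
qed

lemma lin_fold: "set qs \<subseteq> \<Q> \<Longrightarrow> lin sc sc (fold (\<lambda>q. q) qs)"
proof (induct qs)
  case (Cons q qs)
  then show ?case using lin_compose[OF annihilation_lin[of q], of sc "fold (\<lambda>q. q) qs"] by (simp add: comp_def)
qed (simp add: lin_def)

lemma U_zero: "U 0 = {0}"
  by (simp add: short_words_def)

lemma annihilations_kill:
  "set qs \<subseteq> \<Q> \<Longrightarrow> v \<in> U (length qs) \<Longrightarrow> fold (\<lambda>q. q) qs v = 0"
proof (induct qs arbitrary: v)
  case (Cons q qs)
  then show ?case using annihilation_U[of q v "Suc (length qs)"] by auto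
qed (simp add: U_zero)

definition dual :: "(nat \<Rightarrow> 'v \<Rightarrow> 'v) \<Rightarrow> bool" where
  "dual q \<longleftrightarrow> (\<forall>j<m. q j \<in> \<Q> \<and> (\<forall>i<m. q j (X i w) = (if i = j then w else 0)))"

text \<open>
  Each of the operators \<open>q j\<close> deletes one letter \<open>j\<close> in all possible ways, up to shorter words, which the
  remaining operators kill. Hence \<open>s\<close> is the product of the factorials of the multiplicities in \<open>js\<close>; it is
  nonzero because the characteristic is \<open>0\<close>.
\<close>

lemma dual_pairing:
  assumes q: "dual q"
  shows "set js \<subseteq> {..<m} \<Longrightarrow> \<exists>s. s \<noteq> 0 \<and> (\<forall>us. set us \<subseteq> {..<m} \<longrightarrow> length us = length js \<longrightarrow>
    fold (\<lambda>q. q) (map q js) (foldr X us w) = (if mset us = mset js then sc s w else 0))"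
proof (induct js)
  case Nil
  show ?case by (intro exI[of _ 1]) auto
next
  case (Cons j js)
  then obtain s where s: "s \<noteq> 0" and IH: "\<And>us. set us \<subseteq> {..<m} \<Longrightarrow> length us = length js \<Longrightarrow>
      fold (\<lambda>q. q) (map q js) (foldr X us w) = (if mset us = mset js then sc s w else 0)" by auto
  have j: "j < m" and qj: "q j \<in> \<Q>" and js: "set js \<subseteq> {..<m}" "set (map q js) \<subseteq> \<Q>"
    using Cons(2) q by (auto simp: dual_def)
  let ?f = "fold (\<lambda>q. q) (map q js)"
  have f: "lin sc sc ?f" by (rule lin_fold[OF js(2)])
  let ?\<delta> = "\<lambda>i. if i = j then 1 else 0"
  let ?s = "of_nat (count (mset (j # js)) j) * s"
  have "fold (\<lambda>q. q) (map q (j # js)) (foldr X us w) = (if mset us = mset (j # js) then sc ?s w else 0)"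
    if us: "set us \<subseteq> {..<m}" "length us = Suc (length js)" for us
  proof -
    have "q j (foldr X us w) - D ?\<delta> us \<in> U (length us - 1)"
      by (rule annihilation_word[OF qj _ us(1)]) (use q j in \<open>auto simp: dual_def\<close>)
    then have "?f (q j (foldr X us w) - D ?\<delta> us) = 0"
      using us(2) by (intro annihilations_kill[OF js(2)]) simp
    then have "?f (q j (foldr X us w)) = ?f (D ?\<delta> us)" by (simp add: lin_diff[OF f])
    also have "\<dots> = (\<Sum>p<length us. sc (?\<delta> (us ! p)) (?f (foldr X (take p us @ drop (Suc p) us) w)))"
      by (simp add: deletions_def lin_sum[OF f] lin_scale[OF f])
    also have "\<dots> = (\<Sum>p<length us. if us ! p = j then (if mset us = mset (j # js) then sc s w else 0) else 0)"
    proof (rule sum.cong[OF refl])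
      fix p assume "p \<in> {..<length us}"
      then have p: "p < length us" by simp
      have m: "mset us = add_mset (us ! p) (mset (take p us @ drop (Suc p) us))"
        by (subst id_take_nth_drop[OF p]) simp
      have "?f (foldr X (take p us @ drop (Suc p) us) w)
          = (if mset (take p us @ drop (Suc p) us) = mset js then sc s w else 0)"
        by (rule IH) (use us p in \<open>auto dest: in_set_takeD in_set_dropD\<close>)
      then show "sc (?\<delta> (us ! p)) (?f (foldr X (take p us @ drop (Suc p) us) w))
        = (if us ! p = j then (if mset us = mset (j # js) then sc s w else 0) else 0)"
        using m by auto
    qed
    also have "\<dots> = (\<Sum>p\<in>{p. p < length us \<and> us ! p = j}. if mset us = mset (j # js) then sc s w else 0)"
      by (subst sum.inter_filter[symmetric]) (auto intro!: sum.cong)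
    also have "\<dots> = sc (of_nat (count (mset us) j)) (if mset us = mset (j # js) then sc s w else 0)"
    proof -
      have "card {p. p < length us \<and> us ! p = j} = count (mset us) j"
        by (simp add: count_mset count_list_eq_length_filter length_filter_conv_card eq_commute conj_commute)
      moreover have "(\<Sum>p\<in>A. v) = sc (of_nat (card A)) v" for A :: "nat set" and v
        by (induct A rule: infinite_finite_induct) (auto simp: scale_left_distrib)
      ultimately show ?thesis by simp
    qed
    finally show ?thesis by (auto simp del: mset.simps count_add_mset)
  qed
  moreover have "?s \<noteq> 0" using s of_nat_neq_0[of "count (mset js) j"] by simp
  ultimately show ?case by (intro exI[of _ ?s]) auto
qed

text \<open>
  Among the monomials with nonzero coefficient take one of greatest degree, and apply the annihilation
  operators dual to its letters: they kill all other monomials of the relation.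
\<close>

lemma monomials_independent:
  assumes q: "dual q" and w: "w \<noteq> 0" and fin: "finite \<M>" and \<M>: "\<And>M. M \<in> \<M> \<Longrightarrow> set_mset M \<subseteq> {..<m}"
    and rel: "(\<Sum>M\<in>\<M>. sc (c M) (foldr X (sorted_list_of_multiset M) w)) = 0" and M: "M \<in> \<M>"
  shows "c M = 0"
proof (rule ccontr)
  assume "c M \<noteq> 0"
  define N where "N = {M \<in> \<M>. c M \<noteq> 0}"
  have N: "finite N" "N \<noteq> {}" using fin M \<open>c M \<noteq> 0\<close> by (auto simp: N_def)
  have "Max (size ` N) \<in> size ` N" using N by (intro Max_in) auto
  then obtain M0 where "M0 \<in> N" "size M0 = Max (size ` N)" by auto
  then have M0: "M0 \<in> N" "\<And>M. M \<in> N \<Longrightarrow> size M \<le> size M0" using N by auto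
  define js where "js = sorted_list_of_multiset M0"
  have js: "set js \<subseteq> {..<m}" "mset js = M0" using M0 \<M> by (auto simp: js_def N_def)
  obtain s where s: "s \<noteq> 0" and pair: "\<And>us. set us \<subseteq> {..<m} \<Longrightarrow> length us = length js \<Longrightarrow>
    fold (\<lambda>q. q) (map q js) (foldr X us w) = (if mset us = mset js then sc s w else 0)"
    using dual_pairing[OF q js(1)] by auto
  have qs: "set (map q js) \<subseteq> \<Q>" using js(1) q by (auto simp: dual_def)
  let ?f = "fold (\<lambda>q. q) (map q js)"
  have f: "lin sc sc ?f" by (rule lin_fold[OF qs])
  have "?f (foldr X (sorted_list_of_multiset M) w) = (if M = M0 then sc s w else 0)" if "M \<in> N" for M
  proof (cases "size M = size M0")
    case True
    have "length (sorted_list_of_multiset M) = length js" using True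
      by (metis js(2) mset_sorted_list_of_multiset size_mset)
    then show ?thesis using pair[of "sorted_list_of_multiset M"] \<M>[of M] that js by (auto simp: N_def)
  next
    case False
    with M0(2)[OF that] have l: "size M < size M0" by simp
    have "length (sorted_list_of_multiset M) < length js" using l
      by (metis js(2) mset_sorted_list_of_multiset size_mset)
    then have "?f (foldr X (sorted_list_of_multiset M) w) = 0"
      using \<M>[of M] that by (intro annihilations_kill[OF qs] U_word) (auto simp: N_def)
    with l show ?thesis by auto
  qed
  moreover have "(\<Sum>M\<in>N. sc (c M) (foldr X (sorted_list_of_multiset M) w)) = 0"
    using rel by (subst (asm) sum.mono_neutral_right[of \<M> N]) (use fin in \<open>auto simp: N_def\<close>)
  ultimately have "0 = (\<Sum>M\<in>N. sc (c M) (if M = M0 then sc s w else 0))"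
    using lin_sum[OF f, of "\<lambda>M. sc (c M) (foldr X (sorted_list_of_multiset M) w)" N] lin_scale[OF f] lin_zero[OF f]
    by (simp cong: sum.cong)
  also have "\<dots> = sc (c M0) (sc s w)"
    using M0 N by (simp add: if_distrib[of "sc _"] cong: if_cong)
  finally show False using s w M0 by (auto simp: N_def)
qed

lemma monomials_dimension:
  assumes q: "dual q" and w: "w \<noteq> 0" and fin: "finite \<M>" "finite T"
    and \<M>: "\<And>M. M \<in> \<M> \<Longrightarrow> set_mset M \<subseteq> {..<m} \<and> foldr X (sorted_list_of_multiset M) w \<in> span T"
  shows "card \<M> \<le> card T"
proof (rule ccontr)
  assume "\<not> card \<M> \<le> card T"
  then have "card T < card \<M>" by simp
  then obtain c M where "(\<Sum>M\<in>\<M>. sc (c M) (foldr X (sorted_list_of_multiset M) w)) = 0" "M \<in> \<M>" "c M \<noteq> 0"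
    using many_vectors_dependent[OF fin(2,1), of "\<lambda>M. foldr X (sorted_list_of_multiset M) w"] \<M> by blast
  with monomials_independent[OF q w fin(1), of c M] \<M> show False by auto
qed

end

text \<open>
  Induction on \<open>m\<close>. Subtracting multiples of the first \<open>m\<close> vectors from a vector \<open>t\<close> clears its first \<open>m\<close>
  coordinates; the last coordinate survives if \<open>t\<close> is off the hyperplane with coefficients \<open>- b i m\<close> and \<open>1\<close>.
\<close>

lemma standard_basis_of_nondegenerate:
  fixes S :: "(nat \<Rightarrow> 'k::field) set"
  assumes add: "\<And>s t. s \<in> S \<Longrightarrow> t \<in> S \<Longrightarrow> (\<lambda>i. s i + t i) \<in> S"
    and scale: "\<And>c s. s \<in> S \<Longrightarrow> (\<lambda>i. c * s i) \<in> S"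
    and nondeg: "\<And>c. (\<exists>i<m. c i \<noteq> 0) \<Longrightarrow> \<exists>s\<in>S. (\<Sum>i<m. c i * s i) \<noteq> 0"
  shows "\<exists>b. \<forall>j<m. b j \<in> S \<and> (\<forall>i<m. b j i = (if i = j then 1 else 0))"
  using nondeg
proof (induct m)
  case (Suc m)
  have "\<exists>s\<in>S. (\<Sum>i<m. c i * s i) \<noteq> 0" if "\<exists>i<m. c i \<noteq> 0" for c
  proof -
    from that have "\<exists>i<Suc m. (c(m := 0)) i \<noteq> 0" by (metis fun_upd_other less_Suc_eq nat_neq_iff)
    then obtain s where "s \<in> S" "(\<Sum>i<Suc m. (c(m := 0)) i * s i) \<noteq> 0" using Suc(2) by blast
    then show ?thesis by (intro bexI[of _ s]) auto
  qed
  from Suc(1)[OF this] obtain b where b: "\<And>j. j < m \<Longrightarrow> b j \<in> S"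
    "\<And>i j. i < m \<Longrightarrow> j < m \<Longrightarrow> b j i = (if i = j then 1 else 0)" by blast
  have sumS: "(\<lambda>i. \<Sum>j<k. c j * b j i) \<in> S" if "k \<le> m" "S \<noteq> {}" for c k
    using that(1)
  proof (induct k)
    case 0
    from that obtain s where "s \<in> S" by auto
    from scale[OF this, of 0] show ?case by simp
  next
    case (Suc k)
    then show ?case using add[OF Suc(1) scale[OF b(1)[of k], of "c k"]] by simp
  qed
  obtain t where t: "t \<in> S" "(\<Sum>i<Suc m. (if i = m then 1 else - b i m) * t i) \<noteq> 0"
    using Suc(2)[of "\<lambda>i. if i = m then 1 else - b i m", OF exI[of _ m]] by auto
  define g where "g = t m - (\<Sum>i<m. t i * b i m)"
  have g: "g \<noteq> 0" using t(2) by (simp add: g_def sum_negf mult.commute)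
  define r where "r = (\<lambda>i. inverse g * (t i + (\<Sum>j<m. (- t j) * b j i)))"
  have rS: "r \<in> S" unfolding r_def by (intro scale add t sumS) (use t in auto)
  have ri: "r i = 0" if i: "i < m" for i
  proof -
    have "(\<Sum>j<m. (- t j) * b j i) = (\<Sum>j<m. if j = i then - t j else 0)"
      by (rule sum.cong) (use b(2)[OF i] in auto)
    with i show ?thesis by (simp add: r_def)
  qed
  have rm: "r m = 1" using g by (simp add: r_def g_def sum_negf)
  define b' where "b' = (\<lambda>j. if j = m then r else (\<lambda>i. b j i + (- b j m) * r i))"
  have "b' j \<in> S \<and> (\<forall>i<Suc m. b' j i = (if i = j then 1 else 0))" if "j < Suc m" for j
  proof (cases "j = m")
    case True
    then show ?thesis using rS ri rm by (auto simp: b'_def less_Suc_eq)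
  next
    case False
    with that have j: "j < m" by simp
    have "b' j \<in> S" using False by (simp add: b'_def) (use add[OF b(1)[OF j] scale[OF rS, of "- b j m"]] in simp)
    with False j show ?thesis using b(2) ri rm by (auto simp: b'_def less_Suc_eq)
  qed
  then show ?case by blast
qed simp

lemma (in heisenberg) dual_exists:
  assumes add: "\<And>q r. q \<in> \<Q> \<Longrightarrow> r \<in> \<Q> \<Longrightarrow> (\<lambda>v. q v + r v) \<in> \<Q>"
    and scale: "\<And>c q. q \<in> \<Q> \<Longrightarrow> (\<lambda>v. sc c (q v)) \<in> \<Q>"
    and nondeg: "\<And>c. (\<exists>i<m. c i \<noteq> 0) \<Longrightarrow> \<exists>q\<in>\<Q>. q (\<Sum>i<m. sc (c i) (X i w)) \<noteq> 0"
  obtains q where "dual q"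
proof -
  define S where "S = {s. \<exists>q\<in>\<Q>. \<forall>i<m. q (X i w) = sc (s i) w}"
  have "\<exists>b. \<forall>j<m. b j \<in> S \<and> (\<forall>i<m. b j i = (if i = j then 1 else 0))"
  proof (rule standard_basis_of_nondegenerate)
    show "(\<lambda>i. s i + t i) \<in> S" if "s \<in> S" "t \<in> S" for s t
    proof -
      from that obtain q r where "q \<in> \<Q>" "r \<in> \<Q>" "\<And>i. i < m \<Longrightarrow> q (X i w) = sc (s i) w"
        "\<And>i. i < m \<Longrightarrow> r (X i w) = sc (t i) w" by (auto simp: S_def)
      then show ?thesis unfolding S_def
        by (auto intro!: bexI[of _ "\<lambda>v. q v + r v"] add simp: scale_left_distrib)
    qed
    show "(\<lambda>i. c * s i) \<in> S" if "s \<in> S" for c s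
    proof -
      from that obtain q where "q \<in> \<Q>" "\<And>i. i < m \<Longrightarrow> q (X i w) = sc (s i) w"
        by (auto simp: S_def)
      then show ?thesis unfolding S_def by (auto intro!: bexI[of _ "\<lambda>v. sc c (q v)"] scale)
    qed
    fix c :: "nat \<Rightarrow> 'k" assume "\<exists>i<m. c i \<noteq> 0"
    then obtain q where q: "q \<in> \<Q>" "q (\<Sum>i<m. sc (c i) (X i w)) \<noteq> 0" using nondeg by blast
    obtain \<delta> where \<delta>: "\<And>i. i < m \<Longrightarrow> q (X i w) = sc (\<delta> i) w" using scalar_exists[OF q(1)] by blast
    have "q (\<Sum>i<m. sc (c i) (X i w)) = sc (\<Sum>i<m. c i * \<delta> i) w"
      by (simp add: lin_sum[OF annihilation_lin[OF q(1)]] lin_scale[OF annihilation_lin[OF q(1)]] \<delta> scale_sum_left)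
    with q \<delta> show "\<exists>s\<in>S. (\<Sum>i<m. c i * s i) \<noteq> 0" by (intro bexI[of _ \<delta>]) (auto simp: S_def)
  qed
  then obtain b where b: "\<And>j. j < m \<Longrightarrow> b j \<in> S \<and> (\<forall>i<m. b j i = (if i = j then 1 else 0))" by blast
  then have "\<forall>j. \<exists>q. j < m \<longrightarrow> q \<in> \<Q> \<and> (\<forall>i<m. q (X i w) = (if i = j then w else 0))"
    by (fastforce simp: S_def)
  then obtain q where "\<forall>j<m. q j \<in> \<Q> \<and> (\<forall>i<m. q j (X i w) = (if i = j then w else 0))" by metis
  then show thesis by (intro that[of q]) (simp add: dual_def)
qed

lemma (in heisenberg) powers_not_fin_dim:
  assumes "m = 1" "q \<in> \<Q>" "q (X 0 w) = w" "w \<noteq> 0" "fin_dim sc S"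
  shows "\<exists>i. (X 0 ^^ i) w \<notin> S"
proof (rule ccontr)
  assume "\<not> (\<exists>i. (X 0 ^^ i) w \<notin> S)"
  with assms(5) obtain T where T: "finite T" "\<And>i. (X 0 ^^ i) w \<in> span T" by (auto simp: fin_dim_def)
  define \<M> where "\<M> = (\<lambda>i. replicate_mset i (0::nat)) ` {..card T}"
  have inj: "inj_on (\<lambda>i. replicate_mset i (0::nat)) {..card T}"
    by (rule inj_onI) (metis size_replicate_mset)
  have "foldr X (sorted_list_of_multiset (replicate_mset i 0)) w = (X 0 ^^ i) w" for i
  proof -
    have "sorted_list_of_multiset (replicate_mset i 0) = replicate i (0::nat)"
      by (metis mset_replicate sorted_list_of_multiset_mset sorted_replicate sorted_sort_id)
    moreover have "foldr X (replicate i 0) w = (X 0 ^^ i) w" by (induct i) auto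
    ultimately show ?thesis by simp
  qed
  moreover have "dual (\<lambda>_. q)" unfolding dual_def using assms(1-3) by auto
  ultimately have "card \<M> \<le> card T"
    by (intro monomials_dimension[OF _ assms(4), of "\<lambda>_. q"]) (use T assms(1) in \<open>auto simp: \<M>_def split: if_splits\<close>)
  then show False by (simp add: \<M>_def card_image[OF inj])
qed

section \<open>Sweedler calculus\<close>

context hopf_algebra
begin

definition bil :: "('k \<Rightarrow> 'm \<Rightarrow> 'm) \<Rightarrow> ('h \<Rightarrow> 'h \<Rightarrow> 'm::ab_group_add) \<Rightarrow> bool" where
  "bil sc B \<longleftrightarrow> (\<forall>q. lin scale sc (\<lambda>p. B p q)) \<and> (\<forall>p. lin scale sc (\<lambda>q. B p q))"

definition tril :: "('k \<Rightarrow> 'm \<Rightarrow> 'm) \<Rightarrow> ('h \<Rightarrow> 'h \<Rightarrow> 'h \<Rightarrow> 'm::ab_group_add) \<Rightarrow> bool" where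
  "tril sc T \<longleftrightarrow> (\<forall>q r. lin scale sc (\<lambda>p. T p q r)) \<and> (\<forall>p r. lin scale sc (\<lambda>q. T p q r))
     \<and> (\<forall>p q. lin scale sc (\<lambda>r. T p q r))"

text \<open>\<open>sw sc B f\<close> is the sum written \<open>\<Sum> B f\<^sub>1 f\<^sub>2\<close> in Sweedler's notation.\<close>

definition sw :: "('k \<Rightarrow> 'm \<Rightarrow> 'm) \<Rightarrow> ('h \<Rightarrow> 'h \<Rightarrow> 'm) \<Rightarrow> 'h \<Rightarrow> 'm::ab_group_add" where
  "sw sc B f = lin_ext sc (\<lambda>(p, q). B p q) (rep (\<Delta> f))"

lemma bil_lin: "bil sc B \<Longrightarrow> lin scale sc (\<lambda>p. B p q)" "bil sc B \<Longrightarrow> lin scale sc (B p)"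
  by (auto simp: bil_def)

lemma bil_flip: "bil sc B \<Longrightarrow> bil sc (\<lambda>p q. B q p)"
  by (simp add: bil_def)

lemma rep_comult: "rep (\<Delta> f) \<in> \<Delta> f"
proof -
  obtain X where "\<Delta> f = coset rel2 X" using comult_coset[of f] by auto
  then have "X \<in> \<Delta> f" by (simp add: coset_def rel2_def fs.span_zero)
  then show ?thesis unfolding rep_def by (rule someI)
qed

lemma lin_ext_rel2:
  assumes "vector_space sc" "bil sc B" "X \<in> rel2"
  shows "lin_ext sc (\<lambda>(p, q). B p q) X = 0"
proof -
  interpret m: vector_space sc by fact
  show ?thesis
    using assms(3) unfolding rel2_def
    by (rule m.lin_ext_vanishes_on_span)
      (use assms(2) in \<open>auto simp: bil_def elim!: m.lin_ext_slot_rels[rotated]\<close>)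
qed

lemma lin_ext_rel3:
  assumes "vector_space sc" "tril sc T" "X \<in> rel3"
  shows "lin_ext sc (\<lambda>(p, q, r). T p q r) X = 0"
proof -
  interpret m: vector_space sc by fact
  show ?thesis
    using assms(3) unfolding rel3_def
    by (rule m.lin_ext_vanishes_on_span)
      (use assms(2) in \<open>auto simp: tril_def elim!: m.lin_ext_slot_rels[rotated]\<close>)
qed

lemma sw_eq:
  assumes "vector_space sc" "bil sc B" "X \<in> \<Delta> f"
  shows "lin_ext sc (\<lambda>(p, q). B p q) X = sw sc B f"
proof -
  interpret m: vector_space sc by fact
  obtain X0 where "\<Delta> f = coset rel2 X0" using comult_coset[of f] by auto
  with assms(3) rep_comult[of f] have "X - X0 \<in> rel2" "rep (\<Delta> f) - X0 \<in> rel2"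
    by (auto simp: coset_def)
  then have "X - rep (\<Delta> f) \<in> rel2"
    unfolding rel2_def using fs.span_diff[of "X - X0" _ "rep (\<Delta> f) - X0"] by simp
  from lin_ext_rel2[OF assms(1,2) this] show ?thesis by (simp add: m.lin_ext_diff sw_def)
qed

lemma sw_lin: "vector_space sc \<Longrightarrow> bil sc B \<Longrightarrow> lin scale sc (sw sc B)"
proof -
  assume vs: "vector_space sc" and B: "bil sc B"
  interpret m: vector_space sc by fact
  show ?thesis
  proof (rule linI)
    fix f g c
    show "sw sc B (f + g) = sw sc B f + sw sc B g"
      by (subst sw_eq[OF vs B comult_add[OF rep_comult rep_comult], symmetric])
        (simp add: m.lin_ext_add sw_def)
    show "sw sc B (scale c f) = sc c (sw sc B f)"
      by (subst sw_eq[OF vs B comult_scale[OF rep_comult], symmetric])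
        (simp add: m.lin_ext_fscale sw_def)
  qed
qed

lemmas sw_add = lin_add[OF sw_lin] and sw_scale = lin_scale[OF sw_lin]

lemma sw_fun_add:
  "vector_space sc \<Longrightarrow> sw sc (\<lambda>p q. A p q + B p q) f = sw sc A f + sw sc B f"
  unfolding sw_def by (simp add: vector_space.lin_ext_fun_add[symmetric] case_prod_unfold)

lemma sw_fun_scale:
  "vector_space sc \<Longrightarrow> sw sc (\<lambda>p q. sc c (B p q)) f = sc c (sw sc B f)"
  unfolding sw_def by (simp add: vector_space.lin_ext_fun_scale[symmetric] case_prod_unfold)

lemma sw_lin_apply:
  "vector_space t \<Longrightarrow> lin s t g \<Longrightarrow> g (sw s B f) = sw t (\<lambda>p q. g (B p q)) f"
  unfolding sw_def by (simp add: lin_lin_ext_apply case_prod_unfold)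

lemma sw_swap:
  "vector_space sc \<Longrightarrow>
   sw sc (\<lambda>p q. sw sc (\<lambda>r s. T p q r s) g) f = sw sc (\<lambda>r s. sw sc (\<lambda>p q. T p q r s) f) g"
  unfolding sw_def case_prod_unfold by (rule vector_space.lin_ext_swap)

lemma sw_mult:
  assumes vs: "vector_space sc" and B: "bil sc B"
  shows "sw sc B (f * g) = sw sc (\<lambda>p q. sw sc (\<lambda>r s. B (p * r) (q * s)) g) f"
proof -
  interpret m: vector_space sc by fact
  show ?thesis
    by (subst sw_eq[OF vs B comult_mult[OF rep_comult rep_comult], symmetric])
      (simp add: m.lin_ext_lin_ext mult2_def case_prod_unfold sw_def)
qed

lemma sw_one: "vector_space sc \<Longrightarrow> bil sc B \<Longrightarrow> sw sc B 1 = B 1 1"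
  by (subst sw_eq[OF _ _ comult_one, symmetric]) (auto simp: vector_space.lin_ext_basis)

lemma sw_coassoc:
  assumes vs: "vector_space sc" and T: "tril sc T"
  shows "sw sc (\<lambda>p q. sw sc (\<lambda>a b. T a b q) p) f = sw sc (\<lambda>p q. sw sc (\<lambda>a b. T p a b) q) f"
proof -
  interpret m: vector_space sc by fact
  from lin_ext_rel3[OF vs T coassoc[of f]] show ?thesis
    by (simp add: m.lin_ext_diff m.lin_ext_lin_ext case_prod_unfold sw_def)
qed

lemma sw_counit_left: "vector_space sc \<Longrightarrow> lin scale sc g \<Longrightarrow> sw sc (\<lambda>p q. sc (\<epsilon> p) (g q)) f = g f"
  and sw_counit_right: "vector_space sc \<Longrightarrow> lin scale sc g \<Longrightarrow> sw sc (\<lambda>p q. sc (\<epsilon> q) (g p)) f = g f"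
proof -
  assume vs: "vector_space sc" and g: "lin scale sc g"
  have "g f = g (lin_ext scale (\<lambda>(p, q). scale (\<epsilon> p) q) (rep (\<Delta> f)))"
    by (simp add: counit_left[OF rep_comult])
  also have "\<dots> = sw sc (\<lambda>p q. sc (\<epsilon> p) (g q)) f"
    by (simp add: lin_lin_ext_apply[OF vs g] sw_def case_prod_unfold lin_scale[OF g])
  finally show "sw sc (\<lambda>p q. sc (\<epsilon> p) (g q)) f = g f" ..
  have "g f = g (lin_ext scale (\<lambda>(p, q). scale (\<epsilon> q) p) (rep (\<Delta> f)))"
    by (simp add: counit_right[OF rep_comult])
  also have "\<dots> = sw sc (\<lambda>p q. sc (\<epsilon> q) (g p)) f"
    by (simp add: lin_lin_ext_apply[OF vs g] sw_def case_prod_unfold lin_scale[OF g])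
  finally show "sw sc (\<lambda>p q. sc (\<epsilon> q) (g p)) f = g f" ..
qed

lemma sw_antipode_left: "vector_space sc \<Longrightarrow> lin scale sc g \<Longrightarrow> sw sc (\<lambda>p q. g (S p * q)) f = sc (\<epsilon> f) (g 1)"
  and sw_antipode_right: "vector_space sc \<Longrightarrow> lin scale sc g \<Longrightarrow> sw sc (\<lambda>p q. g (p * S q)) f = sc (\<epsilon> f) (g 1)"
proof -
  assume vs: "vector_space sc" and g: "lin scale sc g"
  have "sc (\<epsilon> f) (g 1) = g (lin_ext scale (\<lambda>(p, q). S p * q) (rep (\<Delta> f)))"
    by (simp add: antipode_left[OF rep_comult] lin_scale[OF g])
  also have "\<dots> = sw sc (\<lambda>p q. g (S p * q)) f"
    by (simp add: lin_lin_ext_apply[OF vs g] sw_def case_prod_unfold)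
  finally show "sw sc (\<lambda>p q. g (S p * q)) f = sc (\<epsilon> f) (g 1)" ..
  have "sc (\<epsilon> f) (g 1) = g (lin_ext scale (\<lambda>(p, q). p * S q) (rep (\<Delta> f)))"
    by (simp add: antipode_right[OF rep_comult] lin_scale[OF g])
  also have "\<dots> = sw sc (\<lambda>p q. g (p * S q)) f"
    by (simp add: lin_lin_ext_apply[OF vs g] sw_def case_prod_unfold)
  finally show "sw sc (\<lambda>p q. g (p * S q)) f = sc (\<epsilon> f) (g 1)" ..
qed

lemma S_lin: "lin scale scale S"
  by (rule linear_imp_lin[OF antipode_linear])

lemma counit_lin: "lin scale (*) \<epsilon>"
  by (rule linear_imp_lin[OF counit_linear])

lemmas S_simps = lin_add[OF S_lin] lin_scale[OF S_lin]
lemmas counit_simps = lin_add[OF counit_lin] lin_scale[OF counit_lin] counit_one counit_mult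
lemmas alg_simps = S_simps counit_simps distrib_left distrib_right scale_mult_left scale_mult_right
  scale_right_distrib scale_left_distrib

lemma vs_scale: "vector_space scale"
  by (rule vector_space_axioms)

lemma S_one: "S 1 = 1"
proof -
  have "sw scale (\<lambda>p q. S p * q) 1 = 1"
    using sw_antipode_left[OF vs_scale lin_ident, of 1] by (simp add: counit_one)
  moreover have "sw scale (\<lambda>p q. S p * q) 1 = S 1 * 1"
    by (rule sw_one[OF vs_scale]) (simp add: bil_def lin_def alg_simps)
  ultimately show ?thesis by simp
qed

lemmas sw_f_simps = sw_fun_add[OF vs_scale] sw_fun_scale[OF vs_scale]

text \<open>
  The maps \<open>f \<otimes> g \<mapsto> S (f g)\<close> and \<open>f \<otimes> g \<mapsto> S g S f\<close> are a left and a right convolution inverse of the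
  multiplication, so they coincide.
\<close>

lemma S_mult: "S (f * g) = S g * S f"
proof -
  note ml = bil_def tril_def lin_def alg_simps sw_f_simps
  \<comment> \<open>Both sides equal \<open>\<Sum> S (f\<^sub>1 g\<^sub>1) f\<^sub>2 g\<^sub>2 S g\<^sub>3 S f\<^sub>3\<close>.\<close>
  define T where "T = (\<lambda>f1 f2 f3. sw scale (\<lambda>g1 q. sw scale (\<lambda>g2 g3. S (f1 * g1) * f2 * g2 * S g3 * S f3) q) g)"
  define T' where "T' = (\<lambda>f1 f2 f3. sw scale (\<lambda>q g3. sw scale (\<lambda>g1 g2. S (f1 * g1) * f2 * g2 * S g3 * S f3) q) g)"
  have TT': "T f1 f2 f3 = T' f1 f2 f3" for f1 f2 f3
    unfolding T_def T'_def by (rule sw_coassoc[OF vs_scale, symmetric]) (simp add: ml)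
  have T1: "T f1 f2 f3 = S (f1 * g) * f2 * S f3" for f1 f2 f3
  proof -
    have "sw scale (\<lambda>g2 g3. S (f1 * g1) * f2 * g2 * S g3 * S f3) = (\<lambda>q. scale (\<epsilon> q) (S (f1 * g1) * f2 * S f3))" for g1
    proof
      fix q
      show "sw scale (\<lambda>g2 g3. S (f1 * g1) * f2 * g2 * S g3 * S f3) q = scale (\<epsilon> q) (S (f1 * g1) * f2 * S f3)"
        using sw_antipode_right[OF vs_scale, of "\<lambda>y. S (f1 * g1) * f2 * y * S f3" q] by (simp add: ml mult.assoc)
    qed
    then show ?thesis unfolding T_def
      using sw_counit_right[OF vs_scale, of "\<lambda>g1. S (f1 * g1) * f2 * S f3" g] by (simp add: ml)
  qed
  have "sw scale (\<lambda>f1 p. sw scale (\<lambda>f2 f3. T f1 f2 f3) p) f = S (f * g)"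
  proof -
    have "sw scale (\<lambda>f2 f3. T f1 f2 f3) p = scale (\<epsilon> p) (S (f1 * g))" for f1 p
      using sw_antipode_right[OF vs_scale, of "\<lambda>y. S (f1 * g) * y" p] by (simp add: T1 ml mult.assoc)
    then show ?thesis
      using sw_counit_right[OF vs_scale, of "\<lambda>f1. S (f1 * g)" f] by (simp add: ml)
  qed
  moreover have "sw scale (\<lambda>p f3. sw scale (\<lambda>f1 f2. T f1 f2 f3) p) f = S g * S f"
  proof -
    have "sw scale (\<lambda>f1 f2. T f1 f2 f3) p = scale (\<epsilon> p) (S g * S f3)" for p f3
    proof -
      have "sw scale (\<lambda>f1 f2. T f1 f2 f3) p
          = sw scale (\<lambda>q g3. sw scale (\<lambda>f1 f2. sw scale (\<lambda>g1 g2. S (f1 * g1) * (f2 * g2) * S g3 * S f3) q) p) g"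
        unfolding TT' T'_def by (subst sw_swap[OF vs_scale]) (simp add: mult.assoc)
      also have "\<dots> = sw scale (\<lambda>q g3. scale (\<epsilon> q) (scale (\<epsilon> p) (S g3 * S f3))) g"
      proof -
        have "sw scale (\<lambda>f1 f2. sw scale (\<lambda>g1 g2. S (f1 * g1) * (f2 * g2) * S g3 * S f3) q) p
            = sw scale (\<lambda>a b. S a * b * S g3 * S f3) (p * q)" for q g3
          by (rule sw_mult[OF vs_scale, symmetric]) (simp add: ml)
        moreover have "sw scale (\<lambda>a b. S a * b * S g3 * S f3) h = scale (\<epsilon> h) (S g3 * S f3)" for h g3
          using sw_antipode_left[OF vs_scale, of "\<lambda>y. y * S g3 * S f3" h] by (simp add: ml)
        ultimately show ?thesis by (simp add: counit_mult mult.commute)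
      qed
      also have "\<dots> = scale (\<epsilon> p) (S g * S f3)"
        by (rule sw_counit_left[OF vs_scale]) (simp add: ml mult.commute)
      finally show ?thesis .
    qed
    then show ?thesis
      using sw_counit_left[OF vs_scale, of "\<lambda>f3. S g * S f3" f] by (simp add: ml)
  qed
  moreover have "sw scale (\<lambda>p f3. sw scale (\<lambda>f1 f2. T f1 f2 f3) p) f = sw scale (\<lambda>f1 p. sw scale (\<lambda>f2 f3. T f1 f2 f3) p) f"
    by (rule sw_coassoc[OF vs_scale]) (simp add: T1 ml)
  ultimately show ?thesis by simp
qed

section \<open>Primitive elements\<close>

definition primitive :: "'h \<Rightarrow> bool" where
  "primitive d \<longleftrightarrow> \<Delta> d = coset rel2 (basis_vec (d, 1) + basis_vec (1, d))"

lemma sw_primitive: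
  assumes "vector_space sc" "bil sc B" "primitive d"
  shows "sw sc B d = B d 1 + B 1 d"
proof -
  interpret m: vector_space sc by fact
  have "basis_vec (d, 1) + basis_vec (1, d) \<in> \<Delta> d"
    using assms(3) by (simp add: primitive_def coset_def rel2_def fs.span_zero)
  from sw_eq[OF assms(1,2) this] show ?thesis by (simp add: m.lin_ext_add)
qed

lemma counit_primitive: assumes "primitive d" shows "\<epsilon> d = 0"
proof -
  have "sw scale (\<lambda>p q. scale (\<epsilon> p) q) d = scale (\<epsilon> d) 1 + scale (\<epsilon> 1) d"
    by (rule sw_primitive[OF vs_scale _ assms]) (simp add: bil_def lin_def alg_simps)
  moreover have "sw scale (\<lambda>p q. scale (\<epsilon> p) q) d = d" by (rule sw_counit_left[OF vs_scale lin_ident])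
  ultimately show ?thesis by (simp add: counit_one)
qed

lemma S_primitive: assumes "primitive d" shows "S d = - d"
proof -
  have "sw scale (\<lambda>p q. S p * q) d = S d * 1 + S 1 * d"
    by (rule sw_primitive[OF vs_scale _ assms]) (simp add: bil_def lin_def alg_simps)
  moreover have "sw scale (\<lambda>p q. S p * q) d = scale (\<epsilon> d) 1" by (rule sw_antipode_left[OF vs_scale lin_ident])
  ultimately show ?thesis by (simp add: counit_primitive[OF assms] S_one eq_neg_iff_add_eq_0)
qed

text \<open>The contraction \<open>\<Sum> \<langle>x, f\<^sub>1\<rangle> f\<^sub>2\<close>.\<close>

definition contract :: "('h \<Rightarrow> 'k) \<Rightarrow> 'h \<Rightarrow> 'h" where
  "contract x f = sw scale (\<lambda>p q. scale (x p) q) f"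

lemma contract_bil: "lin scale (*) x \<Longrightarrow> bil scale (\<lambda>p q. scale (x p) q)"
  by (simp add: bil_def lin_def alg_simps mult.commute)

lemma contract_lin: "lin scale (*) x \<Longrightarrow> lin scale scale (contract x)"
  unfolding contract_def by (rule sw_lin[OF vs_scale contract_bil])

lemma contract_fun_add: "contract (\<lambda>h. x h + y h) f = contract x f + contract y f"
  and contract_fun_scale: "contract (\<lambda>h. c * x h) f = scale c (contract x f)"
  using sw_fun_scale[OF vs_scale, of c "\<lambda>p q. scale (x p) q" f]
  by (simp_all add: contract_def scale_left_distrib sw_fun_add[OF vs_scale])

lemma contract_one: "lin scale (*) x \<Longrightarrow> contract x 1 = scale (x 1) 1"
  unfolding contract_def by (simp add: sw_one[OF vs_scale contract_bil])

lemma contract_counit: "contract \<epsilon> f = f"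
  unfolding contract_def by (rule sw_counit_left[OF vs_scale lin_ident])

lemma counit_contract: "lin scale (*) x \<Longrightarrow> \<epsilon> (contract x f) = x f"
  using sw_counit_right[OF vector_space_mult, of x f]
  by (simp add: contract_def sw_lin_apply[OF vector_space_mult counit_lin] lin_scale[OF counit_lin] mult.commute)

lemma contract_mult_primitive:
  assumes x: "lin scale (*) x" and d: "primitive d"
  shows "contract x (f * d) = contract x f * d + contract (\<lambda>h. x (h * d)) f"
proof -
  have "contract x (f * d) = sw scale (\<lambda>p q. sw scale (\<lambda>r s. scale (x (p * r)) (q * s)) d) f"
    unfolding contract_def by (rule sw_mult[OF vs_scale contract_bil[OF x]])
  also have "\<dots> = sw scale (\<lambda>p q. scale (x (p * d)) q + scale (x p) (q * d)) f"
  proof -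
    have "sw scale (\<lambda>r s. scale (x (p * r)) (q * s)) d = scale (x (p * d)) q + scale (x p) (q * d)" for p q
      by (subst sw_primitive[OF vs_scale _ d])
         (simp_all add: bil_def lin_def alg_simps lin_add[OF x] lin_scale[OF x] mult.commute)
    then show ?thesis by simp
  qed
  also have "\<dots> = contract (\<lambda>h. x (h * d)) f + contract x f * d"
    using sw_lin_apply[OF vs_scale, of scale "\<lambda>y. y * d" "\<lambda>p q. scale (x p) q" f]
    by (simp add: contract_def sw_fun_add[OF vs_scale] lin_def alg_simps)
  finally show ?thesis by simp
qed

lemma sw_expand:
  assumes vs: "vector_space sc" and B: "bil sc B"
    and E: "\<And>p. p \<in> fst ` Poly_Mapping.keys (rep (\<Delta> h)) \<Longrightarrow> p = (\<Sum>e\<in>E. scale (x e p) e)"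
  shows "sw sc B h = (\<Sum>e\<in>E. B e (contract (x e) h))"
  unfolding sw_def contract_def by (rule tensor_expand[OF vs _ _ E]) (use B in \<open>auto simp: bil_def\<close>)

text \<open>
  The smallest space \<open>C\<close> such that \<open>\<Delta>\<close> maps \<open>E\<close> to \<open>H \<otimes> C\<close>.
\<close>

definition contractions :: "'h set \<Rightarrow> 'h set" where
  "contractions E = span {contract x f | x f. lin scale (*) x \<and> f \<in> E}"

lemma contractions_fin_dim:
  assumes "fin_dim scale E" shows "fin_dim scale (contractions E)"
proof -
  from assms obtain T where T: "finite T" "E \<subseteq> span T" by (auto simp: fin_dim_def)
  define R where "R = (\<Union>t\<in>T. snd ` Poly_Mapping.keys (rep (\<Delta> t)))"
  have "contract x f \<in> span R" if x: "lin scale (*) x" and "f \<in> E" for x f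
  proof -
    have "f \<in> span T" using T that by auto
    then show ?thesis
    proof (induct rule: span_induct_alt)
      case base
      show ?case by (simp add: lin_zero[OF contract_lin[OF x]] span_zero)
    next
      case (step c t g)
      have "contract x t \<in> span R"
        unfolding contract_def sw_def
        by (rule lin_ext_mem)
          (use step(1) in \<open>auto simp: R_def case_prod_unfold intro!: span_scale[OF span_base] image_eqI\<close>)
      with step show ?case
        by (simp add: lin_add[OF contract_lin[OF x]] lin_scale[OF contract_lin[OF x]] span_add span_scale)
    qed
  qed
  then have "contractions E \<subseteq> span R"
    unfolding contractions_def by (intro span_minimal) auto
  moreover have "finite R" using T by (auto simp: R_def)
  ultimately show ?thesis by (auto simp: fin_dim_def)
qed

lemma contractions_stable:
  assumes d: "primitive d" and E: "\<And>h. h \<in> E \<Longrightarrow> h * d \<in> E" and "h \<in> contractions E"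
  shows "h * d \<in> contractions E"
  using assms(3) unfolding contractions_def
proof (induct rule: span_induct_alt)
  case base
  show ?case by (simp add: span_zero)
next
  case (step c g h)
  then obtain x f where x: "lin scale (*) x" and f: "f \<in> E" and g: "g = contract x f" by auto
  have "lin scale (*) (\<lambda>h. x (h * d))" using x by (simp add: lin_def alg_simps)
  then have "contract x (f * d) - contract (\<lambda>h. x (h * d)) f \<in> span {contract x f | x f. lin scale (*) x \<and> f \<in> E}"
    using x f E by (intro span_diff span_base) blast+
  then have "g * d \<in> span {contract x f | x f. lin scale (*) x \<and> f \<in> E}"
    unfolding g by (simp add: contract_mult_primitive[OF x d])
  with step show ?case by (simp add: alg_simps span_add span_scale)
qed

end

locale hopf_algebra_char_0 = hopf_algebra scale \<Delta> \<epsilon> S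
  for scale :: "'k::field_char_0 \<Rightarrow> 'h::ring_1 \<Rightarrow> 'h" and \<Delta> \<epsilon> S
begin

text \<open>
  By \<open>contract_mult_primitive\<close>, right multiplication by \<open>d\<close> and the contractions with functionals that vanish
  at \<open>1\<close> satisfy Heisenberg relations on the vector \<open>1\<close>. The relations are nondegenerate because \<open>d\<close> is not a
  scalar: \<open>\<epsilon> d = 0\<close>.
\<close>

lemma primitive_powers_not_fin_dim:
  assumes d: "primitive d" "d \<noteq> 0" and "fin_dim scale R"
  shows "\<exists>n. d ^ n \<notin> R"
proof -
  let ?Q = "{contract x | x. lin scale (*) x \<and> x 1 = 0}"
  have d1: "d \<notin> span {1}"
    using d counit_primitive[OF d(1)] by (auto simp: span_singleton lin_scale[OF counit_lin] counit_one)
  have xd: "lin scale (*) (\<lambda>h. x (h * d))" if "lin scale (*) x" for x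
    using that by (simp add: lin_def alg_simps)
  interpret heisenberg scale "\<lambda>_ h. h * d" 1 ?Q 1
  proof
    show "lin scale scale (\<lambda>h. h * d)" by (simp add: lin_def alg_simps)
    fix q assume "q \<in> ?Q"
    then obtain x where x: "lin scale (*) x" "x 1 = 0" and q: "q = contract x" by auto
    show "lin scale scale q" unfolding q by (rule contract_lin[OF x(1)])
    show "q 1 = 0" unfolding q by (simp add: contract_one[OF x(1)] x(2))
    define x' where "x' = (\<lambda>h. x (h * d) + - x d * \<epsilon> h)"
    have "lin scale (*) x'" using xd[OF x(1)] counit_lin unfolding x'_def by (simp add: lin_def algebra_simps)
    then have "contract x' \<in> ?Q" by (auto simp: x'_def counit_one)
    moreover have "q (v * d) = q v * d + scale (x d) v + contract x' v" for v
      unfolding q contract_mult_primitive[OF x(1) d(1)] x'_def contract_fun_add contract_fun_scale contract_counit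
      by simp
    ultimately show "\<exists>c. \<exists>q'\<in>?Q. \<forall>v. q (v * d) = q v * d + scale c v + q' v" by blast
  qed
  obtain x where x: "lin scale (*) x" "\<And>u. u \<in> span {1} \<Longrightarrow> x u = 0" "x d = 1"
    using functional_separates[OF subspace_span d1] by blast
  have x1: "x 1 = 0" by (intro x span_base) simp
  have "\<exists>i. ((\<lambda>h. h * d) ^^ i) 1 \<notin> R"
  proof (rule powers_not_fin_dim[OF refl _ _ _ assms(3)])
    show "contract x \<in> ?Q" using x x1 by auto
    show "contract x (1 * d) = 1"
      using contract_mult_primitive[OF x(1) d(1), of 1] xd[OF x(1)] x(3) x1 by (simp add: contract_one[OF x(1)] contract_one)
  qed simp
  moreover have "((\<lambda>h. h * d) ^^ i) 1 = d ^ i" for i by (induct i) (auto simp: power_commutes)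
  ultimately show ?thesis by simp
qed

text \<open>
  A substitute for the absence of zero divisors in the enveloping algebra. The coefficient spaces of \<open>E\<close>
  are again finite-dimensional and stable under \<open>d\<close>. One of their elements \<open>h\<close> has \<open>\<epsilon> h = 1\<close>, so
  \<open>d\<^sup>n = \<Sum> S h\<^sub>1 (h\<^sub>2 d\<^sup>n)\<close> stays in a finite-dimensional space for all \<open>n\<close>.
\<close>

lemma primitive_fin_dim_stable:
  assumes d: "primitive d" and E: "fin_dim scale E" "\<And>h. h \<in> E \<Longrightarrow> h * d \<in> E" and f: "f \<in> E" "f \<noteq> 0"
  shows "d = 0"
proof (rule ccontr)
  assume "d \<noteq> 0"
  define C where "C = contractions E"
  define C' where "C' = contractions C"
  have C'f: "fin_dim scale C'" unfolding C'_def C_def by (intro contractions_fin_dim E)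
  have C's: "h * d \<in> C'" if "h \<in> C'" for h
    using that unfolding C'_def C_def by (intro contractions_stable[OF d]) (use E in auto)
  have C'p: "h * d ^ n \<in> C'" if "h \<in> C'" for h n
  proof (induct n)
    case (Suc n)
    have "h * d ^ Suc n = (h * d ^ n) * d" by (simp only: power_Suc2 mult.assoc)
    with C's[OF Suc] show ?case by simp
  qed (use that in simp)
  obtain x0 where x0: "lin scale (*) x0" "x0 f = 1" using functional_nonzero[OF f(2)] by auto
  define h where "h = contract x0 f"
  have h: "h \<in> C" "\<epsilon> h = 1"
    using f x0 by (auto simp: h_def C_def contractions_def counit_contract intro!: span_base)
  have "finite (fst ` Poly_Mapping.keys (rep (\<Delta> h)))" by simp
  then obtain B e where Be: "finite B" "\<And>b. b \<in> B \<Longrightarrow> lin scale (*) (e b)"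
    "\<And>p. p \<in> span (fst ` Poly_Mapping.keys (rep (\<Delta> h))) \<Longrightarrow> p = (\<Sum>b\<in>B. scale (e b p) b)"
    by (rule finite_coordinates) blast
  obtain R where R: "finite R" "C' \<subseteq> span R" using C'f by (auto simp: fin_dim_def)
  define R' where "R' = (\<lambda>(b, r). S b * r) ` (B \<times> R)"
  have mem: "S b * r \<in> span R'" if "b \<in> B" "r \<in> span R" for b r
    using that(2)
  proof (induct rule: span_induct_alt)
    case (step c y z)
    then have "S b * y \<in> span R'" using that(1) by (auto simp: R'_def intro!: span_base)
    with step show ?case by (simp add: alg_simps span_add span_scale)
  qed (simp add: span_zero)
  \<comment> \<open>\<open>d\<^sup>n = \<Sum> S h\<^sub>1 (h\<^sub>2 d\<^sup>n)\<close> because \<open>\<epsilon> h = 1\<close>.\<close>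
  have "d ^ n \<in> span R'" for n
  proof -
    have "d ^ n = sw scale (\<lambda>p q. S p * q * d ^ n) h"
      by (subst sw_antipode_left[OF vs_scale, of "\<lambda>y. y * d ^ n"]) (simp_all add: h lin_def alg_simps)
    also have "\<dots> = (\<Sum>b\<in>B. S b * contract (e b) h * d ^ n)"
      by (rule sw_expand[OF vs_scale]) (use Be in \<open>auto simp: bil_def lin_def alg_simps span_base\<close>)
    also have "\<dots> \<in> span R'"
    proof (rule span_sum)
      fix b assume b: "b \<in> B"
      then have "contract (e b) h \<in> C'" using Be(2) h(1) by (auto simp: C'_def contractions_def intro!: span_base)
      then have "contract (e b) h * d ^ n \<in> span R" using C'p R(2) by auto
      from mem[OF b this] show "S b * contract (e b) h * d ^ n \<in> span R'" by (simp add: mult.assoc)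
    qed
    finally show ?thesis .
  qed
  moreover have "fin_dim scale (span R')" by (rule fin_dim_span_finite) (use Be R in \<open>auto simp: R'_def\<close>)
  ultimately show False using primitive_powers_not_fin_dim[OF d \<open>d \<noteq> 0\<close>] by blast
qed

end

context hopf_algebra
begin

lemma antipode_collapse:
  assumes vs: "vector_space sc" and G: "bil sc G"
  shows "sw sc (\<lambda>p r. sw sc (\<lambda>a b. G (p * S a) b) r) f = G 1 f"
    and "sw sc (\<lambda>p r. sw sc (\<lambda>a b. G (S p * a) b) r) f = G 1 f"
proof -
  interpret m: vector_space sc by fact
  have G1: "lin scale sc (\<lambda>p. G p q)" and G2: "lin scale sc (G p)" for p q
    using G by (auto simp: bil_def)
  note Gs = lin_add[OF G1] lin_add[OF G2] lin_scale[OF G1] lin_scale[OF G2]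
  have "sw sc (\<lambda>p r. sw sc (\<lambda>a b. G (p * S a) b) r) f = sw sc (\<lambda>p r. sw sc (\<lambda>a b. G (a * S b) r) p) f"
    by (rule sw_coassoc[OF vs, symmetric]) (simp add: tril_def lin_def alg_simps Gs)
  also have "\<dots> = sw sc (\<lambda>p r. sc (\<epsilon> p) (G 1 r)) f"
    by (simp add: sw_antipode_right[OF vs G1])
  also have "\<dots> = G 1 f" by (rule sw_counit_left[OF vs G2])
  finally show "sw sc (\<lambda>p r. sw sc (\<lambda>a b. G (p * S a) b) r) f = G 1 f" .
  have "sw sc (\<lambda>p r. sw sc (\<lambda>a b. G (S p * a) b) r) f = sw sc (\<lambda>p r. sw sc (\<lambda>a b. G (S a * b) r) p) f"
    by (rule sw_coassoc[OF vs, symmetric]) (simp add: tril_def lin_def alg_simps Gs)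
  also have "\<dots> = sw sc (\<lambda>p r. sc (\<epsilon> p) (G 1 r)) f"
    by (simp add: sw_antipode_left[OF vs G1])
  also have "\<dots> = G 1 f" by (rule sw_counit_left[OF vs G2])
  finally show "sw sc (\<lambda>p r. sw sc (\<lambda>a b. G (S p * a) b) r) f = G 1 f" .
qed

end

section \<open>The smash product\<close>

context smash_product
begin

lemma generators_induct [case_names iota gamma add scale mult]:
  assumes i: "\<And>x. P (\<iota> x)" and g: "\<And>g. P (\<gamma> g)"
    and a: "\<And>f h. P f \<Longrightarrow> P h \<Longrightarrow> P (f + h)" and s: "\<And>c f. P f \<Longrightarrow> P (scale c f)"
    and m: "\<And>f h. P f \<Longrightarrow> P h \<Longrightarrow> P (f * h)"
  shows "P f"
proof -
  have 1: "P 1" using g[of gone] by (simp add: gamma_one)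
  have 0: "P 0" using s[OF 1, of 0] by simp
  have sum: "P (sum u A)" if "\<And>x. x \<in> A \<Longrightarrow> P (u x)" for u :: "'x \<Rightarrow> 'h" and A
    using that by (induct A rule: infinite_finite_induct) (auto simp: 0 a)
  have "P (prod_list (map \<iota> xs))" for xs by (induct xs) (auto simp: 1 i m)
  then have w: "P y" if "y \<in> generated_subalgebra \<iota>" for y
    using that unfolding generated_subalgebra_def word_eval_def lin_ext_def by (elim rangeE) (simp add: sum s)
  obtain u where u: "\<And>g. Poly_Mapping.lookup u g \<in> generated_subalgebra \<iota>"
    "f = (\<Sum>g\<in>Poly_Mapping.keys u. Poly_Mapping.lookup u g * \<gamma> g)"
    using decomposition[of f] by blast
  then show ?thesis by (subst u(2)) (simp add: sum m w[OF u(1)] g)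
qed

lemma primitive_iota: "primitive (\<iota> x)"
  by (simp add: primitive_def comult_iota)

lemma iota_lin: "lin sd scale \<iota>"
  and iota_lb: "\<iota> (lb x y) = \<iota> x * \<iota> y - \<iota> y * \<iota> x"
proof -
  have ev: "word_eval \<iota> X = 0" if "X \<in> (\<Union>us vs. slot_rels sd (\<lambda>x. us @ [x] @ vs)) \<union>
      {basis_vec (us @ [x, y] @ vs) - basis_vec (us @ [y, x] @ vs)
         - basis_vec (us @ [lb x y] @ vs) | us x y vs. True}" for X
    using enveloping fs.span_base[OF that] by (auto simp: d.env_ideal_def)
  have slot: "word_eval \<iota> X = 0" if "X \<in> slot_rels sd (\<lambda>x. [] @ [x] @ [])" for X
    using that by (intro ev) blast
  show "lin sd scale \<iota>"
  proof (rule linI)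
    fix x y c
    have "word_eval \<iota> (basis_vec [x + y] - basis_vec [x] - basis_vec [y]) = 0"
      by (rule slot) (auto simp: slot_rels_def)
    then show "\<iota> (x + y) = \<iota> x + \<iota> y" by (simp add: word_eval_def lin_ext_diff lin_ext_add algebra_simps)
    have "word_eval \<iota> (basis_vec [sd c x] - fscale c (basis_vec [x])) = 0"
      by (rule slot) (auto simp: slot_rels_def)
    then show "\<iota> (sd c x) = scale c (\<iota> x)" by (simp add: word_eval_def lin_ext_diff lin_ext_fscale)
  qed
  have "word_eval \<iota> (basis_vec ([] @ [x, y] @ []) - basis_vec ([] @ [y, x] @ []) - basis_vec ([] @ [lb x y] @ [])) = 0"
    by (rule ev) blast
  then show "\<iota> (lb x y) = \<iota> x * \<iota> y - \<iota> y * \<iota> x" by (simp add: word_eval_def lin_ext_diff lin_ext_add algebra_simps)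
qed

lemma sw_gamma:
  assumes "vector_space sc" "bil sc B" shows "sw sc B (\<gamma> g) = B (\<gamma> g) (\<gamma> g)"
proof -
  interpret m: vector_space sc by fact
  have "basis_vec (\<gamma> g, \<gamma> g) \<in> \<Delta> (\<gamma> g)"
    by (simp add: comult_gamma coset_def rel2_def fs.span_zero)
  from sw_eq[OF assms this] show ?thesis by simp
qed

lemma gamma_inverse: "\<gamma> g * \<gamma> (ginv g) = 1" "\<gamma> (ginv g) * \<gamma> g = 1"
  by (simp_all add: gamma_mult[symmetric] gamma_one)

lemma S_gamma: "S (\<gamma> g) = \<gamma> (ginv g)"
proof -
  have "\<gamma> g = scale (\<epsilon> (\<gamma> g)) (\<gamma> g)"
    using sw_counit_left[OF vs_scale lin_ident, of "\<gamma> g"]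
    by (subst (asm) sw_gamma[OF vs_scale]) (simp_all add: bil_def lin_def alg_simps mult.commute)
  then have "\<gamma> g * \<gamma> (ginv g) = scale (\<epsilon> (\<gamma> g)) (\<gamma> g * \<gamma> (ginv g))"
    by (metis scale_mult_left)
  then have e: "\<epsilon> (\<gamma> g) = 1"
    using scale_cancel_right[of 1 1 "\<epsilon> (\<gamma> g)"] by (simp add: gamma_inverse)
  have "S (\<gamma> g) * \<gamma> g = 1"
    using sw_antipode_left[OF vs_scale lin_ident, of "\<gamma> g"] e
    by (subst (asm) sw_gamma[OF vs_scale]) (simp_all add: bil_def lin_def alg_simps)
  then have "S (\<gamma> g) * (\<gamma> g * \<gamma> (ginv g)) = \<gamma> (ginv g)" by (simp only: mult.assoc[symmetric] mult_1_left)
  then show ?thesis by (simp add: gamma_inverse)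
qed

lemma antipode_involutive: "S (S f) = f"
proof (induct f rule: generators_induct)
  case (iota x)
  then show ?case by (simp add: S_primitive[OF primitive_iota] lin_neg[OF S_lin])
qed (simp_all add: S_gamma S_mult alg_simps)

text \<open>
  \<open>H\<close> is cocommutative because the generators are, and cocommutativity passes to products.
\<close>

lemma sw_cocomm:
  assumes vs: "vector_space sc" and B: "bil sc B"
  shows "sw sc (\<lambda>p q. B q p) f = sw sc B f"
  using B
proof (induct f arbitrary: B rule: generators_induct)
  case (iota x)
  have "bil sc (\<lambda>p q. B q p)" by (rule bil_flip[OF iota])
  with iota show ?case by (simp add: sw_primitive[OF vs _ primitive_iota] add.commute)
next
  case (gamma g)
  have "bil sc (\<lambda>p q. B q p)" by (rule bil_flip[OF gamma])
  with gamma show ?case by (simp add: sw_gamma[OF vs])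
next
  case (add f h)
  have "bil sc (\<lambda>p q. B q p)" by (rule bil_flip[OF add(3)])
  then show ?case by (simp only: sw_add[OF vs] add(3) add(1,2)[OF add(3)])
next
  case (scale c f)
  have "bil sc (\<lambda>p q. B q p)" by (rule bil_flip[OF scale(2)])
  then show ?case by (simp only: sw_scale[OF vs] scale(2) scale(1)[OF scale(2)])
next
  case (mult f h)
  have B1: "lin scale sc (\<lambda>p. B p q)" and B2: "lin scale sc (B p)" for p q
    using mult(3) by (auto simp: bil_def)
  note Bs = lin_add[OF B1] lin_add[OF B2] lin_scale[OF B1] lin_scale[OF B2] bil_def lin_def alg_simps
    sw_fun_add[OF vs] sw_fun_scale[OF vs]
  have flip: "bil sc (\<lambda>p q. B q p)" by (rule bil_flip[OF mult(3)])
  have "sw sc (\<lambda>p q. B q p) (f * h) = sw sc (\<lambda>p q. sw sc (\<lambda>r s. B (q * s) (p * r)) h) f"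
    by (rule sw_mult[OF vs flip])
  also have "\<dots> = sw sc (\<lambda>p q. sw sc (\<lambda>r s. B (q * r) (p * s)) h) f"
  proof -
    have "sw sc (\<lambda>r s. B (q * s) (p * r)) h = sw sc (\<lambda>r s. B (q * r) (p * s)) h" for p q
      by (rule mult(2)[of "\<lambda>r s. B (q * r) (p * s)"]) (simp add: Bs)
    then show ?thesis by simp
  qed
  also have "\<dots> = sw sc (\<lambda>p q. sw sc (\<lambda>r s. B (p * r) (q * s)) h) f"
    by (rule mult(1)[of "\<lambda>p q. sw sc (\<lambda>r s. B (p * r) (q * s)) h"]) (simp add: Bs)
  also have "\<dots> = sw sc B (f * h)" by (rule sw_mult[OF vs mult(3), symmetric])
  finally show ?case .
qed

lemma bil_antipode: "bil sc B \<Longrightarrow> bil sc (\<lambda>p q. B (S q) (S p))"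
  using S_lin unfolding bil_def by (auto intro: lin_compose)

text \<open>
  The antipode reverses the comultiplication; again it suffices to know this on generators.
\<close>

lemma sw_antipode:
  assumes vs: "vector_space sc" and B: "bil sc B"
  shows "sw sc B (S f) = sw sc (\<lambda>p q. B (S q) (S p)) f"
  using B
proof (induct f arbitrary: B rule: generators_induct)
  case (iota x)
  note B1 = bil_lin(1)[OF iota] and B2 = bil_lin(2)[OF iota]
  have "bil sc (\<lambda>p q. B (S q) (S p))" by (rule bil_antipode[OF iota])
  then have "sw sc (\<lambda>p q. B (S q) (S p)) (\<iota> x) = B (S 1) (S (\<iota> x)) + B (S (\<iota> x)) (S 1)"
    by (rule sw_primitive[OF vs _ primitive_iota])
  also have "\<dots> = - (B (\<iota> x) 1 + B 1 (\<iota> x))"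
    by (simp add: S_one S_primitive[OF primitive_iota] lin_neg[OF B1] lin_neg[OF B2])
  also have "\<dots> = sw sc B (S (\<iota> x))"
    by (simp add: S_primitive[OF primitive_iota] lin_neg[OF sw_lin[OF vs iota]] sw_primitive[OF vs iota primitive_iota])
  finally show ?case ..
next
  case (gamma g)
  have "bil sc (\<lambda>p q. B (S q) (S p))" by (rule bil_antipode[OF gamma])
  with gamma show ?case by (simp add: sw_gamma[OF vs] S_gamma)
next
  case (add f h)
  have "bil sc (\<lambda>p q. B (S q) (S p))" by (rule bil_antipode[OF add(3)])
  then show ?case by (simp only: sw_add[OF vs] S_simps add(3) add(1,2)[OF add(3)])
next
  case (scale c f)
  have "bil sc (\<lambda>p q. B (S q) (S p))" by (rule bil_antipode[OF scale(2)])
  then show ?case by (simp only: sw_scale[OF vs] S_simps scale(2) scale(1)[OF scale(2)])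
next
  case (mult f h)
  have B1: "lin scale sc (\<lambda>p. B p q)" and B2: "lin scale sc (B p)" for p q
    using mult(3) by (auto simp: bil_def)
  note Bs = lin_add[OF B1] lin_add[OF B2] lin_scale[OF B1] lin_scale[OF B2] bil_def lin_def alg_simps
    sw_fun_add[OF vs] sw_fun_scale[OF vs]
  have "sw sc B (S (f * h)) = sw sc (\<lambda>p q. sw sc (\<lambda>r s. B (p * r) (q * s)) (S f)) (S h)"
    by (simp add: S_mult sw_mult[OF vs mult(3)])
  also have "\<dots> = sw sc (\<lambda>p q. sw sc (\<lambda>r s. B (p * S s) (q * S r)) f) (S h)"
  proof -
    have "sw sc (\<lambda>r s. B (p * r) (q * s)) (S f) = sw sc (\<lambda>r s. B (p * S s) (q * S r)) f" for p q
      by (rule mult(1)) (simp add: Bs)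
    then show ?thesis by simp
  qed
  also have "\<dots> = sw sc (\<lambda>p q. sw sc (\<lambda>r s. B (S q * S s) (S p * S r)) f) h"
    by (rule mult(2)) (simp add: Bs)
  also have "\<dots> = sw sc (\<lambda>r s. sw sc (\<lambda>p q. B (S q * S s) (S p * S r)) h) f"
    by (rule sw_swap[OF vs])
  also have "\<dots> = sw sc (\<lambda>p q. B (S q) (S p)) (f * h)"
    by (subst sw_mult[OF vs]) (simp_all add: Bs S_mult)
  finally show ?case .
qed

end

section \<open>Straightening\<close>

lemma lin_ext_basis_id: "lin_ext fscale basis_vec X = X"
proof (rule poly_mapping_eqI)
  fix z
  have "Poly_Mapping.lookup (lin_ext fscale basis_vec X) z
      = (\<Sum>x\<in>Poly_Mapping.keys X. Poly_Mapping.lookup (fscale (Poly_Mapping.lookup X x) (basis_vec x)) z)"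
    unfolding lin_ext_def by (rule lookup_sum)
  also have "\<dots> = (\<Sum>x\<in>Poly_Mapping.keys X. if x = z then Poly_Mapping.lookup X z else 0)"
    by (rule sum.cong) (auto simp: lookup_fscale lookup_single)
  also have "\<dots> = Poly_Mapping.lookup X z" by (auto simp: in_keys_iff)
  finally show "Poly_Mapping.lookup (lin_ext fscale basis_vec X) z = Poly_Mapping.lookup X z" .
qed

lemma functional_lin_ext: "lin fscale (*) \<xi> \<Longrightarrow> \<xi> X = lin_ext (*) (\<lambda>z. \<xi> (basis_vec z)) X"
  using lin_lin_ext_apply[OF vector_space_mult, of fscale \<xi> basis_vec X] by (simp add: lin_ext_basis_id)

locale smash_module = smash_product sd lb gmul gone ginv gact scale \<Delta> \<epsilon> S \<iota> \<gamma> + left_module act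
  for sd :: "'k::field \<Rightarrow> 'd::ab_group_add \<Rightarrow> 'd" and lb
    and gmul :: "'g \<Rightarrow> 'g \<Rightarrow> 'g" and gone ginv gact
    and scale :: "'k \<Rightarrow> 'h::ring_1 \<Rightarrow> 'h" and \<Delta> \<epsilon> S \<iota> \<gamma>
    and act :: "'h \<Rightarrow> 'm::ab_group_add \<Rightarrow> 'm"
begin

abbreviation "msc \<equiv> mscale act"

lemma act_scale_left: "act (scale c f) u = msc c (act f u)"
  by (simp add: mscale_def act_mult[symmetric] scale_mult_left)

lemma act_scale_right: "act f (msc c u) = msc c (act f u)"
  by (simp add: mscale_def act_mult[symmetric] scale_mult_left scale_mult_right)

lemma vs_msc: "vector_space msc"
proof
  fix a b :: 'k and x y :: 'm
  show "msc a (x + y) = msc a x + msc a y" by (simp add: mscale_def act_add_right)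
  show "msc (a + b) x = msc a x + msc b x" by (simp add: mscale_def scale_left_distrib act_add_left)
  show "msc a (msc b x) = msc (a * b) x"
    by (simp add: mscale_def act_mult[symmetric] scale_mult_left scale_mult_right mult.commute)
  show "msc 1 x = x" by (simp add: mscale_def act_one)
qed

sublocale m: vector_space msc
  by (rule vs_msc)

lemmas act_simps = act_add_left act_add_right act_scale_left act_scale_right
  m.scale_right_distrib m.scale_left_distrib sw_fun_add[OF vs_msc] sw_fun_scale[OF vs_msc]

lemma act_lin_left: "lin scale msc (\<lambda>f. act f u)" and act_lin_right: "lin msc msc (act f)"
  by (simp_all add: lin_def act_simps)

text \<open>
  Every element \<open>(p \<otimes> q) \<otimes>\<^sub>H u\<close> equals \<open>\<Sum> (p S q\<^sub>1 \<otimes> 1) \<otimes>\<^sub>H q\<^sub>2 u\<close>; \<open>st x p q u\<close> is the contraction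
  of the latter with the functional \<open>x\<close>.
\<close>

definition st :: "('h \<Rightarrow> 'k) \<Rightarrow> 'h \<Rightarrow> 'h \<Rightarrow> 'm \<Rightarrow> 'm" where
  "st x p q u = sw msc (\<lambda>a b. msc (x (p * S a)) (act b u)) q"

lemma
  assumes x: "lin scale (*) x"
  shows st_lin1: "lin scale msc (\<lambda>p. st x p q u)"
    and st_lin2: "lin scale msc (\<lambda>q. st x p q u)"
    and st_lin3: "lin msc msc (st x p q)"
proof -
  note xs = lin_add[OF x] lin_scale[OF x]
  show "lin scale msc (\<lambda>p. st x p q u)"
    by (simp add: st_def lin_def alg_simps act_simps xs flip: m.scale_scale)
  show "lin msc msc (st x p q)"
  proof (rule linI)
    fix u v c
    show "st x p q (u + v) = st x p q u + st x p q v" by (simp add: st_def act_simps)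
    show "st x p q (msc c u) = msc c (st x p q u)"
      by (simp only: st_def act_simps m.scale_left_commute[of _ c])
  qed
  show "lin scale msc (\<lambda>q. st x p q u)"
    unfolding st_def by (rule sw_lin[OF vs_msc]) (simp add: bil_def lin_def alg_simps act_simps xs mult.commute)
qed

lemma st_mult_right:
  assumes x: "lin scale (*) x"
  shows "st x p (q * f) u = sw msc (\<lambda>a b. sw msc (\<lambda>c d. msc (x (p * S c * S a)) (act b (act d u))) f) q"
  unfolding st_def
  by (subst sw_mult[OF vs_msc])
    (simp_all add: bil_def lin_def alg_simps act_simps S_mult act_mult mult.assoc lin_add[OF x] lin_scale[OF x] mult.commute)

text \<open>
  The contraction is compatible with the relation \<open>w \<Delta>(f) \<otimes> u = w \<otimes> f u\<close>, because
  \<open>\<Sum> p f\<^sub>1 S (q\<^sub>1 f\<^sub>2) \<otimes> q\<^sub>2 f\<^sub>3 = \<Sum> p S q\<^sub>1 \<otimes> q\<^sub>2 f\<close>.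
\<close>

lemma st_balanced:
  assumes x: "lin scale (*) x"
  shows "sw msc (\<lambda>f1 f2. st x (p * f1) (q * f2) u) f = st x p q (act f u)"
proof -
  note xs = lin_add[OF x] lin_scale[OF x]
  have "sw msc (\<lambda>f1 f2. st x (p * f1) (q * f2) u) f
      = sw msc (\<lambda>a b. sw msc (\<lambda>f1 f2. sw msc (\<lambda>c d. msc (x (p * (f1 * S c) * S a)) (act b (act d u))) f2) f) q"
    by (simp only: st_mult_right[OF x]) (subst sw_swap[OF vs_msc], simp add: mult.assoc)
  also have "\<dots> = sw msc (\<lambda>a b. msc (x (p * 1 * S a)) (act b (act f u))) q"
  proof -
    have "sw msc (\<lambda>f1 f2. sw msc (\<lambda>c d. msc (x (p * (f1 * S c) * S a)) (act b (act d u))) f2) f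
        = msc (x (p * 1 * S a)) (act b (act f u))" for a b
      by (rule antipode_collapse(1)[OF vs_msc, of "\<lambda>y d. msc (x (p * y * S a)) (act b (act d u))"])
        (simp add: bil_def lin_def alg_simps act_simps xs mult.commute)
    then show ?thesis by simp
  qed
  finally show ?thesis by (simp add: st_def)
qed

text \<open>
  Contraction after straightening: \<open>pair1\<close> moves the second factor of \<open>H \<otimes> H\<close> into \<open>M\<close> and contracts the first,
  \<open>pair2\<close> exchanges their roles.
\<close>

definition pair1 :: "('h \<Rightarrow> 'k) \<Rightarrow> (('h \<times> 'h) \<times> 'm \<Rightarrow>\<^sub>0 'k) \<Rightarrow> 'm" where
  "pair1 x X = lin_ext msc (\<lambda>((p, q), u). st x p q u) X"

definition pair2 :: "('h \<Rightarrow> 'k) \<Rightarrow> (('h \<times> 'h) \<times> 'm \<Rightarrow>\<^sub>0 'k) \<Rightarrow> 'm" where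
  "pair2 x X = lin_ext msc (\<lambda>((p, q), u). st x q p u) X"

lemma lin_ext_rel2M:
  assumes t: "vector_space t"
    and T: "\<And>q u. lin scale t (\<lambda>p. T p q u)" "\<And>p u. lin scale t (\<lambda>q. T p q u)" "\<And>p q. lin msc t (T p q)"
    and bal: "\<And>p q f u. sw t (\<lambda>f1 f2. T (p * f1) (q * f2) u) f = T p q (act f u)"
    and X: "X \<in> rel2M act"
  shows "lin_ext t (\<lambda>((p, q), u). T p q u) X = 0"
proof -
  interpret t: vector_space t by fact
  show ?thesis using X unfolding rel2M_def
  proof (rule t.lin_ext_vanishes_on_span, elim UnE)
    fix Y assume "Y \<in> {lin_ext fscale (\<lambda>u. basis_vec (mult2 w u, m)) (rep (\<Delta> f)) - basis_vec (w, act f m) |w f m. True}"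
    then obtain w f m where Y: "Y = lin_ext fscale (\<lambda>u. basis_vec (mult2 w u, m)) (rep (\<Delta> f)) - basis_vec (w, act f m)"
      by blast
    show "lin_ext t (\<lambda>((p, q), u). T p q u) Y = 0"
      using bal[of "fst w" "snd w" m f]
      by (simp add: Y t.lin_ext_diff t.lin_ext_lin_ext mult2_def sw_def case_prod_unfold)
  qed (use T in \<open>auto elim!: t.lin_ext_slot_rels[rotated]\<close>)
qed

lemma pair1_rel2M: "lin scale (*) x \<Longrightarrow> X \<in> rel2M act \<Longrightarrow> pair1 x X = 0"
  unfolding pair1_def by (rule lin_ext_rel2M[OF vs_msc st_lin1 st_lin2 st_lin3 st_balanced])

lemma pair2_rel2M:
  assumes x: "lin scale (*) x" and X: "X \<in> rel2M act"
  shows "pair2 x X = 0"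
  unfolding pair2_def
proof (rule lin_ext_rel2M[OF vs_msc st_lin2[OF x] st_lin1[OF x] st_lin3[OF x] _ X])
  fix p q f u
  have "bil msc (\<lambda>f1 f2. st x (q * f1) (p * f2) u)"
    by (simp add: bil_def lin_def alg_simps lin_add[OF st_lin1[OF x]] lin_add[OF st_lin2[OF x]]
      lin_scale[OF st_lin1[OF x]] lin_scale[OF st_lin2[OF x]])
  from sw_cocomm[OF vs_msc this]
  show "sw msc (\<lambda>f1 f2. st x (q * f2) (p * f1) u) f = st x q p (act f u)"
    by (simp add: st_balanced[OF x])
qed

definition straighten :: "(('h \<times> 'h) \<times> 'm \<Rightarrow>\<^sub>0 'k) \<Rightarrow> ('h \<times> 'm \<Rightarrow>\<^sub>0 'k)" where
  "straighten X = lin_ext fscale (\<lambda>((p, q), u).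
     lin_ext fscale (\<lambda>(a, b). basis_vec (p * S a, act b u)) (rep (\<Delta> q))) X"

definition embed :: "('h \<times> 'm \<Rightarrow>\<^sub>0 'k) \<Rightarrow> (('h \<times> 'h) \<times> 'm \<Rightarrow>\<^sub>0 'k)" where
  "embed Y = lin_ext fscale (\<lambda>(h, c). basis_vec ((h, 1), c)) Y"

lemma pair1_straighten: "pair1 x X = lin_ext msc (\<lambda>(h, u). msc (x h) u) (straighten X)"
  by (simp add: pair1_def straighten_def m.lin_ext_lin_ext st_def sw_def case_prod_unfold)

lemma pair2_embed: "pair2 x (embed Y) = lin_ext msc (\<lambda>(h, u). st x 1 h u) Y"
  by (simp add: pair2_def embed_def m.lin_ext_lin_ext case_prod_unfold)

lemma rel2M_sub: "fs.subspace (rel2M act)"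
  by (simp add: rel2M_def)

text \<open>
  With \<open>functional_separates\<close>, membership in \<open>rel2M act\<close> becomes an identity for balanced trilinear forms.
\<close>

lemma functional_on_rel2M:
  assumes xi: "lin fscale (*) \<xi>" "\<And>Y. Y \<in> rel2M act \<Longrightarrow> \<xi> Y = 0"
  defines "B \<equiv> \<lambda>p q u. \<xi> (basis_vec ((p, q), u))"
  shows "lin scale (*) (\<lambda>p. B p q u)" "lin scale (*) (\<lambda>q. B p q u)" "lin msc (*) (B p q)"
    "sw (*) (\<lambda>f1 f2. B (p * f1) (q * f2) u) f = B p q (act f u)"
proof -
  have slot: "lin s (*) (\<lambda>y. \<xi> (basis_vec (plug y)))" if sub: "slot_rels s plug \<subseteq> rel2M act"
    for s :: "'k \<Rightarrow> 'z::ab_group_add \<Rightarrow> 'z" and plug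
  proof (rule linI)
    fix y z c
    have "basis_vec (plug (y + z)) - basis_vec (plug y) - basis_vec (plug z) \<in> rel2M act"
      using sub by (auto simp: slot_rels_def)
    from xi(2)[OF this] show "\<xi> (basis_vec (plug (y + z))) = \<xi> (basis_vec (plug y)) + \<xi> (basis_vec (plug z))"
      by (simp add: lin_diff[OF xi(1)] lin_add[OF xi(1)] algebra_simps)
    have "basis_vec (plug (s c y)) - fscale c (basis_vec (plug y)) \<in> rel2M act"
      using sub by (auto simp: slot_rels_def)
    from xi(2)[OF this] show "\<xi> (basis_vec (plug (s c y))) = c * \<xi> (basis_vec (plug y))"
      by (simp add: lin_diff[OF xi(1)] lin_scale[OF xi(1)])
  qed
  have gen: "G \<subseteq> rel2M act" if "G \<subseteq> ((\<Union>h m. slot_rels scale (\<lambda>x. ((x, h), m)) \<union> slot_rels scale (\<lambda>x. ((h, x), m))) \<union>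
      (\<Union>w. slot_rels (mscale act) (\<lambda>m. (w, m))) \<union>
      {lin_ext fscale (\<lambda>u. basis_vec (mult2 w u, m)) (rep (\<Delta> f)) - basis_vec (w, act f m)
         | w f m. True})" for G
    using that unfolding rel2M_def by (meson fs.span_superset subset_trans)
  show "lin scale (*) (\<lambda>p. B p q u)" "lin scale (*) (\<lambda>q. B p q u)" "lin msc (*) (B p q)"
    unfolding B_def by (intro slot gen; blast)+
  have "{lin_ext fscale (\<lambda>w. basis_vec (mult2 (p, q) w, u)) (rep (\<Delta> f)) - basis_vec ((p, q), act f u)} \<subseteq> rel2M act"
    by (rule gen) blast
  then have "\<xi> (lin_ext fscale (\<lambda>w. basis_vec (mult2 (p, q) w, u)) (rep (\<Delta> f)) - basis_vec ((p, q), act f u)) = 0"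
    by (intro xi(2)) blast
  then have "\<xi> (lin_ext fscale (\<lambda>w. basis_vec (mult2 (p, q) w, u)) (rep (\<Delta> f))) = B p q (act f u)"
    by (simp add: B_def lin_diff[OF xi(1)])
  then show "sw (*) (\<lambda>f1 f2. B (p * f1) (q * f2) u) f = B p q (act f u)"
    by (simp add: lin_lin_ext_apply[OF vector_space_mult xi(1)] sw_def B_def mult2_def case_prod_unfold)
qed

text \<open>
  Straightening does not change the class, since \<open>\<Sum> p S q\<^sub>1 q\<^sub>2 \<otimes> q\<^sub>3 = p \<otimes> q\<close>.
\<close>

lemma embed_straighten: "embed (straighten X) - X \<in> rel2M act"
proof (rule ccontr)
  assume "\<not> ?thesis"
  then obtain \<xi> where xi: "lin fscale (*) \<xi>" "\<And>Y. Y \<in> rel2M act \<Longrightarrow> \<xi> Y = 0" "\<xi> (embed (straighten X) - X) = 1"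
    using fs.functional_separates[OF rel2M_sub] by blast
  interpret t: vector_space "(*) :: 'k \<Rightarrow> 'k \<Rightarrow> 'k" by (rule vector_space_mult)
  note vt = vector_space_mult
  define B where "B = (\<lambda>p q u. \<xi> (basis_vec ((p, q), u)))"
  have Bx: "lin scale (*) (\<lambda>p. B p q u)" "lin scale (*) (\<lambda>q. B p q u)" "lin msc (*) (B p q)"
    "sw (*) (\<lambda>f1 f2. B (p * f1) (q * f2) u) f = B p q (act f u)" for p q u f
    unfolding B_def using functional_on_rel2M[OF xi(1,2)] by simp_all
  note Bs = lin_add[OF Bx(1)] lin_add[OF Bx(2)] lin_add[OF Bx(3)] lin_scale[OF Bx(1)] lin_scale[OF Bx(2)] lin_scale[OF Bx(3)]
  have st: "sw (*) (\<lambda>a b. B (p * S a) 1 (act b u)) q = B p q u" for p q u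
  proof -
    have "sw (*) (\<lambda>a b. B (p * S a) 1 (act b u)) q = sw (*) (\<lambda>a b. sw (*) (\<lambda>c d. B (p * (S a * c)) d u) b) q"
      by (simp add: Bx(4)[symmetric] mult.assoc)
    also have "\<dots> = B (p * 1) q u"
      by (rule antipode_collapse(2)[OF vt, of "\<lambda>y d. B (p * y) d u"]) (simp add: bil_def lin_def alg_simps Bs)
    finally show ?thesis by simp
  qed
  have "\<xi> X = lin_ext (*) (\<lambda>z. \<xi> (basis_vec z)) X" by (rule functional_lin_ext[OF xi(1)])
  also have "\<dots> = lin_ext (*) (\<lambda>z. B (fst (fst z)) (snd (fst z)) (snd z)) X" by (simp add: B_def)
  also have "\<dots> = lin_ext (*) (\<lambda>z. sw (*) (\<lambda>a b. B (fst (fst z) * S a) 1 (act b (snd z))) (snd (fst z))) X"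
    by (simp add: st)
  also have "\<dots> = \<xi> (embed (straighten X))"
    by (simp add: embed_def straighten_def lin_lin_ext_apply[OF vt xi(1)] t.lin_ext_lin_ext fs.lin_ext_lin_ext
      case_prod_unfold sw_def B_def)
  finally have "\<xi> (embed (straighten X) - X) = 0" by (simp add: lin_diff[OF xi(1)])
  with xi(3) show False by simp
qed

lemma embed_in_rel2M:
  assumes "\<And>x. lin scale (*) x \<Longrightarrow> lin_ext msc (\<lambda>(h, u). msc (x h) u) Y = 0"
  shows "embed Y \<in> rel2M act"
proof (rule ccontr)
  assume "\<not> ?thesis"
  then obtain \<xi> where xi: "lin fscale (*) \<xi>" "\<And>Y. Y \<in> rel2M act \<Longrightarrow> \<xi> Y = 0" "\<xi> (embed Y) = 1"
    using fs.functional_separates[OF rel2M_sub] by blast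
  have "lin_ext (*) (\<lambda>(h, u). \<xi> (basis_vec ((h, 1), u))) Y = 0"
    by (rule tensor_zero[OF vector_space_mult functional_on_rel2M(1,3)[OF xi(1,2)] assms])
  then have "\<xi> (embed Y) = 0"
    by (simp add: embed_def lin_lin_ext_apply[OF vector_space_mult xi(1)] case_prod_unfold)
  with xi(3) show False by simp
qed

lemma pair2_straighten:
  assumes x: "lin scale (*) x"
  shows "pair2 x X = lin_ext msc (\<lambda>(h, u). st x 1 h u) (straighten X)"
proof -
  have "pair2 x (embed (straighten X) - X) = 0" by (rule pair2_rel2M[OF x embed_straighten])
  then show ?thesis by (simp add: pair2_embed[symmetric]) (simp add: pair2_def m.lin_ext_diff)
qed

lemma pair_flip: "pair1 x (flip X) = pair2 x X" "pair2 x (flip X) = pair1 x X"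
  by (simp_all add: pair1_def pair2_def flip_def m.lin_ext_lin_ext case_prod_unfold)

text \<open>
  If \<open>X\<close> is represented by \<open>\<Sum> (h\<^sub>i \<otimes> 1) \<otimes>\<^sub>H u\<^sub>i\<close>, the contractions in the first factor determine the tensor
  \<open>\<Sum> h\<^sub>i \<otimes> u\<^sub>i\<close>, and the contractions in the second factor are bilinear functions of it.
\<close>

lemma pair1_zero_imp_pair2_zero:
  assumes "\<And>x. lin scale (*) x \<Longrightarrow> pair1 x X = 0" "lin scale (*) y"
  shows "pair2 y X = 0"
  unfolding pair2_straighten[OF assms(2)]
  by (rule tensor_zero[OF vs_msc st_lin2[OF assms(2)] st_lin3[OF assms(2)]])
    (simp add: assms(1) flip: pair1_straighten)

lemma pair2_zero_imp_pair1_zero: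
  assumes "\<And>x. lin scale (*) x \<Longrightarrow> pair2 x X = 0" "lin scale (*) y"
  shows "pair1 y X = 0"
  using pair1_zero_imp_pair2_zero[of "flip X" y] assms by (simp add: pair_flip)

section \<open>Contraction of triple tensors\<close>

text \<open>
  The contraction of \<open>\<Sum> (p S s\<^sub>2 \<otimes> q S s\<^sub>1 \<otimes> 1) \<otimes>\<^sub>H s\<^sub>3 u\<close>, which represents the same class as
  \<open>(p \<otimes> q \<otimes> s) \<otimes>\<^sub>H u\<close>, with \<open>x\<close> and \<open>y\<close>. It straightens the second factor first and then uses \<open>st\<close>, so its
  properties reduce to those of \<open>st\<close>.
\<close>

definition st3 :: "('h \<Rightarrow> 'k) \<Rightarrow> ('h \<Rightarrow> 'k) \<Rightarrow> 'h \<Rightarrow> 'h \<Rightarrow> 'h \<Rightarrow> 'm \<Rightarrow> 'm" where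
  "st3 x y p q s u = sw msc (\<lambda>a b. msc (y (q * S a)) (st x p b u)) s"

definition pair3 :: "('h \<Rightarrow> 'k) \<Rightarrow> ('h \<Rightarrow> 'k) \<Rightarrow> (('h \<times> 'h \<times> 'h) \<times> 'm \<Rightarrow>\<^sub>0 'k) \<Rightarrow> 'm" where
  "pair3 x y X = lin_ext msc (\<lambda>((p, q, s), u). st3 x y p q s u) X"

lemma
  assumes x: "lin scale (*) x" and y: "lin scale (*) y"
  shows st3_lin1: "lin scale msc (\<lambda>p. st3 x y p q s u)"
    and st3_lin2: "lin scale msc (\<lambda>q. st3 x y p q s u)"
    and st3_lin3: "lin scale msc (\<lambda>s. st3 x y p q s u)"
    and st3_lin4: "lin msc msc (st3 x y p q s)"
proof -
  note xs = lin_add[OF y] lin_scale[OF y] lin_add[OF st_lin1[OF x]] lin_add[OF st_lin2[OF x]] lin_add[OF st_lin3[OF x]]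
    lin_scale[OF st_lin1[OF x]] lin_scale[OF st_lin2[OF x]] lin_scale[OF st_lin3[OF x]]
  show "lin scale msc (\<lambda>p. st3 x y p q s u)" "lin msc msc (st3 x y p q s)"
  proof -
    show "lin scale msc (\<lambda>p. st3 x y p q s u)"
    proof (rule linI)
      fix p p' c
      show "st3 x y (p + p') q s u = st3 x y p q s u + st3 x y p' q s u" by (simp add: st3_def act_simps xs)
      show "st3 x y (scale c p) q s u = msc c (st3 x y p q s u)"
        by (simp only: st3_def act_simps xs m.scale_left_commute[of _ c])
    qed
    show "lin msc msc (st3 x y p q s)"
    proof (rule linI)
      fix u v c
      show "st3 x y p q s (u + v) = st3 x y p q s u + st3 x y p q s v" by (simp add: st3_def act_simps xs)
      show "st3 x y p q s (msc c u) = msc c (st3 x y p q s u)"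
        by (simp only: st3_def act_simps xs m.scale_left_commute[of _ c])
    qed
  qed
  show "lin scale msc (\<lambda>q. st3 x y p q s u)"
    by (simp add: st3_def lin_def alg_simps act_simps xs flip: m.scale_scale)
  show "lin scale msc (\<lambda>s. st3 x y p q s u)"
    unfolding st3_def by (rule sw_lin[OF vs_msc]) (simp add: bil_def lin_def alg_simps act_simps xs mult.commute)
qed

lemma st3_mult_right:
  assumes x: "lin scale (*) x" and y: "lin scale (*) y"
  shows "st3 x y p q (s * f) u = sw msc (\<lambda>a b. sw msc (\<lambda>c d. msc (y (q * S c * S a)) (st x p (b * d) u)) f) s"
proof -
  note xs = lin_add[OF y] lin_scale[OF y] lin_add[OF st_lin2[OF x]] lin_scale[OF st_lin2[OF x]]
  show ?thesis
  unfolding st3_def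
  by (subst sw_mult[OF vs_msc])
    (simp_all add: bil_def lin_def alg_simps act_simps S_mult mult.assoc xs mult.commute)
qed

lemma st3_balanced:
  assumes x: "lin scale (*) x" and y: "lin scale (*) y"
  shows "sw msc (\<lambda>e f3. sw msc (\<lambda>f1 f2. st3 x y (p * f1) (q * f2) (s * f3) u) e) f = st3 x y p q s (act f u)"
proof -
  note xs = lin_add[OF y] lin_scale[OF y] lin_add[OF st_lin1[OF x]] lin_add[OF st_lin2[OF x]] 
    lin_scale[OF st_lin1[OF x]] lin_scale[OF st_lin2[OF x]]
  note x3 = lin_add[OF st3_lin1[OF x y]] lin_add[OF st3_lin2[OF x y]] lin_add[OF st3_lin3[OF x y]]
    lin_scale[OF st3_lin1[OF x y]] lin_scale[OF st3_lin2[OF x y]] lin_scale[OF st3_lin3[OF x y]]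
  have inner: "sw msc (\<lambda>f2 f3. st3 x y p' (q * f2) (s * f3) u) r = sw msc (\<lambda>a b. msc (y (q * S a)) (st x p' (b * r) u)) s" for p' r
  proof -
    have "sw msc (\<lambda>f2 f3. st3 x y p' (q * f2) (s * f3) u) r
      = sw msc (\<lambda>a b. sw msc (\<lambda>f2 f3. sw msc (\<lambda>c d. msc (y (q * (f2 * S c) * S a)) (st x p' (b * d) u)) f3) r) s"
      by (simp only: st3_mult_right[OF x y]) (subst sw_swap[OF vs_msc], simp add: mult.assoc)
    also have "\<dots> = sw msc (\<lambda>a b. msc (y (q * 1 * S a)) (st x p' (b * r) u)) s"
    proof -
      have "sw msc (\<lambda>f2 f3. sw msc (\<lambda>c d. msc (y (q * (f2 * S c) * S a)) (st x p' (b * d) u)) f3) r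
          = msc (y (q * 1 * S a)) (st x p' (b * r) u)" for a b
        by (rule antipode_collapse(1)[OF vs_msc, of "\<lambda>z d. msc (y (q * z * S a)) (st x p' (b * d) u)"])
          (simp add: bil_def lin_def alg_simps act_simps xs mult.commute)
      then show ?thesis by simp
    qed
    finally show ?thesis by simp
  qed
  have "sw msc (\<lambda>e f3. sw msc (\<lambda>f1 f2. st3 x y (p * f1) (q * f2) (s * f3) u) e) f
      = sw msc (\<lambda>f1 r. sw msc (\<lambda>f2 f3. st3 x y (p * f1) (q * f2) (s * f3) u) r) f"
    by (rule sw_coassoc[OF vs_msc]) (simp add: tril_def lin_def alg_simps x3)
  also have "\<dots> = sw msc (\<lambda>a b. sw msc (\<lambda>f1 r. msc (y (q * S a)) (st x (p * f1) (b * r) u)) f) s"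
    by (simp only: inner) (rule sw_swap[OF vs_msc])
  also have "\<dots> = st3 x y p q s (act f u)"
    by (simp add: sw_fun_scale[OF vs_msc] st_balanced[OF x] st3_def)
  finally show ?thesis .
qed

lemma pair3_rel3M:
  assumes x: "lin scale (*) x" and y: "lin scale (*) y" and X: "X \<in> rel3M act"
  shows "pair3 x y X = 0"
  using X unfolding rel3M_def pair3_def
proof (rule m.lin_ext_vanishes_on_span, elim UnE)
  fix Y assume "Y \<in> {lin_ext fscale (\<lambda>u. basis_vec (mult3 w u, m)) (comult3_rep f) - basis_vec (w, act f m) |w f m. True}"
  then obtain w f m where Y: "Y = lin_ext fscale (\<lambda>u. basis_vec (mult3 w u, m)) (comult3_rep f) - basis_vec (w, act f m)"
    by blast
  show "lin_ext msc (\<lambda>((p, q, s), u). st3 x y p q s u) Y = 0"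
    using st3_balanced[OF x y, of "fst w" "fst (snd w)" "snd (snd w)" m f]
    by (simp add: Y m.lin_ext_diff m.lin_ext_lin_ext fs.lin_ext_lin_ext mult3_def sw_def case_prod_unfold comult3_rep_def)
qed (use st3_lin1[OF x y] st3_lin2[OF x y] st3_lin3[OF x y] st3_lin4[OF x y]
      in \<open>auto elim!: m.lin_ext_slot_rels[rotated]\<close>)

lemma st3_flip:
  assumes x: "lin scale (*) x" and y: "lin scale (*) y"
  shows "st3 x y q p s u = st3 y x p q s u"
proof -
  note xs = lin_add[OF x] lin_scale[OF x] lin_add[OF y] lin_scale[OF y]
  have t: "tril msc (\<lambda>a b c. msc (z (p * S a)) (msc (z' (q * S b)) (act c u)))"
    if z: "lin scale (*) z" and z': "lin scale (*) z'" for z z' p q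
    by (simp add: tril_def lin_def alg_simps act_simps lin_add[OF z] lin_scale[OF z] lin_add[OF z'] lin_scale[OF z'] mult.commute)
      (simp add: mult.left_commute)?
  have e: "st3 z z' q p s u = sw msc (\<lambda>r c. sw msc (\<lambda>a b. msc (z' (p * S a)) (msc (z (q * S b)) (act c u))) r) s"
    if z: "lin scale (*) z" and z': "lin scale (*) z'" for z z' p q
    unfolding st3_def st_def sw_fun_scale[OF vs_msc, symmetric]
    by (rule sw_coassoc[OF vs_msc t[OF z' z], symmetric])
  have "st3 x y q p s u = sw msc (\<lambda>r c. sw msc (\<lambda>a b. msc (y (p * S a)) (msc (x (q * S b)) (act c u))) r) s"
    by (rule e[OF x y])
  also have "\<dots> = sw msc (\<lambda>r c. sw msc (\<lambda>a b. msc (x (q * S a)) (msc (y (p * S b)) (act c u))) r) s"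
  proof -
    have "sw msc (\<lambda>a b. msc (y (p * S a)) (msc (x (q * S b)) (act c u))) r
        = sw msc (\<lambda>a b. msc (x (q * S a)) (msc (y (p * S b)) (act c u))) r" for r c
    proof -
      have "bil msc (\<lambda>a b. msc (x (q * S a)) (msc (y (p * S b)) (act c u)))"
        using t[OF x y] by (simp add: tril_def bil_def)
      from sw_cocomm[OF vs_msc this, of r] show ?thesis by (simp add: mult.commute)
    qed
    then show ?thesis by simp
  qed
  also have "\<dots> = st3 y x p q s u" by (rule e[OF y x, symmetric])
  finally show ?thesis .
qed

lemma pair3_flip12:
  "lin scale (*) x \<Longrightarrow> lin scale (*) y \<Longrightarrow> pair3 x y (flip12 Z) = pair3 y x Z"
  by (simp add: pair3_def flip12_def m.lin_ext_lin_ext case_prod_unfold st3_flip)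

end

section \<open>The operators of a pseudo-action\<close>

locale smash_pseudo_map = smash_product sd lb gmul gone ginv gact scale \<Delta> \<epsilon> S \<iota> \<gamma>
    + pseudo_map scale \<Delta> \<epsilon> S actA actM \<beta>
  for sd :: "'k::field \<Rightarrow> 'd::ab_group_add \<Rightarrow> 'd" and lb
    and gmul :: "'g \<Rightarrow> 'g \<Rightarrow> 'g" and gone ginv gact
    and scale :: "'k \<Rightarrow> 'h::ring_1 \<Rightarrow> 'h" and \<Delta> \<epsilon> S \<iota> \<gamma>
    and actA :: "'h \<Rightarrow> 'a::ab_group_add \<Rightarrow> 'a" and actM :: "'h \<Rightarrow> 'm::ab_group_add \<Rightarrow> 'm" and \<beta>
begin

sublocale smash_module sd lb gmul gone ginv gact scale \<Delta> \<epsilon> S \<iota> \<gamma> actM ..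

text \<open>\<open>op a x v\<close> is \<open>\<Sum> \<langle>x, h\<^sub>i\<rangle> v\<^sub>i\<close> if \<open>a * v = \<Sum> (h\<^sub>i \<otimes> 1) \<otimes>\<^sub>H v\<^sub>i\<close>.\<close>

definition op :: "'a \<Rightarrow> ('h \<Rightarrow> 'k) \<Rightarrow> 'm \<Rightarrow> 'm" where
  "op a x v = pair1 x (rep (\<beta> a v))"

text \<open>The analogous contraction in the second tensor factor; in contrast to \<open>op\<close>, it is \<open>H\<close>-linear in \<open>v\<close>.\<close>

definition op2 :: "'a \<Rightarrow> ('h \<Rightarrow> 'k) \<Rightarrow> 'm \<Rightarrow> 'm" where
  "op2 a x v = pair2 x (rep (\<beta> a v))"

lemma rep_pseudo: "rep (\<beta> a v) \<in> \<beta> a v"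
proof -
  obtain X where "\<beta> a v = coset (rel2M actM) X" using pseudo_coset[of a v] by auto
  then have "X \<in> \<beta> a v" by (simp add: coset_def rel2M_def fs.span_zero)
  then show ?thesis unfolding rep_def by (rule someI)
qed

lemma pseudo_diff: "X \<in> \<beta> a v \<Longrightarrow> Y \<in> \<beta> a v \<Longrightarrow> X - Y \<in> rel2M actM"
proof -
  assume "X \<in> \<beta> a v" "Y \<in> \<beta> a v"
  moreover obtain Z where "\<beta> a v = coset (rel2M actM) Z" using pseudo_coset[of a v] by auto
  ultimately have "X - Z \<in> rel2M actM" "Y - Z \<in> rel2M actM" by (auto simp: coset_def)
  then show ?thesis using fs.subspace_diff[OF rel2M_sub, of "X - Z" "Y - Z"] by simp
qed

lemma pseudo_memI: "X \<in> \<beta> a v \<Longrightarrow> Y - X \<in> rel2M actM \<Longrightarrow> Y \<in> \<beta> a v"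
proof -
  assume "X \<in> \<beta> a v" "Y - X \<in> rel2M actM"
  moreover obtain Z where "\<beta> a v = coset (rel2M actM) Z" using pseudo_coset[of a v] by auto
  ultimately show ?thesis using fs.subspace_add[OF rel2M_sub, of "Y - X" "X - Z"] by (auto simp: coset_def)
qed

lemma pseudo_eq_coset: "X \<in> \<beta> a v \<Longrightarrow> \<beta> a v = coset (rel2M actM) X"
  unfolding coset_def by (intro set_eqI iffI) (blast intro: pseudo_diff pseudo_memI)+

lemma op_eq: assumes "lin scale (*) x" "X \<in> \<beta> a v" shows "pair1 x X = op a x v"
proof -
  have "pair1 x (X - rep (\<beta> a v)) = 0" by (rule pair1_rel2M[OF assms(1) pseudo_diff[OF assms(2) rep_pseudo]])
  then show ?thesis by (simp add: op_def pair1_def m.lin_ext_diff)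
qed

lemma op2_eq: assumes "lin scale (*) x" "X \<in> \<beta> a v" shows "pair2 x X = op2 a x v"
proof -
  have "pair2 x (X - rep (\<beta> a v)) = 0" by (rule pair2_rel2M[OF assms(1) pseudo_diff[OF assms(2) rep_pseudo]])
  then show ?thesis by (simp add: op2_def pair2_def m.lin_ext_diff)
qed

lemma
  assumes x: "lin scale (*) x"
  shows op_lin: "lin msc msc (op a x)" and op2_lin: "lin msc msc (op2 a x)"
    and op_lin_left: "lin (mscale actA) msc (\<lambda>a. op a x v)"
proof -
  show "lin msc msc (op a x)"
  proof (rule linI)
    fix u v c
    show "op a x (u + v) = op a x u + op a x v"
      by (subst op_eq[OF x pseudo_add_right[OF rep_pseudo rep_pseudo], symmetric])
        (simp add: pair1_def m.lin_ext_add op_def)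
    show "op a x (msc c v) = msc c (op a x v)"
      by (subst op_eq[OF x pseudo_scale_right[OF rep_pseudo], symmetric])
        (simp add: pair1_def m.lin_ext_fscale op_def)
  qed
  show "lin msc msc (op2 a x)"
  proof (rule linI)
    fix u v c
    show "op2 a x (u + v) = op2 a x u + op2 a x v"
      by (subst op2_eq[OF x pseudo_add_right[OF rep_pseudo rep_pseudo], symmetric])
        (simp add: pair2_def m.lin_ext_add op2_def)
    show "op2 a x (msc c v) = msc c (op2 a x v)"
      by (subst op2_eq[OF x pseudo_scale_right[OF rep_pseudo], symmetric])
        (simp add: pair2_def m.lin_ext_fscale op2_def)
  qed
  show "lin (mscale actA) msc (\<lambda>a. op a x v)"
  proof (rule linI)
    fix a b c
    show "op (a + b) x v = op a x v + op b x v"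
      by (subst op_eq[OF x pseudo_add_left[OF rep_pseudo rep_pseudo], symmetric])
        (simp add: pair1_def m.lin_ext_add op_def)
    show "op (mscale actA c a) x v = msc c (op a x v)"
      by (subst op_eq[OF x pseudo_scale_left[OF rep_pseudo], symmetric])
        (simp add: pair1_def m.lin_ext_fscale op_def)
  qed
qed

lemma op_straighten: "op a x v = lin_ext msc (\<lambda>(h, u). msc (x h) u) (straighten (rep (\<beta> a v)))"
  by (simp add: op_def pair1_straighten)

lemma op2_straighten: "op2 a x v = lin_ext msc (\<lambda>(h, u). msc (x h) u) (straighten (flip (rep (\<beta> a v))))"
  by (simp add: op2_def pair1_straighten[symmetric] pair_flip)

lemma op_fun_add: "op a (\<lambda>h. x h + y h) v = op a x v + op a y v"
  and op_fun_scale: "op a (\<lambda>h. c * x h) v = msc c (op a x v)"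
  by (simp_all add: op_straighten case_prod_unfold m.scale_left_distrib m.lin_ext_fun_add
    m.lin_ext_fun_scale flip: m.scale_scale)

lemma op2_fun_add: "op2 a (\<lambda>h. x h + y h) v = op2 a x v + op2 a y v"
  and op2_fun_scale: "op2 a (\<lambda>h. c * x h) v = msc c (op2 a x v)"
  by (simp_all add: op2_straighten case_prod_unfold m.scale_left_distrib m.lin_ext_fun_add
    m.lin_ext_fun_scale flip: m.scale_scale)

lemma op2_fun_sum: "op2 a (\<lambda>h. \<Sum>j\<in>J. c j * y j h) v = (\<Sum>j\<in>J. msc (c j) (op2 a (y j) v))"
proof (induct J rule: infinite_finite_induct)
  case (insert j J)
  then show ?case by (simp add: op2_fun_add op2_fun_scale)
qed (use op2_fun_scale[of a 0 "\<lambda>h. 0" v] in simp_all)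

lemma op_sw:
  "op a (\<lambda>h. sw (*) (\<lambda>p q. W p q h) f) v = sw msc (\<lambda>p q. op a (W p q) v) f"
proof -
  have "msc (sw (*) (\<lambda>p q. W p q h) f) u = sw msc (\<lambda>p q. msc (W p q h) u) f" for h u
    by (rule sw_lin_apply[OF vs_msc]) (simp add: lin_def m.scale_left_distrib)
  then show ?thesis
    unfolding op_straighten case_prod_unfold by (simp only:) (simp only: sw_def case_prod_unfold, rule m.lin_ext_swap)
qed

lemma op_local:
  obtains I h where "finite (I :: ('h \<times> 'm) set)" "\<And>x. lin scale (*) x \<Longrightarrow> op a x v = (\<Sum>i\<in>I. msc (x (h i)) (snd i))"
proof -
  let ?Y = "straighten (rep (\<beta> a v))"
  have "op a x v = (\<Sum>i\<in>Poly_Mapping.keys ?Y. msc (x (scale (Poly_Mapping.lookup ?Y i) (fst i))) (snd i))"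
    if "lin scale (*) x" for x
    unfolding op_straighten lin_ext_def by (simp add: case_prod_unfold lin_scale[OF that])
  then show thesis by (intro that[of "Poly_Mapping.keys ?Y"]) auto
qed

lemma op_act: assumes x: "lin scale (*) x" shows "op (actA f a) x v = op a (\<lambda>h. x (f * h)) v"
proof -
  have st: "st x (f * p) q u = st (\<lambda>h. x (f * h)) p q u" for p q u
    by (simp add: st_def mult.assoc)
  have "lin_ext fscale (\<lambda>(w, u). basis_vec (mult2 (f, 1) w, u)) (rep (\<beta> a v)) \<in> \<beta> (actA f a) (actM 1 v)"
    by (rule pseudo_act[OF rep_pseudo])
  from op_eq[OF x this] show ?thesis
    by (simp add: M.act_one pair1_def m.lin_ext_lin_ext mult2_def case_prod_unfold st op_def)
qed

lemma op_mult_right: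
  assumes x: "lin scale (*) x"
  shows "op a x (actM g v) = lin_ext msc (\<lambda>((p, q), u). st x p (g * q) u) (rep (\<beta> a v))"
proof -
  have "lin_ext fscale (\<lambda>(w, u). basis_vec (mult2 (1, g) w, u)) (rep (\<beta> a v)) \<in> \<beta> (actA 1 a) (actM g v)"
    by (rule pseudo_act[OF rep_pseudo])
  from op_eq[OF x this] show ?thesis
    by (simp add: A.act_one pair1_def m.lin_ext_lin_ext mult2_def case_prod_unfold)
qed

lemma op2_mult_right:
  assumes x: "lin scale (*) x"
  shows "op2 a x (actM g v) = op2 a (\<lambda>h. x (g * h)) v"
proof -
  have st: "st x (g * p) q u = st (\<lambda>h. x (g * h)) p q u" for p q u
    by (simp add: st_def mult.assoc)
  have "lin_ext fscale (\<lambda>(w, u). basis_vec (mult2 (1, g) w, u)) (rep (\<beta> a v)) \<in> \<beta> (actA 1 a) (actM g v)"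
    by (rule pseudo_act[OF rep_pseudo])
  from op2_eq[OF x this] show ?thesis
    by (simp add: A.act_one pair2_def m.lin_ext_lin_ext mult2_def case_prod_unfold st op2_def)
qed

text \<open>
  Straightening turns a factor \<open>d\<close> in the second tensor factor into \<open>d\<close> acting on the module plus
  \<open>S d = - d\<close> multiplied to the first factor from the right.
\<close>

lemma op_primitive:
  assumes x: "lin scale (*) x" and d: "primitive d"
  shows "op a x (actM d v) = actM d (op a x v) - op a (\<lambda>h. x (h * d)) v"
proof -
  note xs = lin_add[OF x] lin_scale[OF x]
  have st: "st x p (d * q) u = actM d (st x p q u) - st (\<lambda>h. x (h * d)) p q u" for p q u
  proof -
    have "st x p (d * q) u = sw msc (\<lambda>a b. sw msc (\<lambda>c e. msc (x (p * S c * S a)) (actM b (actM e u))) q) d"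
      by (rule st_mult_right[OF x])
    also have "\<dots> = sw msc (\<lambda>c e. msc (x (p * S c * S d)) (actM 1 (actM e u))) q
        + sw msc (\<lambda>c e. msc (x (p * S c * S 1)) (actM d (actM e u))) q"
      by (rule sw_primitive[OF vs_msc _ d])
        (simp add: bil_def lin_def alg_simps act_simps xs mult.commute,
         simp add: sw_fun_scale[OF vs_msc] flip: m.scale_scale)
    also have "\<dots> = - st (\<lambda>h. x (h * d)) p q u + actM d (st x p q u)"
      by (simp add: S_one S_primitive[OF d] M.act_one st_def lin_neg[OF x] sw_lin_apply[OF vs_msc act_lin_right]
          act_scale_right sw_lin_apply[OF vs_msc, of msc uminus] lin_def)
    finally show ?thesis by simp
  qed
  have "op a x (actM d v) = lin_ext msc (\<lambda>((p, q), u). actM d (st x p q u) + - st (\<lambda>h. x (h * d)) p q u) (rep (\<beta> a v))"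
    unfolding op_mult_right[OF x] st by simp
  also have "\<dots> = actM d (op a x v) + - op a (\<lambda>h. x (h * d)) v"
    unfolding case_prod_unfold m.lin_ext_fun_add
    by (simp add: op_def pair1_def case_prod_unfold lin_lin_ext_apply[OF vs_msc act_lin_right]
        lin_lin_ext_apply[OF vs_msc, of msc uminus] lin_def)
  finally show ?thesis by simp
qed

text \<open>
  The hypothesis \<open>bnd\<close> says that \<open>a * v\<close> has first coefficients in the span of the fixed finite set \<open>E\<close> for
  all \<open>v\<close> in \<open>F\<close>. In terms of the second factor, only finitely many coordinates \<open>y j\<close> matter for such \<open>v\<close>.
  The maps \<open>op2 a (y j)\<close> take values in a finite-dimensional space, because \<open>op2\<close> is \<open>H\<close>-linear and \<open>M\<close> is
  finitely generated; their joint kernel in \<open>F\<close> is the kernel of \<open>a\<close>.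
\<close>

lemma fin_dim_bounded_coefficients:
  assumes fg: "finitely_generated_over R actM" and E: "finite E"
    and F: "m.subspace F"
    and bnd: "\<And>v x. v \<in> F \<Longrightarrow> lin scale (*) x \<Longrightarrow> (\<And>e. e \<in> E \<Longrightarrow> x e = 0) \<Longrightarrow> op a x v = 0"
    and T: "lin msc msc T"
    and ker: "\<And>v. v \<in> F \<Longrightarrow> (\<And>x. lin scale (*) x \<Longrightarrow> op a x v = 0) \<Longrightarrow> T v = 0"
  shows "fin_dim msc (T ` F)"
proof -
  obtain B e where B: "finite B" "B \<subseteq> E" "\<And>b. b \<in> B \<Longrightarrow> lin scale (*) (e b)"
    "\<And>h. h \<in> span E \<Longrightarrow> h = (\<Sum>b\<in>B. scale (e b h) b)"
    using E by (rule finite_coordinates) blast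
  define \<pi> where "\<pi> = (\<lambda>h. h - (\<Sum>b\<in>B. scale (e b h) b))"
  have pl: "lin scale scale \<pi>"
  proof (rule linI)
    fix h k c
    have "(\<Sum>b\<in>B. scale (e b (h + k)) b) = (\<Sum>b\<in>B. scale (e b h) b) + (\<Sum>b\<in>B. scale (e b k) b)"
      unfolding sum.distrib[symmetric] by (rule sum.cong) (simp_all add: lin_add[OF B(3)] scale_left_distrib)
    then show "\<pi> (h + k) = \<pi> h + \<pi> k" by (simp add: \<pi>_def)
    have "(\<Sum>b\<in>B. scale (e b (scale c h)) b) = scale c (\<Sum>b\<in>B. scale (e b h) b)"
      unfolding scale_sum_right by (rule sum.cong) (simp_all add: lin_scale[OF B(3)])
    then show "\<pi> (scale c h) = scale c (\<pi> h)" by (simp add: \<pi>_def scale_right_diff_distrib)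
  qed
  \<comment> \<open>The finite set of coefficients through which \<open>op2 a x v\<close> depends on \<open>x\<close>.\<close>
  define E' where "E' = (\<Union>b\<in>B. S ` fst ` Poly_Mapping.keys (rep (\<Delta> b)))"
  have fE': "finite E'" using B by (auto simp: E'_def)
  have op2_0: "op2 a x v = 0" if v: "v \<in> F" and x: "lin scale (*) x" and 0: "\<And>k. k \<in> E' \<Longrightarrow> x k = 0" for x v
  proof -
    let ?Y = "straighten (rep (\<beta> a v))"
    let ?Y' = "lin_ext fscale (\<lambda>(h, u). basis_vec (\<pi> h, u)) ?Y"
    have "lin_ext msc (\<lambda>(h, u). st x 1 h u) ?Y' = 0"
    proof (rule tensor_zero[OF vs_msc st_lin2[OF x] st_lin3[OF x]])
      fix z assume z: "lin scale (*) z"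
      have "lin scale (*) (\<lambda>h. z (\<pi> h))" by (rule lin_compose[OF pl z])
      then have "op a (\<lambda>h. z (\<pi> h)) v = 0"
      proof (rule bnd[OF v])
        fix k assume "k \<in> E"
        then have "\<pi> k = 0" using B(4)[of k] by (simp add: \<pi>_def span_base)
        then show "z (\<pi> k) = 0" by (simp add: lin_zero[OF z])
      qed
      then show "lin_ext msc (\<lambda>(h, u). msc (z h) u) ?Y' = 0"
        by (simp add: op_straighten m.lin_ext_lin_ext case_prod_unfold)
    qed
    then have "lin_ext msc (\<lambda>(h, u). st x 1 (\<pi> h) u) ?Y = 0"
      by (simp add: m.lin_ext_lin_ext case_prod_unfold)
    moreover have "st x 1 (\<pi> h) u = st x 1 h u" for h u
    proof -
      have "st x 1 b u = 0" if b: "b \<in> B" for b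
      proof -
        have "S (fst z) \<in> E'" if "z \<in> Poly_Mapping.keys (rep (\<Delta> b))" for z
          unfolding E'_def using b that by (intro UN_I[of b] imageI)
        then have "x (1 * S (fst z)) = 0" if "z \<in> Poly_Mapping.keys (rep (\<Delta> b))" for z
          using 0[of "S (fst z)"] that by simp
        then show ?thesis unfolding st_def sw_def lin_ext_def case_prod_unfold by simp
      qed
      then have "(\<Sum>b\<in>B. msc (e b h) (st x 1 b u)) = 0" by simp
      then show ?thesis
        by (simp only: \<pi>_def lin_diff[OF st_lin2[OF x]] lin_sum[OF st_lin2[OF x]] lin_scale[OF st_lin2[OF x]]) simp
    qed
    ultimately show ?thesis by (simp add: op2_def pair2_straighten[OF x])
  qed
  obtain J y where J: "finite J" "J \<subseteq> E'" "\<And>j. j \<in> J \<Longrightarrow> lin scale (*) (y j)"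
    "\<And>h. h \<in> span E' \<Longrightarrow> h = (\<Sum>j\<in>J. scale (y j h) j)"
    using fE' by (rule finite_coordinates) blast
  from fg obtain G where G: "finite G" and gen: "\<forall>v. \<exists>c. (\<forall>b\<in>G. c b \<in> R) \<and> v = (\<Sum>b\<in>G. actM (c b) b)"
    unfolding finitely_generated_over_def by (elim exE conjE)
  define C where "C = (\<Union>b\<in>G. snd ` Poly_Mapping.keys (straighten (flip (rep (\<beta> a b)))))"
  have im: "op2 a x v \<in> m.span C" if x: "lin scale (*) x" for x v
  proof -
    have b: "op2 a z b \<in> m.span C" if "b \<in> G" for z b
      unfolding op2_straighten
    proof (rule m.lin_ext_mem)
      fix w assume "w \<in> Poly_Mapping.keys (straighten (flip (rep (\<beta> a b))))"
      then have "snd w \<in> C" using that unfolding C_def by (intro UN_I[of b] imageI)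
      then show "(case w of (h, u) \<Rightarrow> msc (z h) u) \<in> m.span C"
        unfolding case_prod_unfold by (intro m.span_scale m.span_base)
    qed (rule m.subspace_span)
    from gen obtain c where c: "v = (\<Sum>b\<in>G. actM (c b) b)" by meson
    have "op2 a x v = (\<Sum>b\<in>G. op2 a (\<lambda>h. x (c b * h)) b)"
      by (simp add: c lin_sum[OF op2_lin[OF x]] op2_mult_right[OF x])
    then show ?thesis using b by (auto intro!: m.span_sum)
  qed
  show ?thesis
  proof (rule m.fin_dim_image_of_joint_kernel[OF F J(1), where g = "\<lambda>j. op2 a (y j)" and B = C])
    fix v assume v: "v \<in> F" and 0: "\<And>j. j \<in> J \<Longrightarrow> op2 a (y j) v = 0"
    have "op2 a x v = 0" if x: "lin scale (*) x" for x
    proof -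
      let ?x = "\<lambda>h. x h + - 1 * (\<Sum>j\<in>J. x j * y j h)"
      have "lin scale (*) ?x"
      proof (rule linI)
        fix h k c
        have "(\<Sum>j\<in>J. x j * y j (h + k)) = (\<Sum>j\<in>J. x j * y j h) + (\<Sum>j\<in>J. x j * y j k)"
          unfolding sum.distrib[symmetric] by (rule sum.cong) (simp_all add: lin_add[OF J(3)] algebra_simps)
        then show "?x (h + k) = ?x h + ?x k" by (simp add: lin_add[OF x] algebra_simps)
        have "(\<Sum>j\<in>J. x j * y j (scale c h)) = c * (\<Sum>j\<in>J. x j * y j h)"
          unfolding sum_distrib_left by (rule sum.cong) (simp_all add: lin_scale[OF J(3)])
        then show "?x (scale c h) = c * ?x h" by (simp add: lin_scale[OF x] algebra_simps)
      qed
      moreover have "?x k = 0" if "k \<in> E'" for k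
      proof -
        have "x k = x (\<Sum>j\<in>J. scale (y j k) j)" using J(4)[of k] that by (simp add: span_base)
        also have "\<dots> = (\<Sum>j\<in>J. x j * y j k)" by (simp add: lin_sum[OF x] lin_scale[OF x] mult.commute)
        finally show ?thesis by simp
      qed
      ultimately have "op2 a ?x v = 0" by (rule op2_0[OF v])
      moreover have "op2 a ?x v = op2 a x v + msc (- 1) (\<Sum>j\<in>J. msc (x j) (op2 a (y j) v))"
        by (simp only: op2_fun_add op2_fun_scale op2_fun_sum)
      ultimately show ?thesis using 0 by simp
    qed
    then have "op a x v = 0" if "lin scale (*) x" for x
      using pair2_zero_imp_pair1_zero[OF _ that, of "rep (\<beta> a v)"] by (simp add: op_def op2_def)
    then show "T v = 0" by (rule ker[OF v])
  next
    show "finite C" using G by (auto simp: C_def)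
  qed (use J(1-3) im T op2_lin in auto)
qed

end

section \<open>Commutators\<close>

locale smash_representation = smash_product sd lb gmul gone ginv gact scale \<Delta> \<epsilon> S \<iota> \<gamma>
    + lie_pseudoalgebra_module scale \<Delta> \<epsilon> S actL br actV mact
  for sd :: "'k::field \<Rightarrow> 'd::ab_group_add \<Rightarrow> 'd" and lb
    and gmul :: "'g \<Rightarrow> 'g \<Rightarrow> 'g" and gone ginv gact
    and scale :: "'k \<Rightarrow> 'h::ring_1 \<Rightarrow> 'h" and \<Delta> \<epsilon> S \<iota> \<gamma>
    and actL :: "'h \<Rightarrow> 'l::ab_group_add \<Rightarrow> 'l" and br
    and actV :: "'h \<Rightarrow> 'v::ab_group_add \<Rightarrow> 'v" and mact
begin

sublocale ad: smash_pseudo_map sd lb gmul gone ginv gact scale \<Delta> \<epsilon> S \<iota> \<gamma> actL actL br ..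

sublocale mo: smash_pseudo_map sd lb gmul gone ginv gact scale \<Delta> \<epsilon> S \<iota> \<gamma> actL actV mact ..

text \<open>
  On operators, \<open>a * (b * v)\<close> is composition: \<open>a\<close> is contracted with \<open>x\<close> and \<open>b\<close> with \<open>y\<close>.
\<close>

lemma pair3_nest_right:
  assumes x: "lin scale (*) x" and y: "lin scale (*) y"
  shows "mo.pair3 x y (nest_right (\<lambda>w. rep (mact a w)) X) = mo.op a x (mo.pair1 y X)"
proof -
  note ys = lin_add[OF y] lin_scale[OF y] lin_add[OF mo.st_lin2[OF x]] lin_scale[OF mo.st_lin2[OF x]]
  have 1: "sw mo.msc (\<lambda>s1 s2. mo.st3 x y r (p * s1) (q * s2) u) s
      = sw mo.msc (\<lambda>c b. mo.msc (y (p * S c)) (mo.st x r (b * s) u)) q" for p q r s u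
  proof -
    have "sw mo.msc (\<lambda>s1 s2. mo.st3 x y r (p * s1) (q * s2) u) s
      = sw mo.msc (\<lambda>c b. sw mo.msc (\<lambda>s1 s2. sw mo.msc (\<lambda>c' d. mo.msc (y (p * (s1 * S c') * S c)) (mo.st x r (b * d) u)) s2) s) q"
      by (simp only: mo.st3_mult_right[OF x y]) (subst sw_swap[OF mo.vs_msc], simp add: mult.assoc)
    also have "\<dots> = sw mo.msc (\<lambda>c b. mo.msc (y (p * 1 * S c)) (mo.st x r (b * s) u)) q"
    proof -
      have "sw mo.msc (\<lambda>s1 s2. sw mo.msc (\<lambda>c' d. mo.msc (y (p * (s1 * S c') * S c)) (mo.st x r (b * d) u)) s2) s
          = mo.msc (y (p * 1 * S c)) (mo.st x r (b * s) u)" for c b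
        by (rule antipode_collapse(1)[OF mo.vs_msc, of "\<lambda>z d. mo.msc (y (p * z * S c)) (mo.st x r (b * d) u)"])
          (simp add: bil_def lin_def alg_simps mo.act_simps ys mult.commute)
      then show ?thesis by simp
    qed
    finally show ?thesis by simp
  qed
  have 2: "lin_ext mo.msc (\<lambda>((r, s), u). sw mo.msc (\<lambda>c b. mo.msc (y (p * S c)) (mo.st x r (b * s) u)) q) (rep (mact a e))
      = mo.op a x (mo.st y p q e)" for p q e
  proof -
    have "lin_ext mo.msc (\<lambda>((r, s), u). sw mo.msc (\<lambda>c b. mo.msc (y (p * S c)) (mo.st x r (b * s) u)) q) (rep (mact a e))
        = sw mo.msc (\<lambda>c b. lin_ext mo.msc (\<lambda>((r, s), u). mo.msc (y (p * S c)) (mo.st x r (b * s) u)) (rep (mact a e))) q"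
      unfolding sw_def case_prod_unfold by (rule mo.m.lin_ext_swap)
    also have "\<dots> = sw mo.msc (\<lambda>c b. mo.msc (y (p * S c)) (mo.op a x (actV b e))) q"
      by (simp add: mo.op_mult_right[OF x] mo.m.lin_ext_fun_scale case_prod_unfold del: mo.m.scale_scale)
    also have "\<dots> = mo.op a x (mo.st y p q e)"
      by (simp add: mo.st_def sw_lin_apply[OF mo.vs_msc mo.op_lin[OF x]] lin_scale[OF mo.op_lin[OF x]])
    finally show ?thesis .
  qed
  have "mo.pair3 x y (nest_right (\<lambda>w. rep (mact a w)) X)
      = lin_ext mo.msc (\<lambda>((p, q), e). lin_ext mo.msc (\<lambda>((r, s), u).
          sw mo.msc (\<lambda>s1 s2. mo.st3 x y r (p * s1) (q * s2) u) s) (rep (mact a e))) X"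
    by (simp add: mo.pair3_def nest_right_def mo.m.lin_ext_lin_ext fs.lin_ext_lin_ext case_prod_unfold sw_def)
  also have "\<dots> = lin_ext mo.msc (\<lambda>((p, q), e). mo.op a x (mo.st y p q e)) X"
    unfolding 1 2 ..
  also have "\<dots> = mo.op a x (mo.pair1 y X)"
    by (simp add: mo.pair1_def lin_lin_ext_apply[OF mo.vs_msc mo.op_lin[OF x]] case_prod_unfold)
  finally show ?thesis .
qed

text \<open>The convolution of the functionals \<open>x(p -)\<close> and \<open>y(q -)\<close>.\<close>

definition conv :: "('h \<Rightarrow> 'k) \<Rightarrow> ('h \<Rightarrow> 'k) \<Rightarrow> 'h \<Rightarrow> 'h \<Rightarrow> 'h \<Rightarrow> 'k" where
  "conv x y p q h = sw (*) (\<lambda>a b. x (p * a) * y (q * b)) h"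

lemma
  assumes x: "lin scale (*) x" and y: "lin scale (*) y"
  shows conv_bil: "bil (*) (\<lambda>a b. x (p * a) * y (q * b))" and conv_lin: "lin scale (*) (conv x y p q)"
proof -
  show "bil (*) (\<lambda>a b. x (p * a) * y (q * b))"
    by (simp add: bil_def lin_def alg_simps lin_add[OF x] lin_add[OF y] lin_scale[OF x] lin_scale[OF y])
  then show "lin scale (*) (conv x y p q)" unfolding conv_def by (rule sw_lin[OF vector_space_mult])
qed

lemma conv_add1: "lin scale (*) x \<Longrightarrow> conv x y (p + p') q h = conv x y p q h + conv x y p' q h"
  and conv_add2: "lin scale (*) y \<Longrightarrow> conv x y p (q + q') h = conv x y p q h + conv x y p q' h"
  by (simp_all add: conv_def distrib_left distrib_right lin_add sw_fun_add[OF vector_space_mult])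

lemma conv_scale1: "lin scale (*) x \<Longrightarrow> conv x y (scale c p) q h = c * conv x y p q h"
  and conv_scale2: "lin scale (*) y \<Longrightarrow> conv x y p (scale c q) h = c * conv x y p q h"
  by (simp_all add: conv_def scale_mult_left lin_scale mult.assoc mult.left_commute sw_fun_scale[OF vector_space_mult])

lemma conv_mult:
  assumes x: "lin scale (*) x" and y: "lin scale (*) y"
  shows "conv x y p q (f * h) = sw (*) (\<lambda>f1 f2. conv x y (p * f1) (q * f2) h) f"
  unfolding conv_def by (subst sw_mult[OF vector_space_mult conv_bil[OF x y]]) (simp add: mult.assoc)

lemma pair3_nest_left:
  assumes x: "lin scale (*) x" and y: "lin scale (*) y"
  shows "mo.pair3 x y (nest_left (\<lambda>e. rep (mact e v)) X)
    = lin_ext mo.msc (\<lambda>((p, q), e). mo.op e (conv x y p q) v) X"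
proof -
  note xs = lin_add[OF x] lin_scale[OF x] lin_add[OF y] lin_scale[OF y]
  have 1: "sw mo.msc (\<lambda>r1 r2. mo.st3 x y (p * r1) (q * r2) s u) r = mo.st (conv x y p q) r s u" for p q r s u
  proof -
    have t: "tril mo.msc (\<lambda>e c b. mo.msc (y (q' * S e)) (mo.msc (x (p' * S c)) (actV b u)))" for p' q'
      by (simp add: tril_def lin_def alg_simps mo.act_simps xs mult.commute)
        (simp add: mult.left_commute)?
    have "mo.st3 x y p' q' s u = sw mo.msc (\<lambda>a b. sw mo.msc (\<lambda>e c. mo.msc (y (q' * S e)) (mo.msc (x (p' * S c)) (actV b u))) a) s" for p' q'
      unfolding mo.st3_def mo.st_def sw_fun_scale[OF mo.vs_msc, symmetric]
      by (rule sw_coassoc[OF mo.vs_msc t, symmetric])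
    then have "sw mo.msc (\<lambda>r1 r2. mo.st3 x y (p * r1) (q * r2) s u) r
        = sw mo.msc (\<lambda>a b. sw mo.msc (\<lambda>r1 r2. sw mo.msc (\<lambda>e c. mo.msc (y (q * r2 * S e)) (mo.msc (x (p * r1 * S c)) (actV b u))) a) r) s"
      by simp (rule sw_swap[OF mo.vs_msc])
    also have "\<dots> = mo.st (conv x y p q) r s u"
    proof -
      have "sw mo.msc (\<lambda>r1 r2. sw mo.msc (\<lambda>e c. mo.msc (y (q * r2 * S e)) (mo.msc (x (p * r1 * S c)) w)) a) r
          = mo.msc (conv x y p q (r * S a)) w" for a w
      proof -
        have l: "lin (*) mo.msc (\<lambda>c. mo.msc c w)" by (simp add: lin_def mo.m.scale_left_distrib)
        have "conv x y p q (r * S a) = sw (*) (\<lambda>r1 r2. conv x y (p * r1) (q * r2) (S a)) r"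
          by (rule conv_mult[OF x y])
        also have "\<dots> = sw (*) (\<lambda>r1 r2. sw (*) (\<lambda>e c. x (p * r1 * S c) * y (q * r2 * S e)) a) r"
          unfolding conv_def by (simp only: sw_antipode[OF vector_space_mult conv_bil[OF x y]])
        finally have "mo.msc (conv x y p q (r * S a)) w
            = sw mo.msc (\<lambda>r1 r2. sw mo.msc (\<lambda>e c. mo.msc (x (p * r1 * S c) * y (q * r2 * S e)) w) a) r"
          by (simp add: sw_lin_apply[OF mo.vs_msc l])
        then show ?thesis by (simp add: mult.commute)
      qed
      then show ?thesis by (simp add: mo.st_def)
    qed
    finally show ?thesis .
  qed
  have "mo.pair3 x y (nest_left (\<lambda>e. rep (mact e v)) X)
      = lin_ext mo.msc (\<lambda>((p, q), e). lin_ext mo.msc (\<lambda>((r, s), u).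
          sw mo.msc (\<lambda>r1 r2. mo.st3 x y (p * r1) (q * r2) s u) r) (rep (mact e v))) X"
    by (simp add: mo.pair3_def nest_left_def mo.m.lin_ext_lin_ext fs.lin_ext_lin_ext case_prod_unfold sw_def)
  also have "\<dots> = lin_ext mo.msc (\<lambda>((p, q), e). mo.op e (conv x y p q) v) X"
    unfolding 1 by (simp add: mo.op_def mo.pair1_def)
  finally show ?thesis .
qed

lemma commutator_conv:
  assumes x: "lin scale (*) x" and y: "lin scale (*) y"
  shows "mo.op a x (mo.op b y v) - mo.op b y (mo.op a x v)
    = lin_ext mo.msc (\<lambda>((p, q), e). mo.op e (conv x y p q) v) (rep (br a b))"
proof -
  have "mo.pair3 x y (nest_right (\<lambda>w. rep (mact a w)) (rep (mact b v))
     - flip12 (nest_right (\<lambda>w. rep (mact b w)) (rep (mact a v)))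
     - nest_left (\<lambda>e. rep (mact e v)) (rep (br a b))) = 0"
    by (rule mo.pair3_rel3M[OF x y module_jacobi])
  then have "mo.pair3 x y (nest_right (\<lambda>w. rep (mact a w)) (rep (mact b v)))
     - mo.pair3 x y (flip12 (nest_right (\<lambda>w. rep (mact b w)) (rep (mact a v))))
     - mo.pair3 x y (nest_left (\<lambda>e. rep (mact e v)) (rep (br a b))) = 0"
    by (simp add: mo.pair3_def mo.m.lin_ext_diff)
  then show ?thesis
    by (simp add: mo.pair3_flip12[OF x y] pair3_nest_right[OF x y] pair3_nest_right[OF y x] pair3_nest_left[OF x y] mo.op_def)
qed

text \<open>
  Represent \<open>[a * b]\<close> as \<open>\<Sum> (h\<^sub>i \<otimes> 1) \<otimes>\<^sub>H c\<^sub>i\<close> and write the \<open>h\<^sub>i\<close> in a basis \<open>E\<close>. The coefficient of \<open>e\<close> is the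
  bracket \<open>[a\<^sub>z b]\<close> for the functional \<open>z\<close> whose composition with \<open>S\<close> is the coordinate of \<open>e\<close>. Nothing in
  the sum depends on \<open>v\<close>, so this is an identity of operators.
\<close>

lemma commutator_op:
  assumes x: "lin scale (*) x" and y: "lin scale (*) y"
  obtains E z z' where "finite (E :: 'h set)" "\<And>e. e \<in> E \<Longrightarrow> lin scale (*) (z e)" "\<And>e. e \<in> E \<Longrightarrow> lin scale (*) (z' e)"
    "\<And>v. mo.op a x (mo.op b y v) - mo.op b y (mo.op a x v) = (\<Sum>e\<in>E. mo.op (L.x_bracket a (z e) b) (z' e) v)"
proof -
  define Y where "Y = (SOME Y. lin_ext fscale (\<lambda>(h, c). basis_vec ((h, 1), c)) Y \<in> br a b)"
  have "ad.embed (ad.straighten (rep (br a b))) \<in> br a b"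
    by (rule ad.pseudo_memI[OF ad.rep_pseudo ad.embed_straighten])
  then have Y: "ad.embed Y \<in> br a b" unfolding Y_def ad.embed_def by (rule someI)
  have "finite (fst ` Poly_Mapping.keys Y)" by simp
  then obtain E w where E: "finite E" "\<And>e. e \<in> E \<Longrightarrow> lin scale (*) (w e)"
    "\<And>h. h \<in> span (fst ` Poly_Mapping.keys Y) \<Longrightarrow> h = (\<Sum>e\<in>E. scale (w e h) e)"
    by (rule finite_coordinates) blast
  have lin_op: "lin scale mo.msc (\<lambda>p. mo.op e (conv x y p q) v)" "lin scale mo.msc (\<lambda>q. mo.op e (conv x y p q) v)"
    "lin ad.msc mo.msc (\<lambda>e. mo.op e (conv x y p q) v)" for p q e v
  proof -
    have c: "conv x y (p + p') q = (\<lambda>h. conv x y p q h + conv x y p' q h)"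
      "conv x y p (q + q') = (\<lambda>h. conv x y p q h + conv x y p q' h)"
      "conv x y (scale t p) q = (\<lambda>h. t * conv x y p q h)"
      "conv x y p (scale t q) = (\<lambda>h. t * conv x y p q h)" for p p' q q' t
      using conv_add1[OF x] conv_add2[OF y] conv_scale1[OF x] conv_scale2[OF y] by (simp_all add: fun_eq_iff)
    show "lin scale mo.msc (\<lambda>p. mo.op e (conv x y p q) v)" "lin scale mo.msc (\<lambda>q. mo.op e (conv x y p q) v)"
      by (rule linI; simp only: c mo.op_fun_add mo.op_fun_scale)+
    show "lin ad.msc mo.msc (\<lambda>e. mo.op e (conv x y p q) v)"
      by (rule mo.op_lin_left[OF conv_lin[OF x y]])
  qed
  show thesis
  proof
    fix v
    have "lin_ext mo.msc (\<lambda>((p, q), e). mo.op e (conv x y p q) v) (ad.embed Y - rep (br a b)) = 0"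
    proof (rule ad.lin_ext_rel2M[OF mo.vs_msc lin_op _ ad.pseudo_diff[OF Y ad.rep_pseudo]])
      fix p q f e
      have "mo.op (actL f e) (conv x y p q) v = mo.op e (\<lambda>h. conv x y p q (f * h)) v"
        by (rule mo.op_act[OF conv_lin[OF x y]])
      also have "\<dots> = sw mo.msc (\<lambda>f1 f2. mo.op e (conv x y (p * f1) (q * f2)) v) f"
        unfolding conv_mult[OF x y] by (rule mo.op_sw)
      finally show "sw mo.msc (\<lambda>f1 f2. mo.op e (conv x y (p * f1) (q * f2)) v) f = mo.op (actL f e) (conv x y p q) v" ..
    qed
    then have "mo.op a x (mo.op b y v) - mo.op b y (mo.op a x v)
        = lin_ext mo.msc (\<lambda>((p, q), e). mo.op e (conv x y p q) v) (ad.embed Y)"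
      by (simp add: commutator_conv[OF x y] mo.m.lin_ext_diff)
    also have "\<dots> = lin_ext mo.msc (\<lambda>(h, c). mo.op c (conv x y h 1) v) Y"
      by (simp add: ad.embed_def mo.m.lin_ext_lin_ext case_prod_unfold)
    also have "\<dots> = (\<Sum>e\<in>E. mo.op (lin_ext ad.msc (\<lambda>(h, c). ad.msc (w e h) c) Y) (conv x y e 1) v)"
      by (rule tensor_expand[OF mo.vs_msc lin_op(1) lin_op(3) E(3)[OF span_base]])
    also have "\<dots> = (\<Sum>e\<in>E. mo.op (L.x_bracket a (\<lambda>h. w e (S h)) b) (conv x y e 1) v)"
      by (simp add: L.x_bracket_def antipode_involutive flip: Y_def)
    finally show "mo.op a x (mo.op b y v) - mo.op b y (mo.op a x v)
      = (\<Sum>e\<in>E. mo.op (L.x_bracket a ((\<lambda>e h. w e (S h)) e) b) ((\<lambda>e. conv x y e 1) e) v)" .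
  next
    fix e assume "e \<in> E"
    then show "lin scale (*) ((\<lambda>e h. w e (S h)) e)" by (simp add: lin_compose[OF S_lin E(2)])
  qed (use E conv_lin[OF x y] in auto)
qed

end

section \<open>Spaces of operators\<close>

inductive_set fun_span :: "('k \<Rightarrow> 'v \<Rightarrow> 'v) \<Rightarrow> ('u \<Rightarrow> 'v) set \<Rightarrow> ('u \<Rightarrow> 'v::ab_group_add) set"
  for sc G where
  zero: "(\<lambda>_. 0) \<in> fun_span sc G"
| gen: "g \<in> G \<Longrightarrow> g \<in> fun_span sc G"
| add: "f \<in> fun_span sc G \<Longrightarrow> g \<in> fun_span sc G \<Longrightarrow> (\<lambda>v. f v + g v) \<in> fun_span sc G"
| scale: "f \<in> fun_span sc G \<Longrightarrow> (\<lambda>v. sc c (f v)) \<in> fun_span sc G"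

lemma fun_span_sum:
  "(\<And>e. e \<in> E \<Longrightarrow> f e \<in> fun_span sc G) \<Longrightarrow> (\<lambda>v. \<Sum>e\<in>E. f e v) \<in> fun_span sc G"
proof (induct E rule: infinite_finite_induct)
  case (insert e E)
  then have "(\<lambda>v. f e v + (\<Sum>e\<in>E. f e v)) \<in> fun_span sc G" by (intro fun_span.add) auto
  with insert show ?case by simp
qed (simp_all add: fun_span.zero)

lemma fun_span_mono: "f \<in> fun_span sc G \<Longrightarrow> G \<subseteq> G' \<Longrightarrow> f \<in> fun_span sc G'"
  by (induct rule: fun_span.induct) (auto intro: fun_span.intros)

context vector_space
begin

lemma fun_span_lin:
  assumes "f \<in> fun_span scale G" "\<And>g. g \<in> G \<Longrightarrow> lin scale scale g"
  shows "lin scale scale f"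
  using assms(1)
  by induct (auto simp: assms(2), auto simp: lin_def scale_right_distrib mult.commute add_ac)

text \<open>It suffices to check the Heisenberg relations on generators.\<close>

lemma fun_span_commutator:
  assumes "q \<in> fun_span scale G" and X: "lin scale scale X"
    and gen: "\<And>g. g \<in> G \<Longrightarrow> \<exists>c. \<exists>q'\<in>fun_span scale G. \<forall>v. g (X v) = X (g v) + scale c v + q' v"
  shows "\<exists>c. \<exists>q'\<in>fun_span scale G. \<forall>v. q (X v) = X (q v) + scale c v + q' v"
  using assms(1)
proof induct
  case zero
  show ?case
    by (intro exI[of _ 0] bexI[OF _ fun_span.zero]) (simp add: lin_zero[OF X])
next
  case (add f g)
  then obtain c q' d r' where q': "q' \<in> fun_span scale G" "\<And>v. f (X v) = X (f v) + scale c v + q' v"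
    and r': "r' \<in> fun_span scale G" "\<And>v. g (X v) = X (g v) + scale d v + r' v" by blast
  show ?case
    by (intro exI[of _ "c + d"] bexI[OF _ fun_span.add[OF q'(1) r'(1)]])
      (simp add: q'(2) r'(2) lin_add[OF X] scale_left_distrib)
next
  case (scale f t)
  then obtain c q' where q': "q' \<in> fun_span scale G" "\<And>v. f (X v) = X (f v) + scale c v + q' v" by blast
  show ?case
    by (intro exI[of _ "t * c"] bexI[OF _ fun_span.scale[OF q'(1), of t]])
      (simp add: q'(2) lin_scale[OF X] scale_right_distrib)
qed (rule gen)

end

section \<open>Growth of a finitely generated module\<close>

text \<open>
  The \<open>\<delta> i\<close> form a basis of the image of the Lie algebra in \<open>H\<close>, and \<open>B\<close> is a finite set of generators of the
  module over the enveloping algebra.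
\<close>

locale growth = smash_pseudo_map sd lb gmul gone ginv gact scale \<Delta> \<epsilon> S \<iota> \<gamma> actA actM \<beta>
  for sd :: "'k::field \<Rightarrow> 'd::ab_group_add \<Rightarrow> 'd" and lb
    and gmul :: "'g \<Rightarrow> 'g \<Rightarrow> 'g" and gone ginv gact
    and scale :: "'k \<Rightarrow> 'h::ring_1 \<Rightarrow> 'h" and \<Delta> \<epsilon> S \<iota> \<gamma>
    and actA :: "'h \<Rightarrow> 'a::ab_group_add \<Rightarrow> 'a" and actM :: "'h \<Rightarrow> 'm::ab_group_add \<Rightarrow> 'm" and \<beta> +
  fixes n :: nat and \<delta> :: "nat \<Rightarrow> 'h" and B :: "'m set"
  assumes delta_range: "i < n \<Longrightarrow> \<delta> i \<in> range \<iota>"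
    and delta_span: "\<exists>c. \<iota> x = (\<Sum>i<n. scale (c i) (\<delta> i))"
    and delta_indep: "(\<Sum>i<n. scale (c i) (\<delta> i)) = 0 \<Longrightarrow> i < n \<Longrightarrow> c i = 0"
    and finite_B: "finite B"
    and generates: "\<exists>c. (\<forall>b\<in>B. c b \<in> generated_subalgebra \<iota>) \<and> v = (\<Sum>b\<in>B. actM (c b) b)"
begin

abbreviation "mon us b \<equiv> foldr (\<lambda>i. actM (\<delta> i)) us b"

definition filt :: "nat \<Rightarrow> 'm set" where
  "filt K = m.span {mon us b | us b. b \<in> B \<and> set us \<subseteq> {..<n} \<and> length us \<le> K}"

lemma filt_sub: "m.subspace (filt K)"
  by (simp add: filt_def)

lemma filt_mon: "b \<in> B \<Longrightarrow> set us \<subseteq> {..<n} \<Longrightarrow> length us \<le> K \<Longrightarrow> mon us b \<in> filt K"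
  unfolding filt_def by (intro m.span_base) blast

lemma filt_mono: "K \<le> K' \<Longrightarrow> filt K \<subseteq> filt K'"
  unfolding filt_def by (intro m.span_mono) (auto intro: le_trans)

lemma filt_induct:
  assumes "v \<in> filt K" and f: "lin msc msc f" and S: "m.subspace V"
    and "\<And>us b. b \<in> B \<Longrightarrow> set us \<subseteq> {..<n} \<Longrightarrow> length us \<le> K \<Longrightarrow> f (mon us b) \<in> V"
  shows "f v \<in> V"
  using assms(1) unfolding filt_def
proof (induct rule: m.span_induct_alt)
  case base
  show ?case using S by (simp add: lin_zero[OF f] m.subspace_0)
next
  case (step c x y)
  then have "f x \<in> V" using assms(4) by blast
  with step S show ?case by (simp add: lin_add[OF f] lin_scale[OF f] m.subspace_add m.subspace_scale)
qed

lemma filt_delta: assumes "i < n" "v \<in> filt K" shows "actM (\<delta> i) v \<in> filt (Suc K)"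
proof (rule filt_induct[OF assms(2) act_lin_right filt_sub])
  fix us b assume "b \<in> B" "set us \<subseteq> {..<n}" "length us \<le> K"
  then show "actM (\<delta> i) (mon us b) \<in> filt (Suc K)" using filt_mon[of b "i # us" "Suc K"] assms(1) by simp
qed

lemma act_sum_left: "actM (\<Sum>i\<in>I. scale (c i) (f i)) v = (\<Sum>i\<in>I. msc (c i) (actM (f i) v))"
  by (simp add: lin_sum[OF act_lin_left] lin_scale[OF act_lin_left])

lemma filt_iota: assumes "v \<in> filt K" shows "actM (\<iota> x) v \<in> filt (Suc K)"
proof -
  obtain c where "\<iota> x = (\<Sum>i<n. scale (c i) (\<delta> i))" using delta_span by blast
  then show ?thesis
    by (auto simp: act_sum_left intro!: m.subspace_sum m.subspace_scale filt_sub filt_delta assms)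
qed

lemma filt_exhausts: "\<exists>K. v \<in> filt K"
proof -
  have add: "\<exists>K. u + v \<in> filt K" if "\<exists>K. u \<in> filt K" "\<exists>K. v \<in> filt K" for u v
  proof -
    from that obtain K K' where "u \<in> filt K" "v \<in> filt K'" by blast
    then have "u + v \<in> filt (max K K')"
      using filt_mono[of K "max K K'"] filt_mono[of K' "max K K'"] by (intro m.subspace_add filt_sub) auto
    then show ?thesis ..
  qed
  have sum: "\<exists>K. (\<Sum>i\<in>I. f i) \<in> filt K" if "\<And>i. i \<in> I \<Longrightarrow> \<exists>K. f i \<in> filt K" for I :: "'i set" and f
    using that
    by (induct I rule: infinite_finite_induct) (auto simp: m.subspace_0[OF filt_sub] intro!: add)
  have scale: "\<exists>K. msc c v \<in> filt K" if "\<exists>K. v \<in> filt K" for c v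
    using that m.subspace_scale[OF filt_sub] by blast
  have word: "\<exists>K. actM (prod_list (map \<iota> xs)) b \<in> filt K" if "b \<in> B" for xs b
  proof (induct xs)
    case Nil
    show ?case using filt_mon[OF that, of "[]" 0] by (auto simp: M.act_one)
  next
    case (Cons x xs)
    then show ?case using filt_iota by (auto simp: M.act_mult)
  qed
  have "\<exists>K. actM h b \<in> filt K" if "b \<in> B" "h \<in> generated_subalgebra \<iota>" for h b
  proof -
    from that(2) obtain X where X: "h = word_eval \<iota> X" by (auto simp: generated_subalgebra_def)
    show ?thesis unfolding X word_eval_def lin_ext_def act_sum_left
      by (rule sum) (rule scale, rule word[OF that(1)])
  qed
  moreover obtain c where "\<forall>b\<in>B. c b \<in> generated_subalgebra \<iota>" "v = (\<Sum>b\<in>B. actM (c b) b)"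
    using generates by meson
  ultimately show ?thesis using sum[of B "\<lambda>b. actM (c b) b"] by simp
qed

lemma filt_exhausts_finite: "finite A \<Longrightarrow> \<exists>K. A \<subseteq> filt K"
proof (induct rule: finite_induct)
  case (insert v A)
  then obtain K K' where "A \<subseteq> filt K" "v \<in> filt K'" using filt_exhausts by blast
  then have "insert v A \<subseteq> filt (max K K')"
    using filt_mono[of K "max K K'"] filt_mono[of K' "max K K'"] by auto
  then show ?case ..
qed simp

lemma primitive_delta: "i < n \<Longrightarrow> primitive (\<delta> i)"
  using delta_range[of i] primitive_iota by auto

text \<open>
  Moving a factor \<open>\<delta> i\<close> past \<open>op a x\<close> replaces \<open>x\<close> by a translate. Hence a bound on the generators, uniform in \<open>x\<close>
  by locality, is a bound on all monomials.
\<close>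

lemma op_filt: "\<exists>c. \<forall>x K v. lin scale (*) x \<longrightarrow> v \<in> filt K \<longrightarrow> op a x v \<in> filt (K + c)"
proof -
  have "\<exists>c. \<forall>x. lin scale (*) x \<longrightarrow> op a x b \<in> filt c" for b
  proof -
    obtain I h where I: "finite (I :: ('h \<times> 'm) set)"
      "\<And>x. lin scale (*) x \<Longrightarrow> op a x b = (\<Sum>i\<in>I. msc (x (h i)) (snd i))" by (rule op_local[of a b]) blast
    obtain c where "snd ` I \<subseteq> filt c" using filt_exhausts_finite[of "snd ` I"] I(1) by auto
    then have "op a x b \<in> filt c" if "lin scale (*) x" for x
      unfolding I(2)[OF that] by (intro m.subspace_sum m.subspace_scale filt_sub) auto
    then show ?thesis by blast
  qed
  then obtain f where f: "\<And>b x. lin scale (*) x \<Longrightarrow> op a x b \<in> filt (f b)" by metis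
  define c where "c = sum f B"
  have b: "op a x b \<in> filt c" if "lin scale (*) x" "b \<in> B" for x b
    using f[OF that(1), of b] filt_mono[of "f b" c] member_le_sum[of b B f] that finite_B by (auto simp: c_def)
  have w: "op a x (mon us b) \<in> filt (length us + c)" if "lin scale (*) x" "b \<in> B" "set us \<subseteq> {..<n}" for x us b
    using that(1,3)
  proof (induct us arbitrary: x)
    case Nil
    then show ?case using b that(2) by simp
  next
    case (Cons i us)
    have i: "i < n" and us: "set us \<subseteq> {..<n}" using Cons(3) by auto
    have "lin scale (*) (\<lambda>h. x (h * \<delta> i))" using Cons(2) by (simp add: lin_def alg_simps)
    from Cons(1)[OF this us] have "op a (\<lambda>h. x (h * \<delta> i)) (mon us b) \<in> filt (length (i # us) + c)"
      using filt_mono[of "length us + c" "length (i # us) + c"] by auto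
    moreover have "actM (\<delta> i) (op a x (mon us b)) \<in> filt (length (i # us) + c)"
      using filt_delta[OF i Cons(1)[OF Cons(2) us]] by simp
    ultimately show ?case
      by (simp add: op_primitive[OF Cons(2) primitive_delta[OF i]] m.subspace_diff[OF filt_sub])
  qed
  have "op a x v \<in> filt (K + c)" if x: "lin scale (*) x" and v: "v \<in> filt K" for x K v
  proof (rule filt_induct[OF v op_lin[OF x] filt_sub])
    fix us b assume "b \<in> B" "set us \<subseteq> {..<n}" "length us \<le> K"
    then show "op a x (mon us b) \<in> filt (K + c)"
      using w[OF x, of b us] filt_mono[of "length us + c" "K + c"] by auto
  qed
  then show ?thesis by blast
qed

lemma commutator_filt:
  assumes "i < n" "j < n" "v \<in> filt K"
  shows "actM (\<delta> i) (actM (\<delta> j) v) - actM (\<delta> j) (actM (\<delta> i) v) \<in> filt (Suc K)"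
proof -
  obtain x y where "\<delta> i = \<iota> x" "\<delta> j = \<iota> y" using delta_range assms by blast
  then have "actM (\<delta> i) (actM (\<delta> j) v) - actM (\<delta> j) (actM (\<delta> i) v) = actM (\<iota> (lb x y)) v"
    by (simp add: iota_lb lin_diff[OF act_lin_left] M.act_mult)
  then show ?thesis using filt_iota[OF assms(3)] by simp
qed

lemma mon_move:
  assumes "b \<in> B" "i < n" "set us \<subseteq> {..<n}" "set vs \<subseteq> {..<n}"
  shows "mon (us @ i # vs) b - mon (i # us @ vs) b \<in> filt (length us + length vs)"
  using assms(3)
proof (induct us)
  case Nil
  show ?case by (simp add: m.subspace_0[OF filt_sub])
next
  case (Cons j us)
  let ?w = "mon (us @ vs) b"
  have j: "j < n" using Cons(2) by simp
  have "actM (\<delta> j) (mon (us @ i # vs) b - mon (i # us @ vs) b) \<in> filt (length (j # us) + length vs)"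
    using filt_delta[OF j Cons(1)] Cons(2) by simp
  moreover have "?w \<in> filt (length us + length vs)" by (rule filt_mon) (use assms Cons(2) in auto)
  from commutator_filt[OF j assms(2) this]
  have "actM (\<delta> j) (actM (\<delta> i) ?w) - actM (\<delta> i) (actM (\<delta> j) ?w) \<in> filt (length (j # us) + length vs)" by simp
  ultimately show ?case
    using m.subspace_add[OF filt_sub] by (fastforce simp: lin_diff[OF act_lin_right])
qed

text \<open>Moving a factor to the front costs commutators of two factors, which are of degree one.\<close>

lemma mon_permute:
  assumes "b \<in> B" "set us \<subseteq> {..<n}" "mset us = mset vs"
  shows "mon us b - mon vs b \<in> filt (length us - 1)"
  using assms(2,3)
proof (induct us arbitrary: vs)
  case Nil
  then show ?case by (simp add: m.subspace_0[OF filt_sub])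
next
  case (Cons i us)
  have i: "i < n" using Cons(2) by simp
  have "i \<in> set vs" using Cons(3) by (metis list.set_intros(1) mset_eq_setD)
  then obtain p s where vs: "vs = p @ i # s" by (meson split_list)
  have m: "mset us = mset (p @ s)" using Cons(3) by (simp add: vs)
  have sets: "set p \<subseteq> {..<n}" "set s \<subseteq> {..<n}" using Cons(2,3) mset_eq_setD[OF Cons(3)] by (auto simp: vs)
  have len: "length us = length p + length s" using mset_eq_length[OF m] by simp
  have 1: "mon vs b - mon (i # p @ s) b \<in> filt (length us)"
    using mon_move[OF assms(1) i sets] by (simp add: vs len)
  have 2: "mon (i # us) b - mon (i # p @ s) b \<in> filt (length us)"
  proof (cases us)
    case Nil
    with m show ?thesis by (simp add: m.subspace_0[OF filt_sub])
  next
    case (Cons a list)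
    have "mon us b - mon (p @ s) b \<in> filt (length us - 1)" by (rule Cons.hyps[OF _ m]) (use Cons.prems in simp)
    from filt_delta[OF i this] show ?thesis by (simp add: lin_diff[OF act_lin_right] Cons)
  qed
  from m.subspace_diff[OF filt_sub 2 1] show ?case by simp
qed

text \<open>
  Up to shorter monomials the factors can be sorted, and a sorted monomial of degree at most \<open>K\<close> is given by
  \<open>n\<close> exponents between \<open>0\<close> and \<open>K\<close>.
\<close>

lemma filt_dimension:
  obtains T where "finite T" "card T \<le> card B * (K + 1) ^ n" "filt K \<subseteq> m.span T"
proof -
  define MS where "MS = (\<lambda>K. {M. set_mset M \<subseteq> {..<n} \<and> size M \<le> K})"
  define T where "T = (\<lambda>K. (\<lambda>(M, b). mon (sorted_list_of_multiset M) b) ` (MS K \<times> B))"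
  have inj: "inj_on (\<lambda>M. \<lambda>i\<in>{..<n}. count M i) (MS K)"
  proof (rule inj_onI)
    fix M N assume M: "M \<in> MS K" "N \<in> MS K" and eq: "(\<lambda>i\<in>{..<n}. count M i) = (\<lambda>i\<in>{..<n}. count N i)"
    show "M = N"
    proof (rule multiset_eqI)
      fix i
      show "count M i = count N i"
      proof (cases "i < n")
        case True
        with fun_cong[OF eq, of i] show ?thesis by simp
      next
        case False
        with M have "i \<notin># M" "i \<notin># N" by (auto simp: MS_def)
        then show ?thesis by (simp add: not_in_iff)
      qed
    qed
  qed
  have img: "(\<lambda>M. \<lambda>i\<in>{..<n}. count M i) ` MS K \<subseteq> ({..<n} \<rightarrow>\<^sub>E {..K})"
    by (auto simp: MS_def intro: order_trans[OF count_le_size] split: if_splits)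
  have fin: "finite ({..<n} \<rightarrow>\<^sub>E {..K})" by (intro finite_PiE) auto
  have finMS: "finite (MS K)" by (rule inj_on_finite[OF inj img fin])
  have "card (MS K) \<le> (K + 1) ^ n"
    using card_inj_on_le[OF inj img fin] by (simp add: card_PiE)
  then have cT: "card (T K) \<le> card B * (K + 1) ^ n"
    unfolding T_def using card_image_le[of "MS K \<times> B" "\<lambda>(M, b). mon (sorted_list_of_multiset M) b"] finMS finite_B
    by (simp add: card_cartesian_product mult.commute) (meson le_trans mult_le_mono2)
  have Tmono: "m.span (T K) \<subseteq> m.span (T (Suc K))" for K
    by (rule m.span_mono) (auto simp: T_def MS_def)
  have "mon us b \<in> m.span (T K)" if "b \<in> B" "set us \<subseteq> {..<n}" "length us \<le> K" for us b K
    using that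
  proof (induct K arbitrary: us b)
    case 0
    then show ?case by (auto simp: T_def MS_def intro!: m.span_base image_eqI[of _ _ "({#}, b)"])
  next
    case (Suc K)
    have filtK: "filt K \<subseteq> m.span (T K)"
      unfolding filt_def by (rule m.span_minimal) (use Suc(1) in auto)
    have "length us - 1 \<le> K" using Suc(4) by simp
    have "mon us b - mon (sorted_list_of_multiset (mset us)) b \<in> filt (length us - 1)"
      by (rule mon_permute) (use Suc in auto)
    then have "mon us b - mon (sorted_list_of_multiset (mset us)) b \<in> m.span (T (Suc K))"
      using filt_mono[OF \<open>length us - 1 \<le> K\<close>] filtK Tmono by blast
    moreover have "mon (sorted_list_of_multiset (mset us)) b \<in> m.span (T (Suc K))"
      using Suc by (auto simp: T_def MS_def intro!: m.span_base image_eqI[of _ _ "(mset us, b)"])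
    ultimately show ?case using m.span_add by fastforce
  qed
  then have "filt K \<subseteq> m.span (T K)" unfolding filt_def by (intro m.span_minimal) auto
  with cT show thesis using finMS finite_B by (intro that[of "T K"]) (auto simp: T_def)
qed

end

section \<open>Weight spaces and Lie's theorem\<close>

locale finite_representation =
  growth sd lb gmul gone ginv gact scale \<Delta> \<epsilon> S \<iota> \<gamma> actL actV mact n \<delta> B
    + smash_representation sd lb gmul gone ginv gact scale \<Delta> \<epsilon> S \<iota> \<gamma> actL br actV mact
  for sd :: "'k::{alg_closed_field, field_char_0} \<Rightarrow> 'd::ab_group_add \<Rightarrow> 'd" and lb
    and gmul :: "'g \<Rightarrow> 'g \<Rightarrow> 'g" and gone ginv gact
    and scale :: "'k \<Rightarrow> 'h::ring_1 \<Rightarrow> 'h" and \<Delta> \<epsilon> S \<iota> \<gamma>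
    and actL :: "'h \<Rightarrow> 'l::ab_group_add \<Rightarrow> 'l" and br
    and actV :: "'h \<Rightarrow> 'v::ab_group_add \<Rightarrow> 'v" and mact
    and n :: nat and \<delta> :: "nat \<Rightarrow> 'h" and B :: "'v set"
begin

sublocale hopf_algebra_char_0 scale \<Delta> \<epsilon> S ..

abbreviation "vsc \<equiv> mscale actV"

definition ops :: "'l set \<Rightarrow> ('v \<Rightarrow> 'v) set" where
  "ops A = fun_span vsc {op a x | a x. a \<in> A \<and> lin scale (*) x}"

definition weight_space :: "'l set \<Rightarrow> ('l \<Rightarrow> ('h \<Rightarrow> 'k) \<Rightarrow> 'k) \<Rightarrow> 'v set" where
  "weight_space A l = {v. \<forall>a\<in>A. \<forall>x. lin scale (*) x \<longrightarrow> op a x v = vsc (l a x) v}"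

lemma finitely_generated: "finitely_generated_over (generated_subalgebra \<iota>) actV"
  unfolding finitely_generated_over_def using finite_B generates by blast

lemma weight_space_sub: "m.subspace (weight_space A l)"
  unfolding weight_space_def m.subspace_def
  by (auto simp: lin_zero[OF op_lin] lin_add[OF op_lin] lin_scale[OF op_lin] m.scale_right_distrib mult.commute)

lemma weight_spaceD: "w \<in> weight_space A l \<Longrightarrow> a \<in> A \<Longrightarrow> lin scale (*) x \<Longrightarrow> op a x w = vsc (l a x) w"
  by (simp add: weight_space_def)

lemma ops_scalar: "r \<in> ops A \<Longrightarrow> \<exists>s. \<forall>w\<in>weight_space A l. r w = vsc s w"
  unfolding ops_def
proof (induct rule: fun_span.induct)
  case zero
  show ?case by (intro exI[of _ 0]) simp
next
  case (gen g)
  then show ?case by (auto simp: weight_spaceD)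
next
  case (add f g)
  then obtain s t where "\<forall>w\<in>weight_space A l. f w = vsc s w" "\<forall>w\<in>weight_space A l. g w = vsc t w" by blast
  then show ?case by (intro exI[of _ "s + t"]) (simp add: m.scale_left_distrib)
next
  case (scale f c)
  then obtain s where "\<forall>w\<in>weight_space A l. f w = vsc s w" by blast
  then show ?case by (intro exI[of _ "c * s"]) simp
qed

text \<open>By locality, \<open>l x\<close> depends on finitely many values of \<open>x\<close>, and linearly so.\<close>

lemma weight_element:
  assumes "v \<noteq> 0" and l: "\<And>x. lin scale (*) x \<Longrightarrow> op a x v = vsc (l x) v"
  obtains f where "\<And>x. lin scale (*) x \<Longrightarrow> l x = x f"
proof -
  obtain I h where I: "finite (I :: ('h \<times> 'v) set)"
    "\<And>x. lin scale (*) x \<Longrightarrow> op a x v = (\<Sum>i\<in>I. vsc (x (h i)) (snd i))" by (rule op_local[of a v]) blast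
  obtain k where k: "lin vsc (*) k" "k v = 1" using m.functional_nonzero[OF assms(1)] by blast
  show thesis
  proof
    fix x assume x: "lin scale (*) x"
    have "k (vsc (l x) v) = k (\<Sum>i\<in>I. vsc (x (h i)) (snd i))" by (simp add: l[OF x, symmetric] I(2)[OF x])
    then show "l x = x (\<Sum>i\<in>I. scale (k (snd i)) (h i))"
      by (simp add: lin_sum[OF k(1)] lin_scale[OF k(1)] k(2) lin_sum[OF x] lin_scale[OF x] mult.commute)
  qed
qed

text \<open>The operators of \<open>A\<close> commute up to operators of \<open>A'\<close>, in the way of \<open>[A, A] \<subseteq> A' \<subseteq> A\<close>.\<close>

definition commutators_in :: "'l set \<Rightarrow> 'l set \<Rightarrow> bool" where
  "commutators_in A A' \<longleftrightarrow> A' \<subseteq> A \<and> (\<forall>a\<in>A. \<forall>b\<in>A. \<forall>x y. lin scale (*) x \<longrightarrow> lin scale (*) y \<longrightarrow>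
     (\<lambda>v. op a x (op b y v) - op b y (op a x v)) \<in> ops A')"

lemma commutators_inD:
  assumes "commutators_in A A'" "a \<in> A" "b \<in> A" "lin scale (*) x" "lin scale (*) y"
  obtains r where "r \<in> ops A'" "\<And>v. op a x (op b y v) = op b y (op a x v) + r v"
proof
  show "(\<lambda>v. op a x (op b y v) - op b y (op a x v)) \<in> ops A'"
    using assms by (simp add: commutators_in_def)
qed simp

text \<open>The annihilation operators in the Heisenberg relations for weight vectors.\<close>

definition shifted :: "'l set \<Rightarrow> ('l \<Rightarrow> ('h \<Rightarrow> 'k) \<Rightarrow> 'k) \<Rightarrow> ('v \<Rightarrow> 'v) set" where
  "shifted A l = {\<lambda>v. op a x v - vsc (l a x) v | a x. a \<in> A \<and> lin scale (*) x}"

lemma ops_shift: "r \<in> ops A \<Longrightarrow> \<exists>s. \<exists>q\<in>fun_span vsc (shifted A l). \<forall>v. r v = vsc s v + q v"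
  unfolding ops_def
proof (induct rule: fun_span.induct)
  case zero
  show ?case by (intro exI[of _ 0] bexI[OF _ fun_span.zero]) simp
next
  case (gen g)
  then obtain a x where g: "g = op a x" "a \<in> A" "lin scale (*) x" by blast
  then have "(\<lambda>v. op a x v - vsc (l a x) v) \<in> fun_span vsc (shifted A l)"
    by (intro fun_span.gen) (auto simp: shifted_def)
  then show ?case unfolding g by (intro exI[of _ "l a x"] bexI) auto
next
  case (add f g)
  then obtain s q t r where q: "q \<in> fun_span vsc (shifted A l)" "\<forall>v. f v = vsc s v + q v"
    and r: "r \<in> fun_span vsc (shifted A l)" "\<forall>v. g v = vsc t v + r v" by blast
  show ?case
    by (intro exI[of _ "s + t"] bexI[OF _ fun_span.add[OF q(1) r(1)]]) (simp add: q(2) r(2) m.scale_left_distrib)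
next
  case (scale f c)
  then obtain s q where q: "q \<in> fun_span vsc (shifted A l)" "\<forall>v. f v = vsc s v + q v" by blast
  show ?case
    by (intro exI[of _ "c * s"] bexI[OF _ fun_span.scale[OF q(1), of c]]) (simp add: q(2) m.scale_right_distrib)
qed

lemma shifted_lin: "g \<in> shifted A l \<Longrightarrow> lin vsc vsc g"
  unfolding shifted_def
  by (auto intro!: linI simp: lin_add[OF op_lin] lin_scale[OF op_lin] m.scale_right_distrib m.scale_right_diff_distrib mult.commute)

lemma shifted_kills: "q \<in> fun_span vsc (shifted A l) \<Longrightarrow> w \<in> weight_space A l \<Longrightarrow> q w = 0"
  by (induct rule: fun_span.induct) (auto simp: shifted_def weight_spaceD)

lemma shifted_commutator_op:
  assumes AA: "commutators_in A A'" and b: "b \<in> A" "lin scale (*) z" and g: "g \<in> shifted A' l"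
  shows "\<exists>c. \<exists>q'\<in>fun_span vsc (shifted A' l). \<forall>v. g (op b z v) = op b z (g v) + vsc c v + q' v"
proof -
  obtain a x where a: "a \<in> A'" "lin scale (*) x" and g: "g = (\<lambda>v. op a x v - vsc (l a x) v)"
    using g by (auto simp: shifted_def)
  have "a \<in> A" using a AA by (auto simp: commutators_in_def)
  then obtain r where r: "r \<in> ops A'" "\<And>v. op a x (op b z v) = op b z (op a x v) + r v"
    using commutators_inD[OF AA _ b(1) a(2) b(2)] by blast
  obtain s q where "q \<in> fun_span vsc (shifted A' l)" "\<forall>v. r v = vsc s v + q v"
    using ops_shift[OF r(1)] by blast
  then show ?thesis
    by (intro exI[of _ s] bexI[of _ q]) (auto simp: g r(2) lin_diff[OF op_lin[OF b(2)]] lin_scale[OF op_lin[OF b(2)]])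
qed

lemma shifted_commutator_delta:
  assumes d: "primitive e" and g: "g \<in> shifted A l"
  shows "\<exists>c. \<exists>q'\<in>fun_span vsc (shifted A l). \<forall>v. g (actV e v) = actV e (g v) + vsc c v + q' v"
proof -
  obtain a x where a: "a \<in> A" "lin scale (*) x" and g: "g = (\<lambda>v. op a x v - vsc (l a x) v)"
    using g by (auto simp: shifted_def)
  let ?x = "\<lambda>h. x (h * e)"
  let ?g = "\<lambda>v. op a ?x v - vsc (l a ?x) v"
  have "lin scale (*) ?x" using a(2) by (simp add: lin_def alg_simps)
  then have "?g \<in> fun_span vsc (shifted A l)" using a by (intro fun_span.gen) (auto simp: shifted_def)
  from fun_span.scale[OF this, of "- 1"]
  have "(\<lambda>v. vsc (- 1) (?g v)) \<in> fun_span vsc (shifted A l)" .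
  then show ?thesis
    by (intro exI[of _ "- l a ?x"] bexI[of _ "\<lambda>v. vsc (- 1) (?g v)"])
      (auto simp: g op_primitive[OF a(2) d] lin_diff[OF act_lin_right] lin_scale[OF act_lin_right])
qed

text \<open>
  For \<open>v\<close> in the weight space, \<open>a * v = (f \<otimes> 1) \<otimes>\<^sub>H v\<close> with a fixed \<open>f \<noteq> 0\<close>, so \<open>a\<close> has no kernel there.
\<close>

lemma weight_space_fin_dim:
  assumes "a \<in> A" "lin scale (*) x" "l a x \<noteq> 0"
  shows "fin_dim vsc (weight_space A l)"
proof (cases "weight_space A l \<subseteq> {0}")
  case True
  then show ?thesis by (auto simp: fin_dim_def intro!: exI[of _ "{}"])
next
  case False
  then obtain v where v: "v \<in> weight_space A l" "v \<noteq> 0" by blast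
  obtain f where f: "\<And>x. lin scale (*) x \<Longrightarrow> l a x = x f"
    using weight_element[OF v(2), of a "l a"] weight_spaceD[OF v(1) assms(1)] by blast
  have "fin_dim vsc ((\<lambda>v. v) ` weight_space A l)"
  proof (rule fin_dim_bounded_coefficients[OF finitely_generated, of "{f}" _ a])
    fix v x assume "v \<in> weight_space A l" "lin scale (*) x" "\<And>e. e \<in> {f} \<Longrightarrow> x e = 0"
    then show "op a x v = 0" using f by (simp add: weight_spaceD[OF _ assms(1)])
  next
    fix v assume "v \<in> weight_space A l" "\<And>x. lin scale (*) x \<Longrightarrow> op a x v = 0"
    then show "v = 0" using weight_spaceD[OF _ assms(1,2), of v l] assms(2,3) by simp
  qed (simp_all add: weight_space_sub lin_ident)
  then show ?thesis by simp
qed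

text \<open>
  Let \<open>W\<close> be the weight space and suppose that \<open>T = op b z\<close> moves \<open>w0\<close> out of \<open>W\<close>. The operators
  \<open>op a x - l a x\<close>, \<open>a \<in> A'\<close>, annihilate \<open>w0\<close>, and their commutators with \<open>T\<close> and with the \<open>n\<close> operators \<open>\<delta> i\<close> are
  scalars up to operators of the same kind. If these Heisenberg relations are nondegenerate, the ordered
  monomials in \<open>\<delta> 0, \<dots>, \<delta> (n - 1), T\<close> applied to \<open>w0\<close> are independent: a module over \<open>n\<close> variables would contain
  a space that grows like polynomials in \<open>n + 1\<close> variables.
  
  A degenerate combination of the creation operators has the form \<open>e + t T\<close> with \<open>e\<close> in the span of the \<open>\<delta> i\<close>,
  and it maps \<open>W\<close> to \<open>W\<close>. If \<open>t = 0\<close>, the element of \<open>H\<close> that gives the weight of \<open>a0\<close> is killed by \<open>e\<close>.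
  If \<open>t \<noteq> 0\<close>, then the functionals \<open>y\<close> such that \<open>op b y\<close> maps \<open>W\<close> to \<open>W\<close> are stable under
  translation by \<open>e\<close>: modulo \<open>W\<close>, both \<open>op b y\<close> and \<open>e\<close> act on \<open>W\<close> as operators of \<open>b\<close>, which commute up to
  operators of \<open>A'\<close>. Their annihilator is therefore stable under \<open>e\<close>; it is nonzero and finite-dimensional. In
  both cases \<open>e = 0\<close> by \<open>primitive_fin_dim_stable\<close>, so \<open>t T\<close> maps \<open>W\<close> to \<open>W\<close>, a contradiction.
\<close>

lemma weight_space_stable:
  assumes AA: "commutators_in A A'" and a0: "a0 \<in> A'" "lin scale (*) x0" "l a0 x0 \<noteq> 0"
    and b: "b \<in> A" "lin scale (*) z" and w0: "w0 \<in> weight_space A' l"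
  shows "op b z w0 \<in> weight_space A' l"
proof (rule ccontr)
  assume unstable: "op b z w0 \<notin> weight_space A' l"
  let ?W = "weight_space A' l" and ?T = "op b z" and ?Q = "fun_span vsc (shifted A' l)"
  let ?X = "\<lambda>i. if i < n then actV (\<delta> i) else ?T"
  note T = op_lin[OF b(2)]
  have w0_0: "w0 \<noteq> 0" using unstable w0 by (metis T lin_zero)
  have X_lin: "lin vsc vsc (?X i)" for i using T act_lin_right by simp
  have X_comm: "\<exists>c. \<exists>q'\<in>?Q. \<forall>v. q (?X i v) = ?X i (q v) + vsc c v + q' v" if "q \<in> ?Q" for q i
    by (rule m.fun_span_commutator[OF that X_lin])
      (use shifted_commutator_op[OF AA b] shifted_commutator_delta[OF primitive_delta] in \<open>auto split: if_splits\<close>)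
  interpret heisenberg vsc ?X "Suc n" ?Q w0
  proof
    show "lin vsc vsc q" if "q \<in> ?Q" for q by (rule m.fun_span_lin[OF that shifted_lin])
    show "q w0 = 0" if "q \<in> ?Q" for q by (rule shifted_kills[OF that w0])
    show "lin vsc vsc (?X i)" for i by (rule X_lin)
    show "\<exists>c. \<exists>q'\<in>?Q. \<forall>v. q (?X i v) = ?X i (q v) + vsc c v + q' v" if "q \<in> ?Q" for q i
      by (rule X_comm[OF that])
  qed
  have W_sub: "m.subspace ?W" by (rule weight_space_sub)
  have nondeg: "\<exists>q\<in>?Q. q (\<Sum>i<Suc n. vsc (c i) (?X i w0)) \<noteq> 0" if c: "\<exists>i<Suc n. c i \<noteq> 0" for c
  proof (rule ccontr)
    assume "\<not> ?thesis"
    then have kill: "q (\<Sum>i<Suc n. vsc (c i) (?X i w0)) = 0" if "q \<in> ?Q" for q using that by blast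
    define u where "u = (\<lambda>w. \<Sum>i<Suc n. vsc (c i) (?X i w))"
    have uW: "u w \<in> ?W" if w: "w \<in> ?W" for w
    proof -
      have "q (u w) = 0" if q: "q \<in> ?Q" for q
      proof -
        have "\<forall>i. \<exists>s. \<forall>v\<in>?W. q (?X i v) = vsc s v"
        proof
          fix i
          obtain s q' where q': "q' \<in> ?Q" "\<forall>v. q (?X i v) = ?X i (q v) + vsc s v + q' v" using X_comm[OF q] by blast
          have "q (?X i v) = vsc s v" if "v \<in> ?W" for v
            using q'(2)[THEN spec, of v] lin_zero[OF X_lin, of i]
            by (simp only: shifted_kills[OF q that] shifted_kills[OF q'(1) that]) simp
          then have "\<forall>v\<in>?W. q (?X i v) = vsc s v" by blast
          then show "\<exists>s. \<forall>v\<in>?W. q (?X i v) = vsc s v" ..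
        qed
        then obtain s where s: "\<And>i v. v \<in> ?W \<Longrightarrow> q (?X i v) = vsc (s i) v" by metis
        note ql = annihilation_lin[OF q]
        have e: "q (u v) = vsc (\<Sum>i<Suc n. c i * s i) v" if "v \<in> ?W" for v
          unfolding u_def lin_sum[OF ql] lin_scale[OF ql] s[OF that] m.scale_scale m.scale_sum_left ..
        have "vsc (\<Sum>i<Suc n. c i * s i) w0 = 0" using kill[OF q] e[OF w0] by (simp only: u_def)
        with w0_0 have "(\<Sum>i<Suc n. c i * s i) = 0" by (simp only: m.scale_eq_0_iff) simp
        with e[OF w] show ?thesis by simp
      qed
      then show ?thesis
        unfolding weight_space_def shifted_def
        using fun_span.gen[of _ "shifted A' l" vsc] by (fastforce simp: shifted_def)
    qed
    define e where "e = (\<Sum>i<n. scale (c i) (\<delta> i))"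
    define t where "t = c n"
    have u: "u w = actV e w + vsc t (?T w)" for w
      by (simp add: u_def e_def t_def act_sum_left)
    have "e \<in> range \<iota>"
    proof -
      have "\<forall>i. \<exists>y. i < n \<longrightarrow> \<delta> i = \<iota> y" using delta_range by blast
      then obtain y where "\<And>i. i < n \<Longrightarrow> \<delta> i = \<iota> (y i)" by metis
      then have "e = \<iota> (\<Sum>i<n. sd (c i) (y i))"
        by (simp add: e_def lin_sum[OF iota_lin] lin_scale[OF iota_lin])
      then show ?thesis by blast
    qed
    then have prim: "primitive e" using primitive_iota by auto
    have xe: "lin scale (*) (\<lambda>h. x (h * e))" if "lin scale (*) x" for x
      using that by (simp add: lin_def alg_simps)
    have "e = 0"
    proof (cases "t = 0")
      case True
      \<comment> \<open>The coefficient of the weight at \<open>a0\<close> spans a space that is stable under \<open>e\<close>.\<close>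
      obtain f where f: "\<And>x. lin scale (*) x \<Longrightarrow> l a0 x = x f"
        using weight_element[OF w0_0, of a0 "l a0"] weight_spaceD[OF w0 a0(1)] by blast
      have "f \<noteq> 0" using f[OF a0(2)] a0(3) lin_zero[OF a0(2)] by auto
      have "f * e = 0"
      proof (rule functionals_separate)
        fix x assume x: "lin scale (*) x"
        have "actV e w0 \<in> ?W" using uW[OF w0] by (simp add: u True)
        from weight_spaceD[OF this a0(1) x] weight_spaceD[OF w0 a0(1) x] weight_spaceD[OF w0 a0(1) xe[OF x]]
        have "vsc (l a0 (\<lambda>h. x (h * e))) w0 = 0"
          using op_primitive[OF x prim, of a0 w0] by (simp add: lin_scale[OF act_lin_right])
        then have "l a0 (\<lambda>h. x (h * e)) = 0" using w0_0 by simp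
        then show "x (f * e) = x 0" using f[OF xe[OF x]] lin_zero[OF x] by simp
      qed
      show ?thesis
      proof (rule primitive_fin_dim_stable[OF prim, of "span {f}" f])
        show "fin_dim scale (span {f})" by (rule fin_dim_span_finite) simp
        show "h * e \<in> span {f}" if "h \<in> span {f}" for h
          using that \<open>f * e = 0\<close> by (auto simp: span_singleton scale_mult_left intro: exI[of _ 0])
      qed (simp_all add: \<open>f \<noteq> 0\<close> span_base)
    next
      case False
      \<comment> \<open>\<open>E\<close> is the space of coefficients of all \<open>b * w\<close>, \<open>w \<in> W\<close>, modulo \<open>W\<close>.\<close>
      define N where "N = {y. lin scale (*) y \<and> (\<forall>w\<in>?W. op b y w \<in> ?W)}"
      define E where "E = {h. \<forall>y\<in>N. y h = 0}"
      have N_stable: "(\<lambda>h. y (h * e)) \<in> N" if "y \<in> N" for y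
      proof -
        from that have y: "lin scale (*) y" and yW: "\<And>w. w \<in> ?W \<Longrightarrow> op b y w \<in> ?W" by (auto simp: N_def)
        have "op b (\<lambda>h. y (h * e)) w \<in> ?W" if w: "w \<in> ?W" for w
        proof -
          obtain r where r: "r \<in> ops A'" "\<And>v. op b y (?T v) = ?T (op b y v) + r v"
            using commutators_inD[OF AA b(1) b(1) y b(2)] by blast
          obtain s where "\<forall>v\<in>?W. r v = vsc s v" using ops_scalar[OF r(1)] by blast
          then have rw: "r w = vsc s w" using w by blast
          have e1: "actV e v = u v - vsc t (?T v)" for v by (simp add: u)
          have "op b (\<lambda>h. y (h * e)) w = actV e (op b y w) - op b y (actV e w)"
            by (simp add: op_primitive[OF y prim])
          also have "\<dots> = (u (op b y w) - vsc t (?T (op b y w))) - (op b y (u w) - vsc t (?T (op b y w) + r w))"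
            unfolding e1 by (simp only: lin_diff[OF op_lin[OF y]] lin_scale[OF op_lin[OF y]] r(2))
          also have "\<dots> = u (op b y w) - op b y (u w) + vsc t (vsc s w)"
            unfolding rw by (simp add: m.scale_right_distrib)
          also have "\<dots> \<in> ?W"
            using w yW uW by (intro m.subspace_add m.subspace_diff m.subspace_scale W_sub) auto
          finally show ?thesis .
        qed
        then show ?thesis using xe[OF y] by (simp add: N_def)
      qed
      have E_stable: "h * e \<in> E" if "h \<in> E" for h
        using that N_stable by (fastforce simp: E_def)
      have "fin_dim scale E"
      proof -
        obtain C where C: "C \<subseteq> ?W" "m.independent C" "?W \<subseteq> m.span C"
          by (rule m.maximal_independent_subset)
        obtain D where D: "finite D" "?W \<subseteq> m.span D"
          using weight_space_fin_dim[OF a0(1,2), of l] a0(3) by (auto simp: fin_dim_def)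
        have fC: "finite C" using m.independent_span_bound[OF D(1) C(2)] C(1) D(2) by auto
        have "\<forall>v. \<exists>R. finite R \<and> (\<forall>y. lin scale (*) y \<longrightarrow> (\<forall>h\<in>R. y h = 0) \<longrightarrow> op b y v = 0)"
        proof
          fix v
          obtain I h where I: "finite (I :: ('h \<times> 'v) set)"
            "\<And>x. lin scale (*) x \<Longrightarrow> op b x v = (\<Sum>i\<in>I. vsc (x (h i)) (snd i))" by (rule op_local[of b v]) blast
          then show "\<exists>R. finite R \<and> (\<forall>y. lin scale (*) y \<longrightarrow> (\<forall>h\<in>R. y h = 0) \<longrightarrow> op b y v = 0)"
            by (intro exI[of _ "h ` I"]) simp
        qed
        then obtain R where R: "\<And>v. finite (R v)"
          "\<And>v y. lin scale (*) y \<Longrightarrow> \<forall>h\<in>R v. y h = 0 \<Longrightarrow> op b y v = 0" by metis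
        have "h \<in> span (\<Union>c\<in>C. R c)" if "h \<in> E" for h
        proof (rule ccontr)
          assume "h \<notin> span (\<Union>c\<in>C. R c)"
          then obtain y where y: "lin scale (*) y" "\<And>g. g \<in> span (\<Union>c\<in>C. R c) \<Longrightarrow> y g = 0" "y h = 1"
            using functional_separates[OF subspace_span] by blast
          have "op b y w = 0" if "w \<in> ?W" for w
          proof -
            have 0: "op b y c = 0" if "c \<in> C" for c
              by (rule R(2)[OF y(1)]) (use that y(2) in \<open>blast intro: span_base\<close>)
            have "w \<in> m.span C" using that C(3) by blast
            then show ?thesis
              by (induct rule: m.span_induct_alt)
                (simp_all add: 0 lin_zero[OF op_lin[OF y(1)]] lin_add[OF op_lin[OF y(1)]] lin_scale[OF op_lin[OF y(1)]])
          qed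
          then have "y \<in> N" using y(1) m.subspace_0[OF W_sub] by (simp add: N_def)
          with \<open>h \<in> E\<close> y(3) show False by (auto simp: E_def)
        qed
        then show ?thesis using fC R(1) by (auto simp: fin_dim_def intro!: exI[of _ "\<Union>c\<in>C. R c"])
      qed
      obtain k where k: "lin vsc (*) k" "\<And>v. v \<in> ?W \<Longrightarrow> k v = 0" "k (?T w0) = 1"
        using m.functional_separates[OF W_sub unstable] by blast
      obtain I h where I: "finite (I :: ('h \<times> 'v) set)"
        "\<And>x. lin scale (*) x \<Longrightarrow> op b x w0 = (\<Sum>i\<in>I. vsc (x (h i)) (snd i))" by (rule op_local[of b w0]) blast
      define h0 where "h0 = (\<Sum>i\<in>I. scale (k (snd i)) (h i))"
      have h0: "y h0 = k (op b y w0)" if "lin scale (*) y" for y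
        by (simp add: h0_def I(2)[OF that] lin_sum[OF that] lin_scale[OF that] lin_sum[OF k(1)] lin_scale[OF k(1)] mult.commute)
      have "y h0 = 0" if "y \<in> N" for y
      proof -
        have y: "lin scale (*) y" "op b y w0 \<in> ?W" using that w0 by (auto simp: N_def)
        show ?thesis using h0[OF y(1)] k(2)[OF y(2)] by simp
      qed
      then have "h0 \<in> E" by (simp add: E_def)
      moreover have "h0 \<noteq> 0" using h0[OF b(2)] k(3) lin_zero[OF b(2)] by auto
      ultimately show ?thesis
        using primitive_fin_dim_stable[OF prim \<open>fin_dim scale E\<close> E_stable] by blast
    qed
    then have "c i = 0" if "i < n" for i using delta_indep[of c i] that by (simp add: e_def)
    with c have "t \<noteq> 0" unfolding t_def by (metis less_SucE)
    moreover have "vsc t (?T w0) \<in> ?W" using uW[OF w0] \<open>e = 0\<close> lin_zero[OF act_lin_left, of w0] by (simp add: u)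
    then have "vsc (inverse t) (vsc t (?T w0)) \<in> ?W" by (rule m.subspace_scale[OF W_sub])
    ultimately show False using unstable by simp
  qed
  obtain q where dual: "dual q"
    using dual_exists[OF fun_span.add fun_span.scale nondeg] by blast
  obtain k0 where k0: "w0 \<in> filt k0" using filt_exhausts by blast
  obtain c where c: "\<And>x K v. lin scale (*) x \<Longrightarrow> v \<in> filt K \<Longrightarrow> op b x v \<in> filt (K + c)" using op_filt[of b] by blast
  have X_filt: "foldr ?X us w0 \<in> filt (k0 + (c + 1) * length us)" for us
  proof (induct us)
    case (Cons i us)
    let ?K = "k0 + (c + 1) * length us"
    have "?X i (foldr ?X us w0) \<in> filt (?K + (c + 1))"
    proof (cases "i < n")
      case True
      have "filt (Suc ?K) \<subseteq> filt (?K + (c + 1))" by (rule filt_mono) simp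
      with filt_delta[OF True Cons] True show ?thesis by auto
    next
      case False
      have "filt (?K + c) \<subseteq> filt (?K + (c + 1))" by (rule filt_mono) simp
      with c[OF b(2) Cons] False show ?thesis by auto
    qed
    moreover have "?K + (c + 1) = k0 + (c + 1) * length (i # us)" by simp
    ultimately show ?case by (simp only: foldr_Cons o_apply)
  qed (simp add: k0)
  \<comment> \<open>There are \<open>(Q + 1)\<^sup>n\<^sup>+\<^sup>1\<close> independent monomials in a space of dimension \<open>O(Q\<^sup>n)\<close>.\<close>
  define M where "M = k0 + (c + 1) * Suc n + 1"
  define Q where "Q = card B * M ^ n"
  define \<M> where "\<M> = (\<lambda>f. \<Sum>i<Suc n. replicate_mset (f i) i) ` ({..<Suc n} \<rightarrow>\<^sub>E {..Q})"
  have count: "count (\<Sum>i<Suc n. replicate_mset (f i) i) j = f j" if "j < Suc n" for f j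
    using that by (simp add: count_sum del: sum.lessThan_Suc) 
  have inj: "inj_on (\<lambda>f. \<Sum>i<Suc n. replicate_mset (f i) i) ({..<Suc n} \<rightarrow>\<^sub>E {..Q})"
  proof (rule inj_onI)
    fix f g assume f: "f \<in> {..<Suc n} \<rightarrow>\<^sub>E {..Q}" "g \<in> {..<Suc n} \<rightarrow>\<^sub>E {..Q}"
      and "(\<Sum>i<Suc n. replicate_mset (f i) i) = (\<Sum>i<Suc n. replicate_mset (g i) i)"
    then have "f j = g j" if "j < Suc n" for j using count[OF that] by metis
    with f show "f = g" by (intro PiE_ext) auto
  qed
  have cardM: "card \<M> = (Q + 1) ^ Suc n" by (simp add: \<M>_def card_image[OF inj] card_PiE del: sum.lessThan_Suc)
  have finM: "finite \<M>" unfolding \<M>_def by (intro finite_imageI finite_PiE) auto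
  define K where "K = k0 + (c + 1) * (Suc n * Q)"
  obtain T where T: "finite T" "card T \<le> card B * (K + 1) ^ n" "filt K \<subseteq> m.span T" by (rule filt_dimension)
  have "card \<M> \<le> card T"
  proof (rule monomials_dimension[OF dual w0_0 finM T(1)])
    fix N assume "N \<in> \<M>"
    then obtain f where f: "f \<in> {..<Suc n} \<rightarrow>\<^sub>E {..Q}" and N: "N = (\<Sum>i<Suc n. replicate_mset (f i) i)"
      by (auto simp: \<M>_def simp del: sum.lessThan_Suc)
    have set: "set_mset N \<subseteq> {..<Suc n}" unfolding N by (subst set_mset_sum) (auto split: if_splits)
    have "size (\<Sum>i<m. replicate_mset (f i) i) = (\<Sum>i<m. f i)" for m by (induct m) simp_all
    then have "size N = (\<Sum>i<Suc n. f i)" unfolding N .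
    also have "\<dots> \<le> (\<Sum>i<Suc n. Q)" by (rule sum_mono) (use f in auto)
    also have "\<dots> = Suc n * Q" by simp
    finally have "length (sorted_list_of_multiset N) \<le> Suc n * Q"
      by (metis mset_sorted_list_of_multiset size_mset)
    then have "k0 + (c + 1) * length (sorted_list_of_multiset N) \<le> K" unfolding K_def by (intro add_left_mono mult_left_mono) auto
    then have "foldr ?X (sorted_list_of_multiset N) w0 \<in> filt K" using X_filt filt_mono by blast
    with set T(3) show "set_mset N \<subseteq> {..<Suc n} \<and> foldr ?X (sorted_list_of_multiset N) w0 \<in> m.span T" by blast
  qed
  also have "\<dots> \<le> card B * (M * (Q + 1)) ^ n"
  proof -
    have "K + 1 \<le> M * (Q + 1)" by (simp add: K_def M_def algebra_simps)
    then have "card B * (K + 1) ^ n \<le> card B * (M * (Q + 1)) ^ n" by (intro mult_left_mono power_mono) auto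
    with T(2) show ?thesis by (rule order_trans)
  qed
  also have "\<dots> = Q * (Q + 1) ^ n" by (simp only: Q_def power_mult_distrib mult.assoc)
  finally show False by (simp add: cardM)
qed

text \<open>
  The commutator acts on the weight space as a scalar \<open>s\<close>. If \<open>s \<noteq> 0\<close>, then \<open>op b y\<close> is a creation operator for
  an eigenvector of \<open>op a x\<close>, so its powers generate an infinite-dimensional subspace of the finite-dimensional
  weight space. This replaces the trace argument in Lie's theorem.
\<close>

lemma weight_space_commute:
  assumes AA: "commutators_in A A'" and a0: "a0 \<in> A'" "lin scale (*) x0" "l a0 x0 \<noteq> 0"
    and a: "a \<in> A" "lin scale (*) x" and b: "b \<in> A" "lin scale (*) y" and w: "w \<in> weight_space A' l"
  shows "op a x (op b y w) = op b y (op a x w)"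
proof (cases "w = 0")
  case True
  then show ?thesis by (simp add: lin_zero[OF op_lin[OF a(2)]] lin_zero[OF op_lin[OF b(2)]])
next
  case False
  let ?W = "weight_space A' l" and ?S = "op a x" and ?T = "op b y"
  have stable: "?S v \<in> ?W" "?T v \<in> ?W" if "v \<in> ?W" for v
    using weight_space_stable[where l = l, OF AA a0] a b that by blast+
  have fd: "fin_dim vsc ?W" by (rule weight_space_fin_dim[where l = l, OF a0])
  obtain r where r: "r \<in> ops A'" "\<And>v. ?S (?T v) = ?T (?S v) + r v"
    using commutators_inD[OF AA a(1) b(1) a(2) b(2)] by blast
  obtain s q where q: "q \<in> fun_span vsc (shifted A' l)" and s: "\<And>v. r v = vsc s v + q v"
    using ops_shift[OF r(1)] by blast
  have rW: "r v = vsc s v" if "v \<in> ?W" for v using s shifted_kills[OF q that] by simp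
  have "s = 0"
  proof (rule ccontr)
    assume "s \<noteq> 0"
    obtain \<alpha> u where u: "u \<in> ?W" "u \<noteq> 0" "?S u = vsc \<alpha> u"
      using eigenvector_exists[OF vs_msc op_lin[OF a(2)] stable(1) weight_space_sub fd w False] by metis
    let ?g = "\<lambda>v. ?S v - vsc \<alpha> v"
    let ?G = "insert ?g (shifted A' l)"
    have gl: "lin vsc vsc h" if "h \<in> ?G" for h
      using that shifted_lin op_lin[OF a(2)]
      by (auto simp: lin_def m.scale_right_distrib m.scale_right_diff_distrib mult.commute)
    have comm: "\<exists>c. \<exists>q'\<in>fun_span vsc ?G. \<forall>v. h (?T v) = ?T (h v) + vsc c v + q' v" if "h \<in> ?G" for h
      using that
    proof
      assume h: "h = ?g"
      have "q \<in> fun_span vsc ?G" by (rule fun_span_mono[OF q]) auto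
      then show ?thesis unfolding h
        by (intro exI[of _ s] bexI[of _ q])
          (auto simp: r(2) s lin_diff[OF op_lin[OF b(2)]] lin_scale[OF op_lin[OF b(2)]])
    next
      assume "h \<in> shifted A' l"
      then obtain c q' where "q' \<in> fun_span vsc (shifted A' l)" "\<forall>v. h (?T v) = ?T (h v) + vsc c v + q' v"
        using shifted_commutator_op[OF AA b] by blast
      then show ?thesis using fun_span_mono[of q' vsc "shifted A' l" ?G] by blast
    qed
    have kill: "h u = 0" if "h \<in> fun_span vsc ?G" for h
      using that by (induct rule: fun_span.induct) (use u shifted_kills[OF fun_span.gen] in auto)
    interpret heisenberg vsc "\<lambda>_. ?T" 1 "fun_span vsc ?G" u
    proof
      show "lin vsc vsc ?T" by (rule op_lin[OF b(2)])
      show "lin vsc vsc h" if "h \<in> fun_span vsc ?G" for h by (rule m.fun_span_lin[OF that gl])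
      show "h u = 0" if "h \<in> fun_span vsc ?G" for h by (rule kill[OF that])
      show "\<exists>c. \<exists>q'\<in>fun_span vsc ?G. \<forall>v. h (?T v) = ?T (h v) + vsc c v + q' v" if "h \<in> fun_span vsc ?G" for h
        by (rule m.fun_span_commutator[OF that op_lin[OF b(2)] comm])
    qed
    have "\<exists>i. (?T ^^ i) u \<notin> ?W"
    proof (rule powers_not_fin_dim[OF refl _ _ u(2) fd])
      show "(\<lambda>v. vsc (inverse s) (?g v)) \<in> fun_span vsc ?G" by (intro fun_span.scale fun_span.gen) simp
      show "vsc (inverse s) (?g (?T u)) = u"
        using \<open>s \<noteq> 0\<close> by (simp add: r(2) rW[OF u(1)] u(3) lin_scale[OF op_lin[OF b(2)]])
    qed
    moreover have "(?T ^^ i) u \<in> ?W" for i by (induct i) (simp_all add: u(1) stable(2))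
    ultimately show False by blast
  qed
  then show ?thesis by (simp add: r(2) rW[OF w])
qed

lemma common_eigenvector_in:
  assumes Z: "m.subspace Z" "fin_dim vsc Z" "\<exists>u\<in>Z. u \<noteq> 0"
    and stable: "\<And>a x u. a \<in> A \<Longrightarrow> lin scale (*) x \<Longrightarrow> u \<in> Z \<Longrightarrow> op a x u \<in> Z"
    and comm: "\<And>a b x y u. a \<in> A \<Longrightarrow> b \<in> A \<Longrightarrow> lin scale (*) x \<Longrightarrow> lin scale (*) y \<Longrightarrow> u \<in> Z \<Longrightarrow>
      op a x (op b y u) = op b y (op a x u)"
  shows "\<exists>u l. u \<noteq> 0 \<and> u \<in> weight_space A l"
proof -
  have "\<exists>u\<in>Z. u \<noteq> 0 \<and> (\<forall>T\<in>{op a x | a x. a \<in> A \<and> lin scale (*) x}. \<exists>\<alpha>. T u = vsc \<alpha> u)"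
  proof (rule common_eigenvector_of_commuting[OF vs_msc _ _ _ Z])
    fix T T' z assume "T \<in> {op a x | a x. a \<in> A \<and> lin scale (*) x}" "T' \<in> {op a x | a x. a \<in> A \<and> lin scale (*) x}" "z \<in> Z"
    then show "T (T' z) = T' (T z)" by (elim CollectE exE conjE) (simp only: comm)
  qed (auto simp: op_lin stable)
  then obtain u where u: "u \<noteq> 0" "\<And>a x. a \<in> A \<Longrightarrow> lin scale (*) x \<Longrightarrow> \<exists>\<alpha>. op a x u = vsc \<alpha> u" by blast
  have "u \<in> weight_space A (\<lambda>a x. SOME \<alpha>. op a x u = vsc \<alpha> u)"
    unfolding weight_space_def using someI_ex[OF u(2)] by auto
  with u(1) show ?thesis by blast
qed

text \<open>
  In each case there is a nonzero finite-dimensional space on which the operators of \<open>A\<close> act and commute. If the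
  weight \<open>l\<close> is nonzero, it is the weight space \<open>W\<close>. If \<open>l\<close> vanishes, the operators of \<open>A\<close> commute on \<open>W\<close>, which
  may be infinite-dimensional. Then choose \<open>op a x\<close> and \<open>w0\<close> in \<open>W\<close> with \<open>op a x w0 \<noteq> 0\<close>, and let \<open>F\<close> be the space of
  all \<open>w\<close> in \<open>W\<close> such that \<open>a * w\<close> involves only the coefficients in \<open>H\<close> that occur in \<open>a * w0\<close>. It is stable, and
  \<open>op a x\<close> maps it to a stable space which is finite-dimensional by \<open>fin_dim_bounded_coefficients\<close>.
\<close>

lemma common_eigenvector_step:
  assumes AA: "commutators_in A A'" and v: "v \<noteq> 0" "v \<in> weight_space A' l"
  shows "\<exists>u l'. u \<noteq> 0 \<and> u \<in> weight_space A l'"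
proof (cases "\<exists>a\<in>A'. \<exists>x. lin scale (*) x \<and> l a x \<noteq> 0")
  case True
  then obtain a0 x0 where a0: "a0 \<in> A'" "lin scale (*) x0" "l a0 x0 \<noteq> 0" by blast
  show ?thesis
  proof (rule common_eigenvector_in)
    show "m.subspace (weight_space A' l)" by (rule weight_space_sub)
    show "fin_dim vsc (weight_space A' l)" by (rule weight_space_fin_dim[where l = l, OF a0])
    show "\<exists>u\<in>weight_space A' l. u \<noteq> 0" using v by blast
  qed (rule weight_space_stable[where l = l, OF AA a0] weight_space_commute[where l = l, OF AA a0]; assumption)+
next
  case False
  let ?W = "weight_space A' l"
  have kill: "op a x w = 0" if "w \<in> ?W" "a \<in> A'" "lin scale (*) x" for a x w
    using weight_spaceD[OF that] that False by simp
  have ops0: "r w = 0" if "r \<in> ops A'" "w \<in> ?W" for r w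
    using that(1) unfolding ops_def
    by (induct rule: fun_span.induct) (auto simp: kill[OF that(2)])
  have comm: "op a x (op b y w) = op b y (op a x w)"
    if ab: "a \<in> A" "b \<in> A" "lin scale (*) x" "lin scale (*) y" and w: "w \<in> ?W" for a b x y w
  proof -
    obtain r where r: "r \<in> ops A'" "\<And>v. op a x (op b y v) = op b y (op a x v) + r v"
      using commutators_inD[OF AA ab] by blast
    show ?thesis by (simp add: r(2) ops0[OF r(1) w])
  qed
  have W_0: "w \<in> ?W" if "\<And>a x. a \<in> A' \<Longrightarrow> lin scale (*) x \<Longrightarrow> op a x w = 0" for w
    using False that by (auto simp: weight_space_def)
  have stable: "op b y w \<in> ?W" if "b \<in> A" "lin scale (*) y" "w \<in> ?W" for b y w
  proof (rule W_0)
    fix a x assume a: "a \<in> A'" "lin scale (*) x"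
    then have "a \<in> A" using AA by (auto simp: commutators_in_def)
    from comm[OF this that(1) a(2) that(2,3)] show "op a x (op b y w) = 0"
      by (simp add: kill[OF that(3) a] lin_zero[OF op_lin[OF that(2)]])
  qed
  show ?thesis
  proof (cases "\<exists>a\<in>A. \<exists>x. lin scale (*) x \<and> (\<exists>w\<in>?W. op a x w \<noteq> 0)")
    case False
    with v(2) have "op a x v = 0" if "a \<in> A" "lin scale (*) x" for a x using that by blast
    then have "v \<in> weight_space A (\<lambda>_ _. 0)" by (simp add: weight_space_def)
    with v(1) show ?thesis by blast
  next
    case True
    then obtain a x w0 where a: "a \<in> A" "lin scale (*) x" and w0: "w0 \<in> ?W" "op a x w0 \<noteq> 0" by blast
    note T = op_lin[OF a(2)]
    obtain I h where I: "finite (I :: ('h \<times> 'v) set)"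
      "\<And>x. lin scale (*) x \<Longrightarrow> op a x w0 = (\<Sum>i\<in>I. vsc (x (h i)) (snd i))" by (rule op_local[of a w0]) blast
    define F where "F = {w \<in> ?W. \<forall>y. lin scale (*) y \<longrightarrow> (\<forall>e\<in>h ` I. y e = 0) \<longrightarrow> op a y w = 0}"
    have F_sub: "m.subspace F"
      using weight_space_sub[of A' l]
      by (auto simp: F_def m.subspace_def lin_zero[OF op_lin] lin_add[OF op_lin] lin_scale[OF op_lin])
    have w0F: "w0 \<in> F" using w0(1) I(2) by (simp add: F_def)
    have FW: "w \<in> ?W" if "w \<in> F" for w using that by (simp add: F_def)
    have F_stable: "op b y w \<in> F" if "b \<in> A" "lin scale (*) y" "w \<in> F" for b y w
    proof -
      have "op a x' (op b y w) = 0" if x': "lin scale (*) x'" "\<forall>e\<in>h ` I. x' e = 0" for x'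
      proof -
        have "op a x' w = 0" using \<open>w \<in> F\<close> x' by (simp add: F_def)
        then show ?thesis
          using comm[OF a(1) \<open>b \<in> A\<close> x'(1) \<open>lin scale (*) y\<close> FW[OF \<open>w \<in> F\<close>]] lin_zero[OF op_lin[OF \<open>lin scale (*) y\<close>]]
          by simp
      qed
      with stable[OF that(1,2) FW[OF that(3)]] show ?thesis by (simp add: F_def)
    qed
    show ?thesis
    proof (rule common_eigenvector_in)
      interpret T: module_hom vsc vsc "op a x"
        using lin_imp_linear[OF vs_msc vs_msc T] by (rule module_hom_linearI)
      show "m.subspace (op a x ` F)" by (rule T.subspace_image[OF F_sub])
      show "fin_dim vsc (op a x ` F)"
      proof (rule fin_dim_bounded_coefficients[OF finitely_generated, of "h ` I" F a])
        show "op a y w = 0" if "w \<in> F" "lin scale (*) y" "\<And>e. e \<in> h ` I \<Longrightarrow> y e = 0" for y w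
          using that by (auto simp: F_def)
      qed (use I(1) F_sub T a(2) in auto)
      show "\<exists>u\<in>op a x ` F. u \<noteq> 0" using w0F w0(2) by blast
    next
      fix b y u assume b: "b \<in> A" "lin scale (*) y" and "u \<in> op a x ` F"
      then obtain w where w: "w \<in> F" "u = op a x w" by blast
      have "op b y u = op a x (op b y w)"
        unfolding w(2) by (rule comm[OF b(1) a(1) b(2) a(2) FW[OF w(1)]])
      with F_stable[OF b w(1)] show "op b y u \<in> op a x ` F" by blast
    next
      fix b c y z u assume "b \<in> A" "c \<in> A" "lin scale (*) y" "lin scale (*) z" "u \<in> op a x ` F"
      then show "op b y (op c z u) = op c z (op b y u)"
        using stable[OF a FW] by (intro comm) auto
    qed
  qed
qed

lemma derived_commutators: "commutators_in (L.derived k) (L.derived (Suc k))"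
proof -
  have sub: "L.derived (Suc k) \<subseteq> L.derived k" for k
  proof (induct k)
    case (Suc k)
    then show ?case
      unfolding L.derived.simps(2)[of "Suc k"] L.derived.simps(2)[of k] L.bracket_span_def
      by (intro ad.m.span_mono) (auto simp: L.bracket_span_def)
  qed simp
  have "(\<lambda>v. op a x (op b y v) - op b y (op a x v)) \<in> ops (L.derived (Suc k))"
    if ab: "a \<in> L.derived k" "b \<in> L.derived k" and x: "lin scale (*) x" and y: "lin scale (*) y" for a b x y
  proof -
    obtain E z z' where E: "finite (E :: 'h set)" "\<And>e. e \<in> E \<Longrightarrow> lin scale (*) (z e)" "\<And>e. e \<in> E \<Longrightarrow> lin scale (*) (z' e)"
      "\<And>v. op a x (op b y v) - op b y (op a x v) = (\<Sum>e\<in>E. op (L.x_bracket a (z e) b) (z' e) v)"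
      by (rule commutator_op[OF x y, of a b]) blast
    have "L.x_bracket a (z e) b \<in> L.derived (Suc k)" if "e \<in> E" for e
      unfolding L.derived.simps L.bracket_span_def
      by (rule ad.m.span_base) (use ab lin_imp_linear[OF vs_scale vector_space_mult E(2)[OF that]] in blast)
    then show ?thesis
      unfolding E(4) ops_def by (intro fun_span_sum fun_span.gen) (use E(3) in blast)
  qed
  with sub show ?thesis by (simp add: commutators_in_def del: L.derived.simps)
qed

lemma eigenvector_of_solvable:
  assumes "L.solvable" and v: "(v :: 'v) \<noteq> 0"
  shows "\<exists>u l. u \<noteq> 0 \<and> u \<in> weight_space UNIV l"
proof -
  obtain N where N: "L.derived N = {0}" using assms(1) by (auto simp: L.solvable_def)
  have "\<exists>u l. u \<noteq> 0 \<and> u \<in> weight_space (L.derived k) l" if "k \<le> N" for k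
    using that
  proof (induct rule: inc_induct)
    case base
    have "v \<in> weight_space (L.derived N) (\<lambda>_ _. 0)"
      by (simp add: N weight_space_def lin_zero[OF op_lin_left])
    with v show ?case by blast
  next
    case (step k)
    then show ?case using common_eigenvector_step[OF derived_commutators] by blast
  qed
  from this[of 0] show ?thesis by simp
qed

lemma eigenvector_pseudo:
  assumes u: "u \<noteq> 0" "u \<in> weight_space UNIV l"
  shows "\<exists>\<phi>. left_module_hom actL (*) \<phi> \<and> (\<forall>a. mact a u = coset (rel2M actV) (basis_vec ((\<phi> a, 1), u)))"
proof -
  have w: "op a x u = vsc (l a x) u" if "lin scale (*) x" for a x
    using weight_spaceD[OF u(2) _ that] by simp
  have "\<forall>a. \<exists>f. \<forall>x. lin scale (*) x \<longrightarrow> l a x = x f"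
    using weight_element[OF u(1) w] by metis
  then obtain \<phi> where phi: "\<And>a x. lin scale (*) x \<Longrightarrow> l a x = x (\<phi> a)" by metis
  have op: "op a x u = vsc (x (\<phi> a)) u" if "lin scale (*) x" for a x
    using w[OF that] phi[OF that] by simp
  have "\<phi> (a + b) = \<phi> a + \<phi> b" for a b
  proof (rule functionals_separate)
    fix x assume x: "lin scale (*) x"
    have "vsc (x (\<phi> (a + b))) u = vsc (x (\<phi> a + \<phi> b)) u"
      using lin_add[OF op_lin_left[OF x], of a b u] by (simp add: op[OF x] lin_add[OF x] m.scale_left_distrib)
    with u(1) show "x (\<phi> (a + b)) = x (\<phi> a + \<phi> b)" by simp
  qed
  moreover have "\<phi> (actL f a) = f * \<phi> a" for f a
  proof (rule functionals_separate)
    fix x assume x: "lin scale (*) x"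
    have fx: "lin scale (*) (\<lambda>h. x (f * h))" using x by (simp add: lin_def alg_simps)
    have "vsc (x (\<phi> (actL f a))) u = vsc (x (f * \<phi> a)) u"
      using op[OF x, of "actL f a"] op[OF fx, of a] by (auto simp: op_act[OF x])
    with u(1) show "x (\<phi> (actL f a)) = x (f * \<phi> a)" by simp
  qed
  moreover have "mact a u = coset (rel2M actV) (basis_vec ((\<phi> a, 1), u))" for a
  proof (rule pseudo_eq_coset)
    let ?X = "rep (mact a u)"
    have "embed (basis_vec (\<phi> a, u) - straighten ?X) \<in> rel2M actV"
      by (rule embed_in_rel2M) (simp add: m.lin_ext_diff op_straighten[symmetric] op)
    then have "basis_vec ((\<phi> a, 1), u) - embed (straighten ?X) \<in> rel2M actV"
      by (simp add: embed_def fs.lin_ext_diff)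
    from fs.subspace_add[OF rel2M_sub this embed_straighten[of ?X]]
    show "basis_vec ((\<phi> a, 1), u) \<in> mact a u" by (intro pseudo_memI[OF rep_pseudo]) simp
  qed
  ultimately show ?thesis by (auto simp: left_module_hom_def)
qed

end

text \<open>
  A basis of the image of the Lie algebra in \<open>H\<close> and a finite set of generators put the module into the setting
  of the previous section.
\<close>

theorem theorem14p3:
  fixes sd :: "'k::{alg_closed_field, field_char_0} \<Rightarrow> 'd::ab_group_add \<Rightarrow> 'd"
    and lb :: "'d \<Rightarrow> 'd \<Rightarrow> 'd"
    and gmul :: "'g \<Rightarrow> 'g \<Rightarrow> 'g" and gone :: 'g and ginv :: "'g \<Rightarrow> 'g"
    and gact :: "'g \<Rightarrow> 'd \<Rightarrow> 'd"
    and scale :: "'k \<Rightarrow> 'h::ring_1 \<Rightarrow> 'h"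
    and \<Delta> :: "'h \<Rightarrow> ('h \<times> 'h \<Rightarrow>\<^sub>0 'k) set" and \<epsilon> :: "'h \<Rightarrow> 'k" and S :: "'h \<Rightarrow> 'h"
    and \<iota> :: "'d \<Rightarrow> 'h" and \<gamma> :: "'g \<Rightarrow> 'h"
    and actL :: "'h \<Rightarrow> 'l::ab_group_add \<Rightarrow> 'l"
    and br :: "'l \<Rightarrow> 'l \<Rightarrow> (('h \<times> 'h) \<times> 'l \<Rightarrow>\<^sub>0 'k) set"
    and actV :: "'h \<Rightarrow> 'v::ab_group_add \<Rightarrow> 'v"
    and mact :: "'l \<Rightarrow> 'v \<Rightarrow> (('h \<times> 'h) \<times> 'v \<Rightarrow>\<^sub>0 'k) set"
  assumes "\<exists>B. finite_dimensional_vector_space sd B"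
    and "smash_product sd lb gmul gone ginv gact scale \<Delta> \<epsilon> S \<iota> \<gamma>"
    and "lie_pseudoalgebra scale \<Delta> \<epsilon> S actL br"
    and "lie_pseudoalgebra.solvable scale S actL br"
    and "lie_pseudoalgebra_module scale \<Delta> \<epsilon> S actL br actV mact"
    and "\<exists>v :: 'v. v \<noteq> 0"
    and "finitely_generated_over (k_algebra.generated_subalgebra scale \<iota>) actV"
  shows "\<exists>v \<phi>. v \<noteq> 0 \<and> left_module_hom actL (*) \<phi> \<and>
           (\<forall>a. mact a v = coset (hopf_algebra.rel2M scale \<Delta> actV) (basis_vec ((\<phi> a, 1), v)))"
proof -
  interpret smash_product sd lb gmul gone ginv gact scale \<Delta> \<epsilon> S \<iota> \<gamma> by fact
  interpret lie_pseudoalgebra_module scale \<Delta> \<epsilon> S actL br actV mact by fact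
  obtain Bd where "finite_dimensional_vector_space sd Bd" using assms(1) by blast
  then interpret fd: finite_dimensional_vector_space sd Bd .
  have iota_lin: "lin sd scale \<iota>" by (rule iota_lin)
  obtain C where C: "C \<subseteq> range \<iota>" "independent C" "range \<iota> \<subseteq> span C"
    by (rule maximal_independent_subset)
  have "range \<iota> \<subseteq> span (\<iota> ` Bd)"
  proof
    fix y assume "y \<in> range \<iota>"
    then obtain x where y: "y = \<iota> x" by blast
    have "x \<in> d.span Bd" by (simp add: fd.span_Basis)
    then show "y \<in> span (\<iota> ` Bd)" unfolding y
    proof (induct rule: d.span_induct_alt)
      case base
      show ?case by (simp add: lin_zero[OF iota_lin] span_zero)
    next
      case (step c x y)
      then show ?case unfolding lin_add[OF iota_lin] lin_scale[OF iota_lin]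
        by (intro span_add span_scale[OF span_base] imageI)
    qed
  qed
  then have fC: "finite C"
    using independent_span_bound[OF finite_imageI[OF fd.finite_Basis] C(2)] C(1) by blast
  obtain \<delta> where bij: "bij_betw \<delta> {0..<card C} C" using ex_bij_betw_nat_finite[OF fC] by blast
  then have bij: "bij_betw \<delta> {..<card C} C" by (simp add: lessThan_atLeast0)
  then have inj: "inj_on \<delta> {..<card C}" and im: "\<delta> ` {..<card C} = C"
    by (auto simp: bij_betw_def)
  obtain B where B: "finite B" "\<forall>v. \<exists>c. (\<forall>b\<in>B. c b \<in> generated_subalgebra \<iota>) \<and> v = (\<Sum>b\<in>B. actV (c b) b)"
    using assms(7) unfolding finitely_generated_over_def by (elim exE conjE)
  interpret finite_representation sd lb gmul gone ginv gact scale \<Delta> \<epsilon> S \<iota> \<gamma> actL br actV mact "card C" \<delta> B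
  proof
    show "\<delta> i \<in> range \<iota>" if "i < card C" for i using im C(1) that by blast
    show "\<exists>c. \<iota> x = (\<Sum>i<card C. scale (c i) (\<delta> i))" for x
    proof -
      have "\<iota> x \<in> span C" using C(3) by blast
      then obtain u where "\<iota> x = (\<Sum>v\<in>C. scale (u v) v)" using span_finite[OF fC] by auto
      then have "\<iota> x = (\<Sum>i<card C. scale (u (\<delta> i)) (\<delta> i))"
        by (simp add: sum.reindex_bij_betw[OF bij, of "\<lambda>v. scale (u v) v"])
      then show ?thesis by (intro exI[of _ "\<lambda>i. u (\<delta> i)"])
    qed
    show "c i = 0" if 0: "(\<Sum>i<card C. scale (c i) (\<delta> i)) = 0" and i: "i < card C" for c i
    proof -
      let ?u = "\<lambda>v. c (the_inv_into {..<card C} \<delta> v)"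
      have "(\<Sum>v\<in>C. scale (?u v) v) = (\<Sum>i<card C. scale (?u (\<delta> i)) (\<delta> i))"
        by (rule sum.reindex_bij_betw[OF bij, symmetric])
      also have "\<dots> = 0" using 0 by (simp add: the_inv_into_f_f[OF inj])
      finally have "?u (\<delta> i) = 0" using C(2) fC im i by (intro independentD[of C C ?u]) auto
      then show ?thesis using i by (simp add: the_inv_into_f_f[OF inj])
    qed
    show "finite B" by (rule B(1))
    show "\<exists>c. (\<forall>b\<in>B. c b \<in> generated_subalgebra \<iota>) \<and> v = (\<Sum>b\<in>B. actV (c b) b)" for v by (rule spec[OF B(2)])
  qed
  obtain v :: 'v where "v \<noteq> 0" using assms(6) by blast
  then obtain u l where u: "u \<noteq> 0" "u \<in> weight_space UNIV l"
    using eigenvector_of_solvable[OF assms(4)] by blast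
  from eigenvector_pseudo[OF u] u(1) show ?thesis by blast
qed

end
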